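(* The product of polyhomomorphisms is well defined and associative. That is: (i) (well-definedness) if $G^\circ,H^\circ,K^\circ$ are unimodular second-countable locally compact groups with fixed Haar measures and $R^\circ\in\operatorname{Polh}(G^\circ,H^\circ)$, $T^\circ\in\operatorname{Polh}(H^\circ,K^\circ)$ are nonzero, then the rule for $T^\circ R^\circ$ given in the context does define a polyhomomorphism in $\operatorname{Polh}(G^\circ,K^\circ)$; (ii) for any unimodular second-countable locally compact groups with fixed Haar measures $G^\circ,H^\circ,K^\circ,L^\circ$ and any $R^\circ\in\operatorname{Polh}(G^\circ,H^\circ)$, $T^\circ\in\operatorname{Polh}(H^\circ,K^\circ)$, $S^\circ\in\operatorname{Polh}(K^\circ,L^\circ)$, $$(S^\circ T^\circ)R^\circ=S^\circ(T^\circ R^\circ).$$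
   Context: All locally compact groups are second countable. $G^\circ=(G,\gamma)$, $H^\circ=(H,\eta)$, etc. denote unimodular groups with fixed Haar measures. The set $\operatorname{Polh}(G^\circ,H^\circ)$ of polyhomomorphisms consists of: the zero measure $0_{G,H}$ on $G\times H$; and all pairs $R^\circ=(R,\rho)$ where $R\subset G\times H$ is a closed subgroup and $\rho$ is a Haar measure on $R$ whose image under the projection to $G$ is dominated by $\gamma$ (i.e. the $\rho$-measure of $R\cap(A\times H)$ is $\le\gamma(A)$ for all Borel $A$) and whose image under the projection to $H$ is dominated by $\eta$. For a subgroup $R\subset G\times H$: $\operatorname{dom}R$, $\operatorname{im}R$ are its projections to $G$ and $H$; $\ker R=\{g:(g,1)\in R\}$; $\operatorname{indef}R=\{h:(1,h)\in R\}$. For nonzero $R^\circ$ the image of $\rho$ in $G$ equals $\alpha(R^\circ)\gamma|_{\operatorname{dom}R}$ and the image in $H$ equals $\beta(R^\circ)\eta|_{\operatorname{im}R}$, with constants $0<\alpha(R^\circ),\beta(R^\circ)\le1$ (and $\operatorname{dom}R,\operatorname{im}R$ are open, $\ker R,\operatorname{indef}R$ are compact). Product: for nonzero $R^\circ\in\operatorname{Polh}(G^\circ,H^\circ)$, $T^\circ\in\operatorname{Polh}(H^\circ,K^\circ)$ the product $S^\circ=T^\circ R^\circ$ has underlying subgroup $S=TR=\{(g,k): \exists h\in H,\ (g,h)\in R,\ (h,k)\in T\}\subset G\times K$, with Haar measure on $S$ normalized by $$\alpha(S^\circ)=\frac{\alpha(R^\circ)\alpha(T^\circ)}{[\operatorname{indef}R:(\operatorname{indef}R\cap\operatorname{dom}T)]},\qquad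 \beta(S^\circ)=\frac{\beta(R^\circ)\beta(T^\circ)}{[\ker T:(\ker T\cap\operatorname{im}R)]}.$$ (Well-definedness includes that $S$ is closed, the indices are finite, and the two normalizations are consistent.) A product in which one factor is a zero polyhomomorphism is the zero polyhomomorphism. *)

theory Defs
  imports "HOL-Analysis.Analysis"
begin

text \<open>
  Topological groups are types of class \<^class>\<open>topological_group_add\<close>. Groups of class
  \<^class>\<open>group_add\<close> need not be commutative; only the notation is additive, so \<open>0\<close> is
  the neutral element and \<open>x + y\<close> the product. Locally compact groups are Hausdorff by convention.
\<close>

class lcsc_group = topological_group_add + t2_space + second_countable_topology +
  assumes locally_compact: "\<exists>U C. open U \<and> compact C \<and> x \<in> U \<and> U \<subseteq> C"

lemma locally_compact_space_lcsc_group: "locally_compact_space (euclidean :: 'a::lcsc_group topology)"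
  using locally_compact by (auto simp: locally_compact_space_def)

definition is_subgroup :: "'a::group_add set \<Rightarrow> bool" where
  "is_subgroup S \<longleftrightarrow> 0 \<in> S \<and> (\<forall>x\<in>S. \<forall>y\<in>S. x + y \<in> S) \<and> (\<forall>x\<in>S. - x \<in> S)"

definition left_cosets :: "'a::group_add set \<Rightarrow> 'a set \<Rightarrow> 'a set set" where
  "left_cosets A B = (\<lambda>a. (+) a ` B) ` A"

text \<open>The index \<open>[A : B]\<close>; it is meaningful only if \<^term>\<open>left_cosets A B\<close> is finite.\<close>

definition subgroup_index :: "'a::group_add set \<Rightarrow> 'a set \<Rightarrow> nat" where
  "subgroup_index A B = card (left_cosets A B)"

text \<open>
  A (left) Haar measure on a closed subgroup \<open>S\<close>, as a measure with underlying space \<open>S\<close> on the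
  Borel sets of the subspace topology. No regularity condition is needed: in a second countable
  locally compact Hausdorff space every Borel measure that is finite on compact sets is regular.
\<close>

definition haar_on :: "'a::{group_add, topological_space} set \<Rightarrow> 'a measure \<Rightarrow> bool" where
  "haar_on S \<mu> \<longleftrightarrow>
     space \<mu> = S \<and> sets \<mu> = sets (restrict_space borel S) \<and>
     (\<forall>x\<in>S. \<forall>A\<in>sets \<mu>. emeasure \<mu> ((+) x ` A) = emeasure \<mu> A) \<and>
     (\<forall>C. compact C \<and> C \<subseteq> S \<longrightarrow> emeasure \<mu> C < \<infinity>) \<and>
     emeasure \<mu> S \<noteq> 0"

text \<open>A Haar measure on the whole group, the group being unimodular.\<close>

definition unimodular_haar :: "'a::{group_add, topological_space} measure \<Rightarrow> bool" where
  "unimodular_haar \<mu> \<longleftrightarrow> haar_on UNIV \<mu> \<and>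
     (\<forall>x. \<forall>A\<in>sets \<mu>. emeasure \<mu> ((\<lambda>y. y + x) ` A) = emeasure \<mu> A)"

text \<open>
  For a subgroup \<open>R\<close> of a product, \<open>dom R\<close> and \<open>im R\<close> are \<^term>\<open>Domain R\<close> and \<^term>\<open>Range R\<close>.
\<close>

definition ker :: "('g::zero \<times> 'h::zero) set \<Rightarrow> 'g set" where
  "ker R = {g. (g, 0) \<in> R}"

definition indef :: "('g::zero \<times> 'h::zero) set \<Rightarrow> 'h set" where
  "indef R = {h. (0, h) \<in> R}"

text \<open>\<open>ZeroPH\<close> stands for the zero measure on the product, \<open>PH R \<rho>\<close> for the pair \<open>(R, \<rho>)\<close>.\<close>

datatype ('g, 'h) ph = ZeroPH | PH "('g \<times> 'h) set" "('g \<times> 'h) measure"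

definition Polh :: "'g::lcsc_group measure \<Rightarrow> 'h::lcsc_group measure \<Rightarrow> ('g, 'h) ph set" where
  "Polh \<gamma> \<eta> = insert ZeroPH
     {PH R \<rho> | R \<rho>. is_subgroup R \<and> closed R \<and> haar_on R \<rho> \<and>
        (\<forall>A\<in>sets borel. emeasure \<rho> (R \<inter> (A \<times> UNIV)) \<le> emeasure \<gamma> A) \<and>
        (\<forall>B\<in>sets borel. emeasure \<rho> (R \<inter> (UNIV \<times> B)) \<le> emeasure \<eta> B)}"

text \<open>
  The image of \<open>\<rho>\<close> in the first factor is \<open>\<alpha>\<close> times \<open>\<gamma>\<close> restricted to \<open>dom R\<close>, the image in the
  second factor is \<open>\<beta>\<close> times \<open>\<eta>\<close> restricted to \<open>im R\<close>.
\<close>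

definition ph_alpha :: "'g::lcsc_group measure \<Rightarrow> ('g \<times> 'h::lcsc_group) set \<Rightarrow>
    ('g \<times> 'h) measure \<Rightarrow> real" where
  "ph_alpha \<gamma> R \<rho> = (THE a. 0 < a \<and>
     distr \<rho> borel fst = scale_measure (ennreal a) (density \<gamma> (indicator (Domain R))))"

definition ph_beta :: "'h::lcsc_group measure \<Rightarrow> ('g::lcsc_group \<times> 'h) set \<Rightarrow>
    ('g \<times> 'h) measure \<Rightarrow> real" where
  "ph_beta \<eta> R \<rho> = (THE b. 0 < b \<and>
     distr \<rho> borel snd = scale_measure (ennreal b) (density \<eta> (indicator (Range R))))"

text \<open>
  The two normalizations of a Haar measure \<open>\<sigma>\<close> on \<open>S = TR\<close>. Relational composition \<^term>\<open>R O T\<close>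
  applies \<open>R\<close> first, so that \<open>TR\<close> is \<^term>\<open>R O T\<close>.
\<close>

definition alpha_normalized ::
  "'g::lcsc_group measure \<Rightarrow> 'h::lcsc_group measure \<Rightarrow>
   ('h \<times> 'k::lcsc_group) set \<Rightarrow> ('h \<times> 'k) measure \<Rightarrow>
   ('g \<times> 'h) set \<Rightarrow> ('g \<times> 'h) measure \<Rightarrow> ('g \<times> 'k) measure \<Rightarrow> bool" where
  "alpha_normalized \<gamma> \<eta> T \<tau> R \<rho> \<sigma> \<longleftrightarrow>
     ph_alpha \<gamma> (R O T) \<sigma> =
       ph_alpha \<gamma> R \<rho> * ph_alpha \<eta> T \<tau> / real (subgroup_index (indef R) (indef R \<inter> Domain T))"

definition beta_normalized ::
  "'h::lcsc_group measure \<Rightarrow> 'k::lcsc_group measure \<Rightarrow>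
   ('h \<times> 'k) set \<Rightarrow> ('h \<times> 'k) measure \<Rightarrow>
   ('g::lcsc_group \<times> 'h) set \<Rightarrow> ('g \<times> 'h) measure \<Rightarrow> ('g \<times> 'k) measure \<Rightarrow> bool" where
  "beta_normalized \<eta> \<kappa> T \<tau> R \<rho> \<sigma> \<longleftrightarrow>
     ph_beta \<kappa> (R O T) \<sigma> =
       ph_beta \<eta> R \<rho> * ph_beta \<kappa> T \<tau> / real (subgroup_index (ker T) (ker T \<inter> Range R))"

text \<open>\<open>ph_mult \<gamma> \<eta> \<kappa> T R\<close> is the product \<open>TR\<close>, the factors being in the same order.\<close>

fun ph_mult ::
  "'g::lcsc_group measure \<Rightarrow> 'h::lcsc_group measure \<Rightarrow> 'k::lcsc_group measure \<Rightarrow>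
   ('h, 'k) ph \<Rightarrow> ('g, 'h) ph \<Rightarrow> ('g, 'k) ph" where
  "ph_mult \<gamma> \<eta> \<kappa> (PH T \<tau>) (PH R \<rho>) =
     PH (R O T) (THE \<sigma>. haar_on (R O T) \<sigma> \<and>
       alpha_normalized \<gamma> \<eta> T \<tau> R \<rho> \<sigma> \<and> beta_normalized \<eta> \<kappa> T \<tau> R \<rho> \<sigma>)"
| "ph_mult \<gamma> \<eta> \<kappa> ZeroPH _ = ZeroPH"
| "ph_mult \<gamma> \<eta> \<kappa> _ ZeroPH = ZeroPH"

end

(* Counting disjoint translates shows that the projection of a polyhomomorphism R to G is proper.
   Hence its image is closed, and it is open as it has positive measure, while indef R is compact.
   A Borel section s of the projection of T to dom T turns the Haar measure of T into a measure M
   on indef T that is invariant under translations and under conjugation by im T.  The image of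
   rho restricted to h in dom T, times M, under ((g, h), n) |-> (g, n + s h) is the required Haar
   measure on TR.  Splitting indef R into cosets of indef R \<inter> dom T gives its first marginal,
   and splitting ker T gives the second one.  A Haar measure on a subgroup of this kind is
   determined by either marginal, as one sees by averaging over indef or ker, so associativity
   reduces to an identity between indices. *)
theory Submission
  imports Defs
begin

section \<open>Topology of locally compact second countable groups\<close>

text \<open>All measures are built from those given on the three groups and on \<open>R\<close> and
  \<open>T\<close>. The natural candidate on \<open>R O T\<close>, the image of a Haar measure on
  the fibre product of \<open>R\<close> and \<open>T\<close> over the middle group, would first have
  to be constructed on that fibre product; disintegrating \<tau> along a section \<open>s\<close>
  takes its place. As \<open>s\<close> is merely Borel and not a homomorphism, translating by
  \<open>(h0, k0)\<close> in \<open>T\<close> produces the defect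
  \<open>k0 + s h - s (h0 + h)\<close>, which lies in \<open>indef T\<close>, and carrying
  \<open>k0\<close> past the fibre variable costs a conjugation. This is why \<open>M\<close> has to
  be invariant from the right and under conjugation by \<open>Range T\<close>; both follow from left
  invariance and finite mass, as for Haar measure on a compact group. Uniqueness of Haar measure is
  proved on open subgroups of unimodular groups, where left and right invariant measures can be
  compared by Fubini, and reaches \<open>R\<close>, \<open>T\<close> and \<open>R O T\<close>
  through their projections. Properness and uniqueness with respect to the second factor come from
  the first through the converse relation.\<close>

instance prod :: (topological_monoid_add, topological_monoid_add) topological_monoid_add
proof
  fix a b :: "'a \<times> 'b"
  have 1: "((\<lambda>x. fst (fst x) + fst (snd x)) \<longlongrightarrow> fst a + fst b) (nhds a \<times>\<^sub>F nhds b)"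
    by (intro tendsto_add tendsto_fst filterlim_fst filterlim_snd)
  have 2: "((\<lambda>x. snd (fst x) + snd (snd x)) \<longlongrightarrow> snd a + snd b) (nhds a \<times>\<^sub>F nhds b)"
    by (intro tendsto_add tendsto_snd filterlim_fst filterlim_snd)
  show "((\<lambda>x. fst x + snd x) \<longlongrightarrow> a + b) (nhds a \<times>\<^sub>F nhds b)"
    using tendsto_Pair[OF 1 2] by (simp add: plus_prod_def)
qed

instance prod :: (topological_group_add, topological_group_add) topological_group_add
proof
  fix a :: "'a \<times> 'b"
  have 1: "((\<lambda>x. - fst x) \<longlongrightarrow> - fst a) (nhds a)" "((\<lambda>x. - snd x) \<longlongrightarrow> - snd a) (nhds a)"
    by (intro tendsto_minus tendsto_fst tendsto_snd filterlim_ident)+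
  show "(uminus \<longlongrightarrow> - a) (nhds a)"
    using tendsto_Pair[OF 1] by (simp add: uminus_prod_def[abs_def])
qed

instance prod :: (lcsc_group, lcsc_group) lcsc_group
proof
  fix x :: "'a \<times> 'b"
  obtain U C where U: "open U" "compact C" "fst x \<in> U" "U \<subseteq> C" using locally_compact[of "fst x"] by blast
  obtain V D where V: "open V" "compact D" "snd x \<in> V" "V \<subseteq> D" using locally_compact[of "snd x"] by blast
  show "\<exists>U C. open U \<and> compact C \<and> x \<in> U \<and> U \<subseteq> C"
    using U V by (intro exI[of _ "U \<times> V"] exI[of _ "C \<times> D"])
      (auto intro: open_Times compact_Times simp: mem_Times_iff)
qed

text \<open>In a locally compact Hausdorff space one compact neighbourhood of a point yields
  arbitrarily small ones.\<close>

lemma compact_neighbourhood: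
  fixes x :: "'a::lcsc_group"
  assumes "open U" "x \<in> U"
  obtains V C where "open V" "compact C" "x \<in> V" "V \<subseteq> C" "C \<subseteq> U"
proof -
  have "Hausdorff_space (euclidean :: 'a topology)"
    by (simp add: Hausdorff_space_def disjnt_def) (metis separation_t2)
  then have "neighbourhood_base_of (compactin euclidean) (euclidean :: 'a topology)"
    using locally_compact_space_neighbourhood_base locally_compact_space_lcsc_group by blast
  then show ?thesis
    using assms that unfolding neighbourhood_base_of open_openin[symmetric] compactin_euclidean_iff
    by blast
qed

text \<open>The compact closures of members of a countable basis already form such a family: a basis
  set inside a compact neighbourhood \<open>K\<close> of \<open>x\<close> has its closure in
  \<open>K\<close>. The family gives sigma-compactness and later separates points in the choice of a
  Borel section.\<close>

lemma compact_basis: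
  obtains C :: "nat \<Rightarrow> 'a::lcsc_group set"
  where "\<And>n. compact (C n)" "\<And>x U. open U \<Longrightarrow> x \<in> U \<Longrightarrow> \<exists>n. x \<in> C n \<and> C n \<subseteq> U"
proof -
  obtain B :: "'a set set" where B: "countable B" "topological_basis B"
    using ex_countable_basis by blast
  \<comment> \<open>The empty set keeps \<open>D\<close> nonempty, so that it can be enumerated as
    the range of a sequence.\<close>
  define D where "D = insert {} {closure b | b. b \<in> B \<and> compact (closure b)}"
  have "countable D"
    using B(1) unfolding D_def by (simp add: setcompr_eq_image)
  moreover have "D \<noteq> {}" by (auto simp: D_def)
  ultimately obtain C :: "nat \<Rightarrow> 'a set" where C: "range C = D"
    using range_from_nat_into[of D] by blast
  show ?thesis
  proof
    have "compact c" if "c \<in> D" for c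
      using that by (auto simp: D_def)
    then show "compact (C n)" for n using C by blast
    fix x :: 'a and U assume "open U" "x \<in> U"
    then obtain V K where V: "open V" "compact K" "x \<in> V" "V \<subseteq> K" "K \<subseteq> U"
      using compact_neighbourhood by blast
    obtain b where b: "b \<in> B" "x \<in> b" "b \<subseteq> V"
      using topological_basisE[OF B(2) V(1,3)] by metis
    have "closure b \<subseteq> K"
      using b V by (intro closure_minimal compact_imp_closed) auto
    moreover from this have "compact (closure b)"
      using V(2) by (metis closed_closure compact_Int_closed inf.absorb2)
    ultimately have "closure b \<in> D" "x \<in> closure b" "closure b \<subseteq> U"
      using b V closure_subset[of b] by (auto simp: D_def)
    then show "\<exists>n. x \<in> C n \<and> C n \<subseteq> U" using C by (metis rangeE)
  qed
qed

lemma sigma_compact_UNIV: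
  obtains C :: "nat \<Rightarrow> 'a::lcsc_group set" where "\<And>n. compact (C n)" "(\<Union>n. C n) = UNIV"
proof -
  obtain C :: "nat \<Rightarrow> 'a set" where C: "\<And>n. compact (C n)"
    "\<And>x U. open U \<Longrightarrow> x \<in> U \<Longrightarrow> \<exists>n. x \<in> C n \<and> C n \<subseteq> U"
    by (rule compact_basis) (rule that)
  have "x \<in> (\<Union>n. C n)" for x
    using C(2)[OF open_UNIV, of x] by simp
  then show ?thesis by (intro that[of C, OF C(1)]) auto
qed

text \<open>Being closed is a local property, and every point has a compact neighbourhood to which
  the hypothesis applies.\<close>

lemma closed_if_locally_closed:
  fixes D :: "'a::lcsc_group set"
  assumes "\<And>C. compact C \<Longrightarrow> closed (D \<inter> C)"
  shows "closed D"
proof -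
  have "\<exists>T. open T \<and> x \<in> T \<and> T \<subseteq> - D" if x: "x \<in> - D" for x
  proof -
    obtain V C where V: "open V" "compact C" "x \<in> V" "V \<subseteq> C"
      using locally_compact[of x] by blast
    have "open (V \<inter> - (D \<inter> C))"
      using V assms by (intro open_Int open_Compl)
    then show ?thesis using V x by (intro exI[of _ "V \<inter> - (D \<inter> C)"]) auto
  qed
  then have "open (- D)" by (rule Topological_Spaces.openI)
  then show ?thesis by (simp add: closed_def)
qed

text \<open>The projection of a Borel set is in general only analytic. A closed set is here a
  countable union of compact sets, and these have compact projections.\<close>

lemma borel_fst_image_closed:
  fixes Z :: "('a::lcsc_group \<times> 'b::lcsc_group) set"
  assumes "closed Z"
  shows "fst ` Z \<in> sets borel"
proof -
  obtain C :: "nat \<Rightarrow> ('a \<times> 'b) set" where C: "\<And>n. compact (C n)" "(\<Union>n. C n) = UNIV"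
    by (rule sigma_compact_UNIV) (rule that)
  have "fst ` Z = (\<Union>n. fst ` (C n \<inter> Z))" using C(2) by blast
  moreover have "compact (fst ` (C n \<inter> Z))" for n
    by (intro compact_continuous_image continuous_on_fst continuous_on_id compact_Int_closed C assms)
  ultimately show ?thesis
    by (metis (no_types, lifting) borel_compact sets.countable_UN image_subsetI)
qed

section \<open>Measurability, compactness and subgroup rules for the group operations\<close>

lemma measurable_uminus_group [measurable (raw)]:
  fixes f :: "'c \<Rightarrow> 'a::lcsc_group"
  assumes "f \<in> borel_measurable M"
  shows "(\<lambda>x. - f x) \<in> borel_measurable M"
  by (rule borel_measurable_continuous_on[OF _ assms])
     (simp add: continuous_on_def, intro allI tendsto_minus tendsto_ident_at)

lemma measurable_diff_group [measurable (raw)]: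
  fixes f g :: "'c \<Rightarrow> 'a::lcsc_group"
  assumes "f \<in> borel_measurable M" "g \<in> borel_measurable M"
  shows "(\<lambda>x. f x - g x) \<in> borel_measurable M"
  unfolding diff_conv_add_uminus using assms by measurable

lemma compact_plus:
  fixes A B :: "'a::lcsc_group set"
  assumes "compact A" "compact B"
  shows "compact ((\<lambda>(x, y). x + y) ` (A \<times> B))"
  using assms by (intro compact_continuous_image compact_Times)
    (auto simp: case_prod_beta intro!: continuous_intros)

lemma compact_translate:
  fixes B :: "'a::lcsc_group set"
  assumes "compact B"
  shows "compact ((+) x ` B)"
  using assms by (intro compact_continuous_image continuous_intros)

lemma compact_diff:
  fixes A B :: "'a::lcsc_group set"
  assumes "compact A" "compact B"
  shows "compact ((\<lambda>(x, y). x - y) ` (A \<times> B))"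
  using assms by (intro compact_continuous_image compact_Times)
    (auto simp: case_prod_beta intro!: continuous_intros)

lemma is_subgroupD:
  assumes "is_subgroup S"
  shows is_subgroup_zero: "0 \<in> S"
    and is_subgroup_add: "x \<in> S \<Longrightarrow> y \<in> S \<Longrightarrow> x + y \<in> S"
    and is_subgroup_uminus: "x \<in> S \<Longrightarrow> - x \<in> S"
    and is_subgroup_diff: "x \<in> S \<Longrightarrow> y \<in> S \<Longrightarrow> x - y \<in> S"
  using assms unfolding is_subgroup_def by (auto simp: diff_conv_add_uminus simp del: add_uminus_conv_diff)

lemma is_subgroup_translate_iff:
  assumes "is_subgroup S" "x \<in> S"
  shows "x + y \<in> S \<longleftrightarrow> y \<in> S" "y + x \<in> S \<longleftrightarrow> y \<in> S" "- x + y \<in> S \<longleftrightarrow> y \<in> S" "y - x \<in> S \<longleftrightarrow> y \<in> S"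
proof -
  note S = is_subgroupD[OF assms(1)]
  have *: "- x + (x + y) = y" "y + x - x = y" "x + (- x + y) = y" "y - x + x = y"
    by (simp_all add: add.assoc[symmetric])
  show "x + y \<in> S \<longleftrightarrow> y \<in> S"
    using S(2)[OF S(3)[OF assms(2)], of "x + y"] S(2)[OF assms(2), of y] * by auto
  show "y + x \<in> S \<longleftrightarrow> y \<in> S"
    using S(4)[OF _ assms(2), of "y + x"] S(2)[OF _ assms(2), of y] * by auto
  show "- x + y \<in> S \<longleftrightarrow> y \<in> S"
    using S(2)[OF assms(2), of "- x + y"] S(2)[OF S(3)[OF assms(2)], of y] * by auto
  show "y - x \<in> S \<longleftrightarrow> y \<in> S"
    using S(2)[OF _ assms(2), of "y - x"] S(4)[OF _ assms(2), of y] * by auto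
qed

lemma is_subgroup_uminus_iff: "is_subgroup S \<Longrightarrow> - x \<in> S \<longleftrightarrow> x \<in> S"
  using is_subgroup_uminus[of S x] is_subgroup_uminus[of S "- x"] by auto

section \<open>Invariant measures\<close>

definition locally_finite :: "'a::topological_space measure \<Rightarrow> bool" where
  "locally_finite \<mu> \<longleftrightarrow> sets \<mu> = sets borel \<and> (\<forall>C. compact C \<longrightarrow> emeasure \<mu> C < \<infinity>)"

text \<open>Invariance is phrased through image measures, so that it transforms integrals directly.
  Only translations by elements of \<open>S\<close> occur, although the measure lives on the whole
  group.\<close>

definition left_invariant :: "'a::lcsc_group set \<Rightarrow> 'a measure \<Rightarrow> bool" where
  "left_invariant S \<mu> \<longleftrightarrow> (\<forall>x\<in>S. distr \<mu> borel ((+) x) = \<mu>)"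

definition right_invariant :: "'a::lcsc_group set \<Rightarrow> 'a measure \<Rightarrow> bool" where
  "right_invariant S \<mu> \<longleftrightarrow> (\<forall>x\<in>S. distr \<mu> borel (\<lambda>y. y + x) = \<mu>)"

text \<open>The ambient counterpart of \<open>haar_on\<close>: that the measure lives on
  \<open>S\<close> becomes concentration almost everywhere.\<close>

definition lhaar :: "'a::lcsc_group set \<Rightarrow> 'a measure \<Rightarrow> bool" where
  "lhaar S \<mu> \<longleftrightarrow> locally_finite \<mu> \<and> (AE x in \<mu>. x \<in> S) \<and> left_invariant S \<mu> \<and> emeasure \<mu> UNIV \<noteq> 0"

lemma lhaarD:
  assumes "lhaar S \<mu>"
  shows "locally_finite \<mu>" "AE x in \<mu>. x \<in> S" "left_invariant S \<mu>" "emeasure \<mu> UNIV \<noteq> 0"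
    "sets \<mu> = sets borel" "space \<mu> = UNIV"
  using assms sets_eq_imp_space_eq[of \<mu> borel] unfolding lhaar_def locally_finite_def by auto

lemma sigma_finite_locally_finite:
  fixes \<mu> :: "'a::lcsc_group measure"
  assumes "locally_finite \<mu>"
  shows "sigma_finite_measure \<mu>"
proof -
  have s: "sets \<mu> = sets borel" "space \<mu> = UNIV"
    using assms sets_eq_imp_space_eq[of \<mu> borel] by (auto simp: locally_finite_def)
  obtain C :: "nat \<Rightarrow> 'a set" where C: "\<And>n. compact (C n)" "(\<Union>n. C n) = UNIV"
    by (rule sigma_compact_UNIV) (rule that)
  show ?thesis
  proof
    show "\<exists>A. countable A \<and> A \<subseteq> sets \<mu> \<and> \<Union>A = space \<mu> \<and> (\<forall>a\<in>A. emeasure \<mu> a \<noteq> \<infinity>)"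
      using C assms by (intro exI[of _ "range C"])
        (auto simp: s locally_finite_def borel_compact less_top)
  qed
qed

lemma nn_integral_left_invariant:
  assumes "left_invariant S \<mu>" "sets \<mu> = sets borel" "x \<in> S" "f \<in> borel_measurable borel"
  shows "(\<integral>\<^sup>+y. f (x + y) \<partial>\<mu>) = (\<integral>\<^sup>+y. f y \<partial>\<mu>)"
proof -
  have [measurable_cong]: "sets \<mu> = sets borel" by fact
  have "(\<integral>\<^sup>+y. f y \<partial>distr \<mu> borel ((+) x)) = (\<integral>\<^sup>+y. f (x + y) \<partial>\<mu>)"
    using assms(4) by (intro nn_integral_distr) measurable
  then show ?thesis using assms by (simp add: left_invariant_def)
qed

lemma nn_integral_right_invariant:
  assumes "right_invariant S \<mu>" "sets \<mu> = sets borel" "x \<in> S" "f \<in> borel_measurable borel"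
  shows "(\<integral>\<^sup>+y. f (y + x) \<partial>\<mu>) = (\<integral>\<^sup>+y. f y \<partial>\<mu>)"
proof -
  have [measurable_cong]: "sets \<mu> = sets borel" by fact
  have "(\<integral>\<^sup>+y. f y \<partial>distr \<mu> borel (\<lambda>y. y + x)) = (\<integral>\<^sup>+y. f (y + x) \<partial>\<mu>)"
    using assms(4) by (intro nn_integral_distr) measurable
  then show ?thesis using assms by (simp add: right_invariant_def)
qed

lemma emeasure_left_invariant:
  assumes "left_invariant S \<mu>" "sets \<mu> = sets borel" "x \<in> S" "A \<in> sets borel"
  shows "emeasure \<mu> {y. x + y \<in> A} = emeasure \<mu> A"
proof -
  have [measurable_cong]: "sets \<mu> = sets borel" by fact
  have "space \<mu> = UNIV" using sets_eq_imp_space_eq[OF assms(2)] by simp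
  then have "emeasure (distr \<mu> borel ((+) x)) A = emeasure \<mu> {y. x + y \<in> A}"
    using assms(4) by (subst emeasure_distr) (auto simp: vimage_def)
  then show ?thesis using assms by (simp add: left_invariant_def)
qed

lemma emeasure_right_invariant:
  assumes "right_invariant S \<mu>" "sets \<mu> = sets borel" "x \<in> S" "A \<in> sets borel"
  shows "emeasure \<mu> {y. y + x \<in> A} = emeasure \<mu> A"
proof -
  have [measurable_cong]: "sets \<mu> = sets borel" by fact
  have "space \<mu> = UNIV" using sets_eq_imp_space_eq[OF assms(2)] by simp
  then have "emeasure (distr \<mu> borel (\<lambda>y. y + x)) A = emeasure \<mu> {y. y + x \<in> A}"
    using assms(4) by (subst emeasure_distr) (auto simp: vimage_def)
  then show ?thesis using assms by (simp add: right_invariant_def)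
qed

text \<open>Turns images under translations into preimages, to which the measurability rules
  apply.\<close>

lemma translate_image: "(+) (x::'a::group_add) ` A = {y. - x + y \<in> A}"
proof (intro equalityI subsetI)
  fix y assume "y \<in> {y. - x + y \<in> A}"
  moreover have "y = x + (- x + y)" by (simp add: add.assoc[symmetric])
  ultimately show "y \<in> (+) x ` A" by blast
qed (auto simp: add.assoc[symmetric])

lemma translate_right_image: "(\<lambda>y. y + (x::'a::group_add)) ` A = {y. y - x \<in> A}"
proof (intro equalityI subsetI)
  fix y assume "y \<in> {y. y - x \<in> A}"
  moreover have "y = y - x + x" by simp
  ultimately show "y \<in> (\<lambda>y. y + x) ` A" by blast
qed auto

lemma borel_translate:
  fixes A :: "'a::lcsc_group set"
  assumes [measurable]: "A \<in> sets borel"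
  shows "{y. x + y \<in> A} \<in> sets borel" "{y. y + x \<in> A} \<in> sets borel"
    "{y. - y \<in> A} \<in> sets borel" "{y. y - x \<in> A} \<in> sets borel" "(+) x ` A \<in> sets borel"
  unfolding translate_image by measurable

lemma emeasure_translate_image:
  assumes "left_invariant S \<mu>" "sets \<mu> = sets borel" "is_subgroup S" "x \<in> S" "A \<in> sets borel"
  shows "emeasure \<mu> ((+) x ` A) = emeasure \<mu> A"
  unfolding translate_image
  by (intro emeasure_left_invariant[OF assms(1,2) _ assms(5)] is_subgroup_uminus[OF assms(3,4)])

text \<open>
  A measure on a closed subgroup is treated as a Borel measure on the ambient group, so that
  measures on different subgroups live on the same \<open>\<sigma>\<close>-algebra.
\<close>

definition borel_extension :: "'a::topological_space measure \<Rightarrow> 'a measure" where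
  "borel_extension \<rho> = distr \<rho> borel (\<lambda>x. x)"

lemma sets_borel_extension [simp, measurable_cong]: "sets (borel_extension \<rho>) = sets borel"
  and space_borel_extension [simp]: "space (borel_extension \<rho>) = UNIV"
  by (simp_all add: borel_extension_def)

lemma haar_onD:
  fixes S :: "'a::lcsc_group set"
  assumes "haar_on S \<rho>" "closed S"
  shows "space \<rho> = S" "(\<lambda>x. x) \<in> measurable \<rho> borel"
    "A \<in> sets borel \<Longrightarrow> emeasure (borel_extension \<rho>) A = emeasure \<rho> (S \<inter> A)"
    "A \<in> sets \<rho> \<longleftrightarrow> A \<in> sets borel \<and> A \<subseteq> S"
proof -
  have sp: "space \<rho> = S" "sets \<rho> = sets (restrict_space borel S)"
    using assms(1) by (auto simp: haar_on_def)
  then show 1: "space \<rho> = S" by simp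
  show 2: "(\<lambda>x. x) \<in> measurable \<rho> borel"
    unfolding measurable_cong_sets[OF sp(2) refl] by (rule measurable_restrict_space1) simp
  show "emeasure (borel_extension \<rho>) A = emeasure \<rho> (S \<inter> A)" if "A \<in> sets borel"
    unfolding borel_extension_def using that by (subst emeasure_distr[OF 2]) (auto simp: 1 Int_commute)
  show "A \<in> sets \<rho> \<longleftrightarrow> A \<in> sets borel \<and> A \<subseteq> S"
    unfolding sp(2) using assms(2) by (subst sets_restrict_space_iff) auto
qed

lemma lhaar_borel_extension:
  fixes S :: "'a::lcsc_group set"
  assumes "haar_on S \<rho>" "closed S" "is_subgroup S"
  shows "lhaar S (borel_extension \<rho>)"
proof -
  note h = haar_onD[OF assms(1,2)]
  have S: "S \<in> sets borel" using assms(2) by simp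
  have "emeasure (borel_extension \<rho>) (- S) = 0"
    using S by (subst h(3)) auto
  then have ae: "AE x in borel_extension \<rho>. x \<in> S"
    using S by (intro AE_I[of _ _ "- S"]) auto
  have inv: "distr (borel_extension \<rho>) borel ((+) x) = borel_extension \<rho>" if x: "x \<in> S" for x
  proof (rule measure_eqI)
    fix A assume A: "A \<in> sets (distr (borel_extension \<rho>) borel ((+) x))"
    have "emeasure (distr (borel_extension \<rho>) borel ((+) x)) A = emeasure (borel_extension \<rho>) {y. x + y \<in> A}"
      using A by (subst emeasure_distr) (auto simp: vimage_def)
    also have "\<dots> = emeasure \<rho> (S \<inter> {y. x + y \<in> A})"
      using A by (intro h(3) borel_translate) auto
    also have "\<dots> = emeasure \<rho> ((+) x ` (S \<inter> {y. x + y \<in> A}))"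
      using A x S assms(1) borel_translate(1)[of A x] unfolding haar_on_def
      by (metis (no_types, lifting) Int_lower1 h(4) sets.Int sets_distr)
    also have "(+) x ` (S \<inter> {y. x + y \<in> A}) = S \<inter> A"
      using is_subgroup_translate_iff(1,3)[OF assms(3) x]
      unfolding translate_image by (auto simp: add.assoc[symmetric])
    finally show "emeasure (distr (borel_extension \<rho>) borel ((+) x)) A = emeasure (borel_extension \<rho>) A"
      using A h(3)[of A] by simp
  qed simp
  have fin: "emeasure (borel_extension \<rho>) C < \<infinity>" if "compact C" for C
    using that assms(1) compact_Int_closed[OF that assms(2)] unfolding haar_on_def
    by (subst h(3)) (auto simp: borel_compact Int_commute)
  have "emeasure (borel_extension \<rho>) UNIV \<noteq> 0"
    using assms(1) by (subst h(3)) (auto simp: haar_on_def)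
  then show ?thesis
    using ae inv fin by (auto simp: lhaar_def locally_finite_def left_invariant_def)
qed

text \<open>Inverse passage to \<open>lhaar_borel_extension\<close>: constructions can be carried
  out on the ambient group and turned into a Haar measure in the sense of \<open>haar_on\<close> at
  the end.\<close>

lemma haar_on_restrict:
  fixes S :: "'a::lcsc_group set"
  assumes "lhaar S \<mu>" "closed S" "is_subgroup S"
  shows "haar_on S (restrict_space \<mu> S)" "borel_extension (restrict_space \<mu> S) = \<mu>"
proof -
  note l = lhaarD[OF assms(1)]
  have S: "S \<in> sets borel" using assms(2) by simp
  have em: "emeasure (restrict_space \<mu> S) A = emeasure \<mu> A" if "A \<subseteq> S" "A \<in> sets borel" for A
    using that S l by (intro emeasure_restrict_space) auto
  have ss: "sets (restrict_space \<mu> S) = sets (restrict_space borel S)"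
    using l by (intro sets_restrict_space_cong) auto
  have st: "A \<in> sets (restrict_space \<mu> S) \<longleftrightarrow> A \<in> sets borel \<and> A \<subseteq> S" for A
    using S l by (subst sets_restrict_space_iff) auto
  have null: "emeasure \<mu> (- S) = 0"
    using l S AE_iff_measurable[of "- S" \<mu> "\<lambda>x. x \<in> S"] by auto
  have Sz: "emeasure \<mu> S \<noteq> 0"
  proof
    assume "emeasure \<mu> S = 0"
    then have "emeasure \<mu> (S \<union> - S) \<le> 0"
      using null emeasure_subadditive[of S \<mu> "- S"] S l by auto
    then show False using l by simp
  qed
  show hr: "haar_on S (restrict_space \<mu> S)"
    unfolding haar_on_def
  proof (intro conjI ballI allI impI)
    show "space (restrict_space \<mu> S) = S" using l by (simp add: space_restrict_space)
    fix x A assume x: "x \<in> S" and A: "A \<in> sets (restrict_space \<mu> S)"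
    then have "(+) x ` A \<subseteq> S" using st is_subgroup_add[OF assms(3)] by blast
    then show "emeasure (restrict_space \<mu> S) ((+) x ` A) = emeasure (restrict_space \<mu> S) A"
      using A x emeasure_translate_image[OF l(3,5) assms(3) x, of A] borel_translate(5)[of A x]
      by (simp add: em st)
  next
    fix C assume "compact C \<and> C \<subseteq> S"
    then show "emeasure (restrict_space \<mu> S) C < \<infinity>"
      using l(1) by (simp add: em borel_compact locally_finite_def)
  qed (use ss Sz S in \<open>auto simp: em\<close>)
  show "borel_extension (restrict_space \<mu> S) = \<mu>"
  proof (rule measure_eqI)
    fix A assume "A \<in> sets (borel_extension (restrict_space \<mu> S))"
    then have A: "A \<in> sets borel" by simp
    have "emeasure (borel_extension (restrict_space \<mu> S)) A = emeasure \<mu> (S \<inter> A)"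
      using haar_onD(3)[OF hr assms(2) A] S A by (simp add: em)
    also have "\<dots> = emeasure \<mu> A"
      using l(2) A S l(5) by (intro emeasure_eq_AE) auto
    finally show "emeasure (borel_extension (restrict_space \<mu> S)) A = emeasure \<mu> A" .
  qed (use l in simp)
qed

lemma haar_on_eqI:
  fixes S :: "'a::lcsc_group set"
  assumes "haar_on S \<rho>" "haar_on S \<rho>'" "closed S" "borel_extension \<rho> = borel_extension \<rho>'"
  shows "\<rho> = \<rho>'"
proof (rule measure_eqI)
  note h = haar_onD[OF assms(1,3)] and h' = haar_onD[OF assms(2,3)]
  show "sets \<rho> = sets \<rho>'" using assms(1,2) by (simp add: haar_on_def)
  fix A assume "A \<in> sets \<rho>"
  then have "A \<in> sets borel" "A \<subseteq> S" using h(4) by auto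
  then show "emeasure \<rho> A = emeasure \<rho>' A"
    using h(3)[of A] h'(3)[of A] assms(4) by (simp add: Int_absorb1)
qed

lemma unimodular_haarD:
  fixes \<gamma> :: "'a::lcsc_group measure"
  assumes "unimodular_haar \<gamma>"
  shows "lhaar UNIV \<gamma>" "right_invariant UNIV \<gamma>"
proof -
  have h: "haar_on UNIV \<gamma>" using assms by (simp add: unimodular_haar_def)
  have s: "sets \<gamma> = sets borel" "space \<gamma> = UNIV"
    using h by (auto simp: haar_on_def)
  have "lhaar UNIV (borel_extension \<gamma>)" by (intro lhaar_borel_extension h) (auto simp: is_subgroup_def)
  moreover have "borel_extension \<gamma> = \<gamma>" unfolding borel_extension_def by (rule distr_id2[OF s(1)[symmetric]])
  ultimately show "lhaar UNIV \<gamma>" by simp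
  have [measurable_cong]: "sets \<gamma> = sets borel" by fact
  show "right_invariant UNIV \<gamma>"
    unfolding right_invariant_def
  proof (intro ballI measure_eqI)
    fix x :: 'a and A assume "A \<in> sets (distr \<gamma> borel (\<lambda>y. y + x))"
    then have A: "A \<in> sets borel" by simp
    have "emeasure (distr \<gamma> borel (\<lambda>y. y + x)) A = emeasure \<gamma> {y. y + x \<in> A}"
      using A by (subst emeasure_distr) (auto simp: vimage_def s)
    also have "\<dots> = emeasure \<gamma> ((\<lambda>y. y + x) ` {y. y + x \<in> A})"
      using assms borel_translate(2)[OF A, of x] by (simp add: unimodular_haar_def s)
    also have "(\<lambda>y. y + x) ` {y. y + x \<in> A} = A"
      unfolding translate_right_image by auto
    finally show "emeasure (distr \<gamma> borel (\<lambda>y. y + x)) A = emeasure \<gamma> A" .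
  qed (simp add: s)
qed

section \<open>Uniqueness of Haar measure\<close>

text \<open>Disjoint translates of \<open>V\<close> inside \<open>Y\<close> all have the measure of
  \<open>V\<close>, so their number is bounded. A family of maximal size exists, and maximality
  forces every further translate to meet one of its members. This serves compactness of sections and
  openness of subgroups of positive measure.\<close>

lemma packing:
  fixes \<mu> :: "'a::lcsc_group measure"
  assumes sets: "sets \<mu> = sets borel" and V: "V \<in> sets borel" and Y: "Y \<in> sets borel"
    and inv: "\<And>x. x \<in> X \<Longrightarrow> emeasure \<mu> ((+) x ` V) = emeasure \<mu> V"
    and pos: "emeasure \<mu> V \<noteq> 0" and fin: "emeasure \<mu> Y < \<infinity>"
    and sub: "\<And>x. x \<in> X \<Longrightarrow> (+) x ` V \<subseteq> Y"
  shows "\<exists>F. finite F \<and> F \<subseteq> X \<and> (\<forall>x\<in>X. \<exists>f\<in>F. (+) x ` V \<inter> (+) f ` V \<noteq> {})"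
proof -
  define P where "P F \<longleftrightarrow> finite F \<and> F \<subseteq> X \<and> disjoint_family_on (\<lambda>x. (+) x ` V) F" for F
  have le: "of_nat (card F) * emeasure \<mu> V \<le> emeasure \<mu> Y" if "P F" for F
  proof -
    have "of_nat (card F) * emeasure \<mu> V = (\<Sum>x\<in>F. emeasure \<mu> ((+) x ` V))"
      using that inv by (subst sum.cong[OF refl, of F _ "\<lambda>_. emeasure \<mu> V"]) (auto simp: P_def)
    also have "\<dots> = emeasure \<mu> (\<Union>x\<in>F. (+) x ` V)"
      using that borel_translate(5)[OF V] by (intro sum_emeasure) (auto simp: P_def sets)
    also have "\<dots> \<le> emeasure \<mu> Y"
      using that sub Y by (intro emeasure_mono) (auto simp: P_def sets)
    finally show ?thesis .
  qed
  have V0: "V \<noteq> {}" using pos by auto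
  obtain N :: nat where N: "emeasure \<mu> Y / emeasure \<mu> V < of_nat N"
    using fin pos ennreal_Ex_less_of_nat[of "emeasure \<mu> Y / emeasure \<mu> V"]
    by (auto simp: less_top[symmetric] ennreal_divide_eq_top_iff)
  have bound: "card F < N" if "P F" for F
  proof -
    have "of_nat (card F) \<le> emeasure \<mu> Y / emeasure \<mu> V"
    proof (cases "emeasure \<mu> V = \<infinity>")
      case True
      \<comment> \<open>An infinite measure of \<open>V\<close> leaves only the empty family, as
        \<open>Y\<close> has finite measure.\<close>
      then have "card F = 0" using le[OF that] fin
        by (cases "card F = 0") (auto simp: ennreal_mult_top top_unique)
      then show ?thesis by simp
    next
      case False
      have "of_nat (card F) = of_nat (card F) * emeasure \<mu> V / emeasure \<mu> V"
        using False pos by (subst ennreal_mult_divide_eq) auto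
      also have "\<dots> \<le> emeasure \<mu> Y / emeasure \<mu> V"
        by (intro divide_right_mono_ennreal le[OF that])
      finally show ?thesis .
    qed
    then show ?thesis using N by (metis of_nat_less_iff order.strict_trans1)
  qed
  have "P {}" by (simp add: P_def disjoint_family_on_def)
  then obtain F where F: "P F" "\<And>G. P G \<Longrightarrow> card G \<le> card F"
    using ex_has_greatest_nat[of P "{}" card N] bound by (metis less_imp_le_nat)
  have "\<exists>f\<in>F. (+) x ` V \<inter> (+) f ` V \<noteq> {}" if x: "x \<in> X" for x
  proof (rule ccontr)
    assume neg: "\<not> ?thesis"
    then have "x \<notin> F" using V0 by auto
    moreover have "P (insert x F)"
      using F(1) x neg \<open>x \<notin> F\<close> unfolding P_def disjoint_family_on_def by (auto 0 3)
    ultimately show False using F(1) F(2)[of "insert x F"] by (simp add: P_def)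
  qed
  then show ?thesis using F(1) by (auto simp: P_def)
qed

text \<open>If \<open>U\<close> were null, its translates by elements of \<open>S\<close> would be
  null open sets covering \<open>S\<close>. By Lindelof countably many of them cover
  \<open>S\<close>, contradicting that the nonzero measure is concentrated on
  \<open>S\<close>.\<close>

lemma lhaar_open_pos:
  assumes "lhaar S \<mu>" "is_subgroup S" "open U" "x \<in> S" "x \<in> U"
  shows "emeasure \<mu> U \<noteq> 0"
proof
  note l = lhaarD[OF assms(1)]
  assume z: "emeasure \<mu> U = 0"
  \<comment> \<open>The translate of \<open>U\<close> that carries \<open>x\<close> to
    \<open>s\<close>.\<close>
  define W where "W s = {y. (x - s) + y \<in> U}" for s
  have opW: "open (W s)" for s
    unfolding W_def using open_vimage[OF assms(3), of "\<lambda>y. (x - s) + y"]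
    by (simp add: vimage_def continuous_intros)
  have W0: "emeasure \<mu> (W s) = 0" if "s \<in> S" for s
    unfolding W_def using z assms that is_subgroup_diff[OF assms(2)]
    by (subst emeasure_left_invariant[OF l(3,5)]) auto
  have mem: "s \<in> W s" for s using assms by (simp add: W_def)
  obtain F where F: "F \<subseteq> W ` S" "countable F" "\<Union>F = \<Union>(W ` S)"
    using Lindelof[of "W ` S"] opW by (metis imageE)
  have "W s \<in> null_sets \<mu>" if "s \<in> S" for s
    using W0[OF that] opW l by (intro null_setsI) auto
  then have "\<Union>F \<in> null_sets \<mu>"
    using F(1) null_sets_UN'[OF F(2), of "\<lambda>x. x" \<mu>] by (simp only: image_ident) blast
  then have 1: "AE y in \<mu>. y \<notin> \<Union>F" by (rule AE_not_in)
  have 2: "S \<subseteq> \<Union>F" using F mem by auto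
  have 3: "AE y in \<mu>. y \<notin> S"
    using 1 by eventually_elim (use 2 in auto)
  have "emeasure \<mu> (space \<mu>) = 0"
    using AE_conjI[OF l(2) 3] by (simp add: AE_iff_measurable[OF sets.top])
  then show False using l(4,6) by simp
qed

text \<open>Both sides equal the double integral of
  \<open>indicator B (y + x) * indicator W x\<close>: left invariance of \<mu> replaces
  \<open>x\<close> by \<open>y + x\<close>, and after Fubini right invariance of \<nu> removes
  \<open>x\<close>. Having the two kinds of invariance on different measures makes them comparable
  without a modular function.\<close>

lemma convolution_identity:
  assumes sf: "sigma_finite_measure \<mu>" "sigma_finite_measure \<nu>"
    and sets: "sets \<mu> = sets borel" "sets \<nu> = sets borel"
    and ae: "AE x in \<mu>. x \<in> D" "AE x in \<nu>. x \<in> D"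
    and inv: "left_invariant D \<mu>" "right_invariant D \<nu>"
    and B: "B \<in> sets borel" "W \<in> sets borel"
  shows "(\<integral>\<^sup>+y. emeasure \<mu> {x \<in> B. - y + x \<in> W} \<partial>\<nu>) = emeasure \<nu> B * emeasure \<mu> W"
proof -
  interpret mn: pair_sigma_finite \<mu> \<nu> using sf by (simp add: pair_sigma_finite_def)
  note [measurable_cong] = sets
  note [measurable] = B
  have eq1: "emeasure \<mu> {x \<in> B. - y + x \<in> W} = (\<integral>\<^sup>+x. indicator B x * indicator W (- y + x) \<partial>\<mu>)" for y
  proof -
    have "(\<integral>\<^sup>+x. indicator B x * indicator W (- y + x) \<partial>\<mu>)
        = (\<integral>\<^sup>+x. indicator {x \<in> B. - y + x \<in> W} x \<partial>\<mu>)"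
      by (intro nn_integral_cong) (auto simp: indicator_def)
    then show ?thesis by simp
  qed
  have "(\<integral>\<^sup>+y. emeasure \<mu> {x \<in> B. - y + x \<in> W} \<partial>\<nu>)
      = (\<integral>\<^sup>+y. (\<integral>\<^sup>+x. indicator B (y + x) * indicator W x \<partial>\<mu>) \<partial>\<nu>)"
  proof (rule nn_integral_cong_AE, use ae(2) in eventually_elim)
    fix y assume y: "y \<in> D"
    have "emeasure \<mu> {x \<in> B. - y + x \<in> W} = (\<integral>\<^sup>+x. indicator B x * indicator W (- y + x) \<partial>\<mu>)"
      by (rule eq1)
    also have "\<dots> = (\<integral>\<^sup>+x. indicator B (y + x) * indicator W (- y + (y + x)) \<partial>\<mu>)"
      by (rule nn_integral_left_invariant[OF inv(1) sets(1) y, symmetric]) measurable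
    finally show "emeasure \<mu> {x \<in> B. - y + x \<in> W} = (\<integral>\<^sup>+x. indicator B (y + x) * indicator W x \<partial>\<mu>)"
      by (simp add: add.assoc[symmetric])
  qed
  also have "\<dots> = (\<integral>\<^sup>+x. (\<integral>\<^sup>+y. indicator B (y + x) * indicator W x \<partial>\<nu>) \<partial>\<mu>)"
    by (rule mn.Fubini') measurable
  also have "\<dots> = (\<integral>\<^sup>+x. emeasure \<nu> B * indicator W x \<partial>\<mu>)"
  proof (rule nn_integral_cong_AE, use ae(1) in eventually_elim)
    fix x assume x: "x \<in> D"
    have "(\<integral>\<^sup>+y. indicator B (y + x) * indicator W x \<partial>\<nu>) = (\<integral>\<^sup>+y. indicator B y * indicator W x \<partial>\<nu>)"
      by (rule nn_integral_right_invariant[OF inv(2) sets(2) x]) measurable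
    then show "(\<integral>\<^sup>+y. indicator B (y + x) * indicator W x \<partial>\<nu>) = emeasure \<nu> B * indicator W x"
      by (simp add: nn_integral_multc)
  qed
  also have "\<dots> = emeasure \<nu> B * emeasure \<mu> W"
    by (simp add: nn_integral_cmult)
  finally show ?thesis .
qed

text \<open>This is \<open>convolution_identity\<close> for \<open>W = UNIV\<close>.\<close>

lemma finite_left_right_invariant_eq:
  assumes fin: "finite_measure \<mu>" "finite_measure \<nu>"
    and sets: "sets \<mu> = sets borel" "sets \<nu> = sets borel"
    and ae: "AE x in \<mu>. x \<in> D" "AE x in \<nu>. x \<in> D"
    and inv: "left_invariant D \<mu>" "right_invariant D \<nu>"
    and eq: "emeasure \<mu> UNIV = emeasure \<nu> UNIV"
  shows "\<mu> = \<nu>"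
proof (rule measure_eqI)
  interpret m: finite_measure \<mu> by fact
  interpret n: finite_measure \<nu> by fact
  have sp: "space \<mu> = UNIV" "space \<nu> = UNIV" using sets_eq_imp_space_eq[OF sets(1)] sets_eq_imp_space_eq[OF sets(2)] by simp_all
  fix B assume "B \<in> sets \<mu>"
  then have "emeasure \<mu> B * emeasure \<nu> UNIV = emeasure \<nu> B * emeasure \<mu> UNIV"
    using convolution_identity[OF m.sigma_finite_measure_axioms n.sigma_finite_measure_axioms
        sets ae inv, of B UNIV] sp sets by simp
  \<comment> \<open>All values are bounded by the common finite mass, which can then be cancelled;
    mass zero is treated apart.\<close>
  moreover have "emeasure \<mu> B \<le> emeasure \<nu> UNIV" "emeasure \<nu> B \<le> emeasure \<nu> UNIV"
    using emeasure_space[of \<mu> B] emeasure_space[of \<nu> B] sp eq by auto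
  moreover have "emeasure \<nu> UNIV < \<infinity>" using n.emeasure_finite[of UNIV] by (metis infinity_ennreal_def less_top)
  ultimately show "emeasure \<mu> B = emeasure \<nu> B"
    unfolding eq
    by (cases "emeasure \<nu> UNIV = 0") (auto simp: mult.commute[of _ "emeasure \<nu> UNIV"] ennreal_mult_cancel_left)
qed (simp add: sets)

text \<open>The restriction \<nu> of \<gamma> to \<open>D\<close> is invariant on both sides. One
  double integral is evaluated twice, by \<open>convolution_identity\<close> and by the substitution
  of \<open>x + y\<close> for \<open>y\<close>, which turns \<open>W\<close> into its inverse
  \<open>W'\<close>. The resulting identity \<open>emeasure \<mu> B * emeasure \<nu> W' = emeasure
  \<nu> B * emeasure \<mu> W\<close> contains the constant.\<close>

lemma haar_unique_open_subgroup:
  fixes \<gamma> :: "'g::lcsc_group measure"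
  assumes "unimodular_haar \<gamma>" "open D" "is_subgroup D" "lhaar D \<mu>"
  shows "\<exists>a>0. \<forall>B\<in>sets borel. emeasure \<mu> B = ennreal a * emeasure \<gamma> (B \<inter> D)"
proof -
  note g = lhaarD[OF unimodular_haarD(1)[OF assms(1)]] and gr = unimodular_haarD(2)[OF assms(1)]
  note l = lhaarD[OF assms(4)]
  define \<nu> where "\<nu> = density \<gamma> (indicator D)"
  have D: "D \<in> sets borel" using assms(2) by simp
  have sn: "sets \<nu> = sets borel" "space \<nu> = UNIV" using g by (simp_all add: \<nu>_def)
  have en: "emeasure \<nu> A = emeasure \<gamma> (A \<inter> D)" if "A \<in> sets borel" for A
    unfolding \<nu>_def using that D g by (subst emeasure_restricted) (auto simp: Int_commute)
  note [measurable_cong] = sn(1) l(5) g(5)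
  have li: "left_invariant D \<nu>"
    unfolding left_invariant_def
  proof (intro ballI measure_eqI)
    fix x A assume x: "x \<in> D" and "A \<in> sets (distr \<nu> borel ((+) x))"
    then have A: "A \<in> sets borel" by simp
    have "emeasure (distr \<nu> borel ((+) x)) A = emeasure \<nu> {y. x + y \<in> A}"
      using A by (subst emeasure_distr) (auto simp: vimage_def sn)
    also have "\<dots> = emeasure \<gamma> {y. x + y \<in> A \<inter> D}"
      using A borel_translate(1)[OF A, of x] is_subgroup_translate_iff(1)[OF assms(3) x]
      by (subst en) (auto intro!: arg_cong[where f="emeasure \<gamma>"])
    also have "\<dots> = emeasure \<nu> A"
      using A D emeasure_left_invariant[OF g(3,5) UNIV_I, of "A \<inter> D" x] en[OF A] by simp
    finally show "emeasure (distr \<nu> borel ((+) x)) A = emeasure \<nu> A" .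
  qed (simp add: sn)
  have ri: "right_invariant D \<nu>"
    unfolding right_invariant_def
  proof (intro ballI measure_eqI)
    fix x A assume x: "x \<in> D" and "A \<in> sets (distr \<nu> borel (\<lambda>y. y + x))"
    then have A: "A \<in> sets borel" by simp
    have "emeasure (distr \<nu> borel (\<lambda>y. y + x)) A = emeasure \<nu> {y. y + x \<in> A}"
      using A by (subst emeasure_distr) (auto simp: vimage_def sn)
    also have "\<dots> = emeasure \<gamma> {y. y + x \<in> A \<inter> D}"
      using A borel_translate(2)[OF A, of x] is_subgroup_translate_iff(2)[OF assms(3) x]
      by (subst en) (auto intro!: arg_cong[where f="emeasure \<gamma>"])
    also have "\<dots> = emeasure \<nu> A"
      using A D emeasure_right_invariant[OF gr g(5) UNIV_I, of "A \<inter> D" x] en[OF A] by simp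
    finally show "emeasure (distr \<nu> borel (\<lambda>y. y + x)) A = emeasure \<nu> A" .
  qed (simp add: sn)
  have aen: "AE x in \<nu>. x \<in> D"
    proof -
    have "indicator D \<in> borel_measurable \<gamma>" using D g by simp
    from AE_density[OF this, of "\<lambda>x. x \<in> D"] show ?thesis
      unfolding \<nu>_def by (auto simp: indicator_def)
  qed
  have lfn: "locally_finite \<nu>"
    unfolding locally_finite_def
  proof (intro conjI allI impI)
    fix C :: "'g set" assume C: "compact C"
    then have "emeasure \<nu> C \<le> emeasure \<gamma> C"
      using D g by (subst en) (auto intro!: emeasure_mono simp: borel_compact)
    then show "emeasure \<nu> C < \<infinity>" using C g(1) by (auto simp: locally_finite_def intro: le_less_trans)
  qed (simp add: sn)
  \<comment> \<open>A compact neighbourhood of \<open>0\<close> inside \<open>D\<close> makes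
    \<open>emeasure \<mu> W\<close> and \<open>emeasure \<nu> W'\<close> positive and finite, so
    that one can divide by them.\<close>
  obtain V W where VW: "open V" "compact W" "0 \<in> V" "V \<subseteq> W" "W \<subseteq> D"
    by (rule compact_neighbourhood[OF assms(2) is_subgroup_zero[OF assms(3)]]) (rule that)
  define W' where "W' = {y. - y \<in> W}"
  have Wb[measurable]: "W \<in> sets borel" using VW borel_compact by blast
  have W'b[measurable]: "W' \<in> sets borel" unfolding W'_def by measurable
  have W'c: "compact W'"
  proof -
    have "W' = uminus ` W" unfolding W'_def by (auto simp: image_iff) (metis minus_minus)
    then show ?thesis using VW by (auto intro!: compact_continuous_image continuous_intros)
  qed
  have W'D: "W' \<subseteq> D" using VW(5) is_subgroup_uminus_iff[OF assms(3)] by (auto simp: W'_def)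
  have W'pos: "emeasure \<nu> W' \<noteq> 0"
  proof -
    have op: "open {y. - y \<in> V}"
      using open_vimage[OF VW(1), of uminus] by (simp add: vimage_def continuous_intros)
    have "emeasure \<gamma> {y. - y \<in> V} \<noteq> 0"
      using VW(3) by (intro lhaar_open_pos[OF unimodular_haarD(1)[OF assms(1)] _ op, of 0]) (auto simp: is_subgroup_def)
    moreover have "emeasure \<gamma> {y. - y \<in> V} \<le> emeasure \<gamma> W'"
    proof (rule emeasure_mono)
      show "{y. - y \<in> V} \<subseteq> W'" using VW(4) by (auto simp: W'_def)
    qed (use W'b g(5) in simp)
    ultimately show ?thesis using W'D en[OF W'b] by (auto simp: Int_absorb2)
  qed
  have W'fin: "emeasure \<nu> W' < \<infinity>" using lfn W'c by (auto simp: locally_finite_def)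
  have Wpos: "emeasure \<mu> W \<noteq> 0"
    using lhaar_open_pos[OF assms(4,3) VW(1) is_subgroup_zero[OF assms(3)] VW(3)]
      emeasure_mono[OF VW(4), of \<mu>] l(5) Wb by auto
  have Wfin: "emeasure \<mu> W < \<infinity>" using l(1) VW(2) by (auto simp: locally_finite_def)
  interpret mn: pair_sigma_finite \<mu> \<nu>
    using sigma_finite_locally_finite[OF l(1)] sigma_finite_locally_finite[OF lfn]
    by (simp add: pair_sigma_finite_def)
  have key: "emeasure \<mu> B * emeasure \<nu> W' = emeasure \<nu> B * emeasure \<mu> W" if Bb[measurable]: "B \<in> sets borel" for B
  proof -
    have "emeasure \<nu> B * emeasure \<mu> W = (\<integral>\<^sup>+y. emeasure \<mu> {x \<in> B. - y + x \<in> W} \<partial>\<nu>)"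
      by (rule convolution_identity[OF mn.M1.sigma_finite_measure_axioms
          mn.M2.sigma_finite_measure_axioms l(5) sn(1) l(2) aen l(3) ri Bb Wb, symmetric])
    also have "\<dots> = (\<integral>\<^sup>+y. (\<integral>\<^sup>+x. indicator B x * indicator W (- y + x) \<partial>\<mu>) \<partial>\<nu>)"
    proof (rule nn_integral_cong)
      fix y
      have "(\<integral>\<^sup>+x. indicator B x * indicator W (- y + x) \<partial>\<mu>)
          = (\<integral>\<^sup>+x. indicator {x \<in> B. - y + x \<in> W} x \<partial>\<mu>)"
        by (intro nn_integral_cong) (auto simp: indicator_def)
      then show "emeasure \<mu> {x \<in> B. - y + x \<in> W} = (\<integral>\<^sup>+x. indicator B x * indicator W (- y + x) \<partial>\<mu>)"
        by simp
    qed
    also have "\<dots> = (\<integral>\<^sup>+x. (\<integral>\<^sup>+y. indicator B x * indicator W (- y + x) \<partial>\<nu>) \<partial>\<mu>)"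
      by (rule mn.Fubini') measurable
    also have "\<dots> = (\<integral>\<^sup>+x. indicator B x * emeasure \<nu> W' \<partial>\<mu>)"
    proof (rule nn_integral_cong_AE, use l(2) in eventually_elim)
      \<comment> \<open>The set of \<open>y\<close> with \<open>- y + x\<close> in \<open>W\<close>
        is the translate of \<open>W'\<close> by \<open>x\<close>, and left invariance of \<nu>
        removes \<open>x\<close>.\<close>
      fix x assume x: "x \<in> D"
      have "(\<integral>\<^sup>+y. indicator W (- y + x) \<partial>\<nu>) = (\<integral>\<^sup>+y. indicator W (- (x + y) + x) \<partial>\<nu>)"
        by (rule nn_integral_left_invariant[OF li sn(1) x, symmetric]) measurable
      also have "\<dots> = (\<integral>\<^sup>+y. indicator W' y \<partial>\<nu>)"
        by (intro nn_integral_cong) (simp add: W'_def indicator_def minus_add diff_conv_add_uminus add.assoc del: add_uminus_conv_diff)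
      finally show "(\<integral>\<^sup>+y. indicator B x * indicator W (- y + x) \<partial>\<nu>) = indicator B x * emeasure \<nu> W'"
        by (subst nn_integral_cmult) auto
    qed
    also have "\<dots> = emeasure \<mu> B * emeasure \<nu> W'"
      by (subst nn_integral_multc) auto
    finally show ?thesis by simp
  qed
  define a where "a = enn2real (emeasure \<mu> W) / enn2real (emeasure \<nu> W')"
  have a: "a > 0"
    using Wpos Wfin W'pos W'fin by (auto simp: a_def enn2real_positive_iff zero_less_iff_neq_zero)
  have ea: "ennreal a = emeasure \<mu> W / emeasure \<nu> W'"
    using Wpos Wfin W'pos W'fin unfolding a_def
    by (subst divide_ennreal[symmetric]) (auto simp: enn2real_positive_iff zero_less_iff_neq_zero)
  have "emeasure \<mu> B = ennreal a * emeasure \<gamma> (B \<inter> D)" if B: "B \<in> sets borel" for B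
  proof -
    have "emeasure \<mu> B = emeasure \<mu> B * emeasure \<nu> W' / emeasure \<nu> W'"
      using W'pos W'fin by (subst ennreal_mult_divide_eq) auto
    also have "\<dots> = ennreal a * emeasure \<nu> B"
      unfolding key[OF B] ea by (simp add: ennreal_times_divide mult.commute)
    finally show ?thesis using en[OF B] by simp
  qed
  then show ?thesis using a by blast
qed

section \<open>Subgroups with proper projection\<close>

text \<open>Proper in the topological sense: the projection to the first factor is a proper map.\<close>

definition proper_subgroup :: "('g::lcsc_group \<times> 'h::lcsc_group) set \<Rightarrow> bool" where
  "proper_subgroup S \<longleftrightarrow> is_subgroup S \<and> closed S \<and> open (Domain S) \<and>
     (\<forall>C. compact C \<longrightarrow> compact (S \<inter> C \<times> UNIV))"

text \<open>The marginal identity behind \<open>ph_alpha\<close>, for a measure on the ambient group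
  and tested on sets; \<open>beta_const\<close> is its mirror image.\<close>

definition alpha_const :: "'g::lcsc_group measure \<Rightarrow> ('g \<times> 'h::lcsc_group) set \<Rightarrow>
    ('g \<times> 'h) measure \<Rightarrow> real \<Rightarrow> bool" where
  "alpha_const \<gamma> S \<mu> a \<longleftrightarrow>
     0 < a \<and> (\<forall>A\<in>sets borel. emeasure \<mu> (A \<times> UNIV) = ennreal a * emeasure \<gamma> (A \<inter> Domain S))"

definition beta_const :: "'h::lcsc_group measure \<Rightarrow> ('g::lcsc_group \<times> 'h) set \<Rightarrow>
    ('g \<times> 'h) measure \<Rightarrow> real \<Rightarrow> bool" where
  "beta_const \<eta> S \<mu> b \<longleftrightarrow>
     0 < b \<and> (\<forall>B\<in>sets borel. emeasure \<mu> (UNIV \<times> B) = ennreal b * emeasure \<eta> (B \<inter> Range S))"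

lemma is_subgroup_UNIV [simp]: "is_subgroup UNIV"
  by (simp add: is_subgroup_def)

lemma is_subgroup_Domain: "is_subgroup S \<Longrightarrow> is_subgroup (Domain S)"
  unfolding is_subgroup_def zero_prod_def by (auto simp: Domain_iff Ball_def) (metis+)

lemma borel_Times_lcsc [measurable]:
  fixes A :: "'a::lcsc_group set" and B :: "'b::lcsc_group set"
  assumes "A \<in> sets borel" "B \<in> sets borel"
  shows "A \<times> B \<in> sets borel"
  using assms by (rule borel_Times)

lemma measurable_fst_borel [measurable (raw)]:
  fixes f :: "'c \<Rightarrow> 'a::topological_space \<times> 'b::topological_space"
  assumes "f \<in> borel_measurable M"
  shows "(\<lambda>x. fst (f x)) \<in> borel_measurable M"
  by (rule borel_measurable_continuous_on[OF _ assms]) (intro continuous_intros)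

lemma measurable_snd_borel [measurable (raw)]:
  fixes f :: "'c \<Rightarrow> 'a::topological_space \<times> 'b::topological_space"
  assumes "f \<in> borel_measurable M"
  shows "(\<lambda>x. snd (f x)) \<in> borel_measurable M"
  by (rule borel_measurable_continuous_on[OF _ assms]) (intro continuous_intros)

text \<open>Every compact set lies over a compact set of first coordinates, where \<open>S\<close>
  and its projection are compact; closedness is then checked on compact sets.\<close>

lemma closed_subset_compact_sections:
  fixes S :: "('g::lcsc_group \<times> 'h::lcsc_group) set"
  assumes "\<And>C. compact C \<Longrightarrow> compact (S \<inter> C \<times> UNIV)"
  shows "closed S" "closed (Domain S)"
proof -
  show "closed S"
  proof (rule closed_if_locally_closed)
    fix C :: "('g \<times> 'h) set" assume C: "compact C"
    then have "compact (fst ` C)"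
      by (intro compact_continuous_image continuous_intros)
    then have "closed ((S \<inter> fst ` C \<times> UNIV) \<inter> C)"
      using C assms compact_imp_closed by blast
    moreover have "(S \<inter> fst ` C \<times> UNIV) \<inter> C = S \<inter> C" by (auto simp: image_iff) force
    ultimately show "closed (S \<inter> C)" by simp
  qed
  show "closed (Domain S)"
  proof (rule closed_if_locally_closed)
    fix C :: "'g set" assume C: "compact C"
    then have "compact (fst ` (S \<inter> C \<times> UNIV))"
      using assms by (intro compact_continuous_image continuous_intros)
    moreover have "fst ` (S \<inter> C \<times> UNIV) = Domain S \<inter> C" by force
    ultimately show "closed (Domain S \<inter> C)" by (simp add: compact_imp_closed)
  qed
qed

text \<open>Domination makes the part of \<open>R\<close> over a compact set finite in measure. A
  maximal disjoint family of translates of a relatively compact neighbourhood \<open>U\<close> by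
  points of \<open>R\<close> over \<open>C\<close> is therefore finite, and the points of
  \<open>R\<close> over \<open>C\<close> lie in finitely many translates of the compact set of
  differences of \<open>K\<close>.\<close>

lemma compact_sections_if_dominated:
  fixes R :: "('g::lcsc_group \<times> 'h::lcsc_group) set"
  assumes "is_subgroup R" "closed R" "lhaar R \<mu>" "locally_finite \<gamma>"
    and dom: "\<And>A. A \<in> sets borel \<Longrightarrow> emeasure \<mu> (A \<times> UNIV) \<le> emeasure \<gamma> A"
    and C: "compact C"
  shows "compact (R \<inter> C \<times> UNIV)"
proof -
  note l = lhaarD[OF assms(3)]
  obtain U K where UK: "open U" "compact K" "(0::'g \<times> 'h) \<in> U" "U \<subseteq> K"
    using locally_compact[of "0::'g \<times> 'h"] by blast
  \<comment> \<open>All translates of \<open>U\<close> by points over \<open>C\<close> lie over this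
    compact set.\<close>
  define CK where "CK = (\<lambda>(x, y). x + y) ` (C \<times> fst ` K)"
  have CKc: "compact CK"
    unfolding CK_def using UK(2) C
    by (intro compact_plus compact_continuous_image continuous_intros)
  then have CKb: "CK \<in> sets borel" by (rule borel_compact)
  have "\<exists>F. finite F \<and> F \<subseteq> R \<inter> C \<times> UNIV \<and>
      (\<forall>x\<in>R \<inter> C \<times> UNIV. \<exists>f\<in>F. (+) x ` U \<inter> (+) f ` U \<noteq> {})"
  proof (rule packing[of \<mu> U "CK \<times> UNIV"])
    show "emeasure \<mu> U \<noteq> 0"
      using UK(3) by (intro lhaar_open_pos[OF assms(3,1) UK(1) is_subgroup_zero[OF assms(1)]])
    have "emeasure \<mu> (CK \<times> UNIV) \<le> emeasure \<gamma> CK" using CKb by (rule dom)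
    also have "\<dots> < \<infinity>" using CKc assms(4) by (auto simp: locally_finite_def)
    finally show "emeasure \<mu> (CK \<times> UNIV) < \<infinity>" .
    fix x assume x: "x \<in> R \<inter> C \<times> UNIV"
    then show "emeasure \<mu> ((+) x ` U) = emeasure \<mu> U"
      using UK(1) by (intro emeasure_translate_image[OF l(3,5) assms(1)]) auto
    show "(+) x ` U \<subseteq> CK \<times> UNIV"
    proof
      fix z assume "z \<in> (+) x ` U"
      then obtain u where u: "u \<in> K" "z = x + u" using UK(4) by auto
      then have "fst z = fst x + fst u" "fst x \<in> C" "fst u \<in> fst ` K" using x by auto
      then have "fst z \<in> CK" unfolding CK_def by (intro image_eqI[of _ _ "(fst x, fst u)"]) auto
      then show "z \<in> CK \<times> UNIV" by (simp add: mem_Times_iff)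
    qed
  qed (use l CKb UK in auto)
  then obtain F where F: "finite F" "F \<subseteq> R \<inter> C \<times> UNIV"
      "\<forall>x\<in>R \<inter> C \<times> UNIV. \<exists>f\<in>F. (+) x ` U \<inter> (+) f ` U \<noteq> {}"
    by (elim exE conjE) (rule that)
  define KK where "KK = (\<lambda>(x, y). x - y) ` (K \<times> K)"
  have KKc: "compact KK" unfolding KK_def by (intro compact_diff UK)
  have "R \<inter> C \<times> UNIV \<subseteq> (\<Union>f\<in>F. (+) f ` KK)"
  proof
    fix x assume "x \<in> R \<inter> C \<times> UNIV"
    then obtain f where f: "f \<in> F" "(+) x ` U \<inter> (+) f ` U \<noteq> {}" using F(3) by blast
    then obtain z where z: "z \<in> (+) x ` U" "z \<in> (+) f ` U" by blast
    obtain u where u: "u \<in> U" "z = x + u" using z(1) by (rule imageE)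
    obtain v where v: "v \<in> U" "z = f + v" using z(2) by (rule imageE)
    \<comment> \<open>If two translates of \<open>U\<close> meet, their base points differ by an
      element of \<open>KK\<close>.\<close>
    have uv: "u \<in> K" "v \<in> K" "x + u = f + v" using u v UK(4) by auto
    then have "x = f + v - u" by (metis add_diff_cancel)
    then have "x = f + (v - u)" by (simp add: diff_conv_add_uminus add.assoc del: add_uminus_conv_diff)
    moreover have "v - u \<in> KK" using uv by (auto simp: KK_def)
    ultimately show "x \<in> (\<Union>f\<in>F. (+) f ` KK)" using f(1) by blast
  qed
  moreover have "compact (\<Union>f\<in>F. (+) f ` KK)"
    using F(1) KKc by (intro compact_UN compact_translate) auto
  moreover have "closed (R \<inter> C \<times> UNIV)"
    using assms(2) closed_Times[OF compact_imp_closed[OF C] closed_UNIV] by (rule closed_Int)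
  ultimately show ?thesis by (metis compact_Int_closed inf.absorb_iff2)
qed

text \<open>A Steinhaus argument: among the translates of a compact \<open>V\<close> inside
  \<open>D\<close> by points of a compact neighbourhood \<open>C\<close> of \<open>0\<close> only
  finitely many are disjoint, so finitely many cosets \<open>f + D\<close> cover \<open>C\<close>.
  These are closed, and removing the ones that differ from \<open>D\<close> leaves a neighbourhood
  of \<open>0\<close> contained in \<open>D\<close>.\<close>

lemma open_subgroup_if_pos:
  fixes D :: "'g::lcsc_group set"
  assumes "closed D" "is_subgroup D" "lhaar UNIV \<gamma>" "emeasure \<gamma> D \<noteq> 0"
  shows "open D"
proof -
  note g = lhaarD[OF assms(3)]
  obtain K :: "nat \<Rightarrow> 'g set" where K: "\<And>n. compact (K n)" "(\<Union>n. K n) = UNIV"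
    by (rule sigma_compact_UNIV) (rule that)
  \<comment> \<open>Countably many compact pieces cover \<open>D\<close>, so one of them has
    positive measure.\<close>
  have "\<exists>n. emeasure \<gamma> (D \<inter> K n) \<noteq> 0"
  proof (rule ccontr)
    assume "\<not> ?thesis"
    then have "D \<inter> K n \<in> null_sets \<gamma>" for n
      using assms(1) K(1) g(5) by (intro null_setsI) (auto simp: borel_compact)
    then have "(\<Union>n. D \<inter> K n) \<in> null_sets \<gamma>" by blast
    moreover have "(\<Union>n. D \<inter> K n) = D" using K(2) by auto
    ultimately show False using assms(4) by auto
  qed
  then obtain n where n: "emeasure \<gamma> (D \<inter> K n) \<noteq> 0" by blast
  define V where "V = D \<inter> K n"
  have V: "compact V" "emeasure \<gamma> V \<noteq> 0" "V \<subseteq> D"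
    using n K(1) assms(1) by (auto simp: V_def Int_commute[of D] compact_Int_closed)
  obtain U C where U: "open U" "compact C" "(0::'g) \<in> U" "U \<subseteq> C"
    using locally_compact[of "0::'g"] by blast
  define Y where "Y = (\<lambda>(x, y). x + y) ` (C \<times> V)"
  have Y: "compact Y" unfolding Y_def using U V by (intro compact_plus)
  have "\<exists>F. finite F \<and> F \<subseteq> C \<and> (\<forall>x\<in>C. \<exists>f\<in>F. (+) x ` V \<inter> (+) f ` V \<noteq> {})"
  proof (rule packing[of \<gamma> V Y])
    show "emeasure \<gamma> Y < \<infinity>" using Y g(1) by (auto simp: locally_finite_def)
    show "emeasure \<gamma> ((+) x ` V) = emeasure \<gamma> V" for x
      using V(1) by (intro emeasure_translate_image[OF g(3,5)]) (auto simp: borel_compact)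
    show "(+) x ` V \<subseteq> Y" if "x \<in> C" for x using that unfolding Y_def by auto
  qed (use V Y g borel_compact in auto)
  then obtain F where F: "finite F" "\<forall>x\<in>C. \<exists>f\<in>F. (+) x ` V \<inter> (+) f ` V \<noteq> {}"
    by (elim exE conjE) (rule that)
  \<comment> \<open>The cosets \<open>f + D\<close> with \<open>f\<close> outside \<open>D\<close>
    avoid \<open>0\<close>, so that \<open>N\<close> still contains it.\<close>
  define N where "N = U \<inter> (\<Inter>f\<in>F - D. - {y. - f + y \<in> D})"
  have "closed {y. - f + y \<in> D}" for f
    using closed_vimage[OF assms(1), of "\<lambda>y. - f + y"] by (simp add: vimage_def continuous_intros)
  then have N: "open N" using U(1) F(1) unfolding N_def
    by (intro open_Int open_INT ballI open_Compl) auto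
  have N0: "0 \<in> N" using U(3) is_subgroup_uminus_iff[OF assms(2)] by (auto simp: N_def)
  have ND: "N \<subseteq> D"
  proof
    fix y assume y: "y \<in> N"
    then have "y \<in> C" using U(4) by (auto simp: N_def)
    then obtain f where f: "f \<in> F" "(+) y ` V \<inter> (+) f ` V \<noteq> {}" using F(2) by blast
    then obtain z where z: "z \<in> (+) y ` V" "z \<in> (+) f ` V" by blast
    obtain u where u: "u \<in> V" "z = y + u" using z(1) by (rule imageE)
    obtain v where v: "v \<in> V" "z = f + v" using z(2) by (rule imageE)
    have uv: "u \<in> D" "v \<in> D" "y + u = f + v" using u v V(3) by auto
    have "- f + y + u = v" using uv(3) by (simp add: add.assoc)
    then have "- f + y \<in> D" using is_subgroup_translate_iff(2)[OF assms(2) uv(1)] uv(2) by metis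
    moreover from this have "f \<in> D" using y f(1) by (auto simp: N_def)
    ultimately show "y \<in> D" using is_subgroup_translate_iff(3)[OF assms(2), of f y] by blast
  qed
  show "open D"
  proof (rule Topological_Spaces.openI)
    fix d assume d: "d \<in> D"
    show "\<exists>T. open T \<and> d \<in> T \<and> T \<subseteq> D"
    proof (intro exI conjI)
      show "open {y. - d + y \<in> N}"
        using open_vimage[OF N, of "\<lambda>y. - d + y"] by (simp add: vimage_def continuous_intros)
      show "d \<in> {y. - d + y \<in> N}" using N0 by simp
      show "{y. - d + y \<in> N} \<subseteq> D"
        using ND is_subgroup_translate_iff(3)[OF assms(2) d] by blast
    qed
  qed
qed

lemma emeasure_concentrated:
  assumes "lhaar S \<mu>" "A \<in> sets borel" "B \<in> sets borel" "A \<inter> S = B \<inter> S"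
  shows "emeasure \<mu> A = emeasure \<mu> B"
proof (rule emeasure_eq_AE)
  show "AE x in \<mu>. x \<in> A \<longleftrightarrow> x \<in> B"
    using lhaarD(2)[OF assms(1)] by eventually_elim (use assms(4) in auto)
qed (use assms lhaarD(5)[OF assms(1)] in auto)

lemma proper_subgroup_if_dominated:
  fixes R :: "('g::lcsc_group \<times> 'h::lcsc_group) set"
  assumes "is_subgroup R" "closed R" "lhaar R \<mu>" "lhaar UNIV \<gamma>"
    and dom: "\<And>A. A \<in> sets borel \<Longrightarrow> emeasure \<mu> (A \<times> UNIV) \<le> emeasure \<gamma> A"
  shows "proper_subgroup R"
proof -
  note l = lhaarD[OF assms(3)]
  have c: "compact (R \<inter> C \<times> UNIV)" if "compact C" for C
    using compact_sections_if_dominated[OF assms(1,2,3) lhaarD(1)[OF assms(4)] dom that] .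
  have cl: "closed (Domain R)" by (rule closed_subset_compact_sections(2)[OF c])
  \<comment> \<open>All of \<mu> lies over \<open>Domain R\<close>; domination thus bounds the
    positive total mass by \<open>emeasure \<gamma> (Domain R)\<close>.\<close>
  have "emeasure \<mu> UNIV = emeasure \<mu> (Domain R \<times> UNIV)"
    using cl by (intro emeasure_concentrated[OF assms(3)]) auto
  also have "\<dots> \<le> emeasure \<gamma> (Domain R)" using cl by (intro dom) auto
  finally have "emeasure \<gamma> (Domain R) \<noteq> 0" using l(4) by auto
  then have "open (Domain R)"
    by (intro open_subgroup_if_pos[OF cl is_subgroup_Domain[OF assms(1)] assms(4)])
  then show ?thesis using assms(1,2) c by (simp add: proper_subgroup_def)
qed

lemma proper_subgroupD:
  assumes "proper_subgroup S"
  shows "is_subgroup S" "closed S" "open (Domain S)" "compact C \<Longrightarrow> compact (S \<inter> C \<times> UNIV)"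
    "is_subgroup (Domain S)" "closed (Domain S)" "Domain S \<in> sets borel" "S \<in> sets borel"
proof -
  show 1: "is_subgroup S" "closed S" "open (Domain S)" "compact C \<Longrightarrow> compact (S \<inter> C \<times> UNIV)"
    using assms by (auto simp: proper_subgroup_def)
  show "is_subgroup (Domain S)" by (rule is_subgroup_Domain[OF 1(1)])
  show "closed (Domain S)"
    using assms by (intro closed_subset_compact_sections(2)) (auto simp: proper_subgroup_def)
  then show "Domain S \<in> sets borel" "S \<in> sets borel" using 1 by auto
qed

text \<open>The image of \<mu> in the first factor is a left Haar measure on the open subgroup
  \<open>Domain S\<close>: compactness of the sections over compact sets is what makes it locally
  finite. Uniqueness there gives the constant.\<close>

lemma alpha_const_exists:
  fixes S :: "('g::lcsc_group \<times> 'h::lcsc_group) set"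
  assumes "proper_subgroup S" "lhaar S \<mu>" "unimodular_haar \<gamma>"
  shows "\<exists>a. alpha_const \<gamma> S \<mu> a"
proof -
  note S = proper_subgroupD[OF assms(1)] and l = lhaarD[OF assms(2)]
  note [measurable_cong] = l(5)
  define \<nu> where "\<nu> = distr \<mu> borel fst"
  have f: "fst \<in> measurable \<mu> borel"
    using measurable_fst_borel[OF measurable_ident_sets[OF l(5)]] by simp
  have en: "emeasure \<nu> A = emeasure \<mu> (A \<times> UNIV)" if "A \<in> sets borel" for A
    unfolding \<nu>_def using that f
    by (subst emeasure_distr) (auto simp: l intro!: arg_cong[where f="emeasure \<mu>"])
  have "lhaar (Domain S) \<nu>"
    unfolding lhaar_def locally_finite_def left_invariant_def
  proof (intro conjI allI impI ballI)
    show "sets \<nu> = sets borel" by (simp add: \<nu>_def)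
    show "emeasure \<nu> UNIV \<noteq> 0" using l(4) by (simp add: en)
    show "AE x in \<nu>. x \<in> Domain S"
    proof -
      have "AE x in \<mu>. fst x \<in> Domain S"
        using l(2) by eventually_elim force
      then show ?thesis unfolding \<nu>_def using S(7) by (subst AE_distr_iff[OF f]) auto
    qed
    fix C :: "'g set" assume C: "compact C"
    have "emeasure \<nu> C = emeasure \<mu> (S \<inter> C \<times> UNIV)"
      unfolding en[OF borel_compact[OF C]]
      using borel_Times_lcsc[OF borel_compact[OF C] sets.top] S(8)
      by (intro emeasure_concentrated[OF assms(2)]) auto
    then show "emeasure \<nu> C < \<infinity>" using S(4)[OF C] l(1) by (auto simp: locally_finite_def)
  next
    fix g assume "g \<in> Domain S"
    then obtain h where gh: "(g, h) \<in> S" by auto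
    show "distr \<nu> borel ((+) g) = \<nu>"
    proof (rule measure_eqI)
      fix A assume "A \<in> sets (distr \<nu> borel ((+) g))"
      then have A: "A \<in> sets borel" by simp
      have "emeasure (distr \<nu> borel ((+) g)) A = emeasure \<nu> {y. g + y \<in> A}"
        using A by (subst emeasure_distr) (auto simp: vimage_def \<nu>_def)
      also have "\<dots> = emeasure \<mu> {p. (g, h) + p \<in> A \<times> UNIV}"
        using borel_translate(1)[OF A, of g]
        by (subst en) (auto intro!: arg_cong[where f="emeasure \<mu>"])
      also have "\<dots> = emeasure \<nu> A"
        using A by (subst emeasure_left_invariant[OF l(3,5) gh]) (auto simp: en)
      finally show "emeasure (distr \<nu> borel ((+) g)) A = emeasure \<nu> A" .
    qed (simp add: \<nu>_def)
  qed
  from haar_unique_open_subgroup[OF assms(3) S(3,5) this]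
  show ?thesis by (auto simp: alpha_const_def en)
qed

text \<open>Supplies test sets on which \<gamma> is positive and finite, so that it can be
  cancelled.\<close>

lemma compact_in_open_pos:
  fixes \<gamma> :: "'g::lcsc_group measure"
  assumes "lhaar UNIV \<gamma>" "open D" "x \<in> D"
  obtains C where "compact C" "C \<subseteq> D" "C \<in> sets borel" "emeasure \<gamma> C \<noteq> 0" "emeasure \<gamma> C < \<infinity>"
proof -
  note g = lhaarD[OF assms(1)]
  obtain V C where VC: "open V" "compact C" "x \<in> V" "V \<subseteq> C" "C \<subseteq> D"
    by (rule compact_neighbourhood[OF assms(2,3)]) (rule that)
  have C: "C \<in> sets borel" by (rule borel_compact[OF VC(2)])
  have "emeasure \<gamma> V \<le> emeasure \<gamma> C"
    using VC(4) C g(5) by (intro emeasure_mono) auto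
  moreover have "emeasure \<gamma> V \<noteq> 0"
    by (rule lhaar_open_pos[OF assms(1) is_subgroup_UNIV VC(1) UNIV_I VC(3)])
  ultimately have "emeasure \<gamma> C \<noteq> 0" by auto
  moreover have "emeasure \<gamma> C < \<infinity>" using VC(2) g(1) by (auto simp: locally_finite_def)
  ultimately show ?thesis using that[OF VC(2,5) C] by blast
qed

lemma alpha_const_unique:
  fixes \<gamma> :: "'g::lcsc_group measure"
  assumes "alpha_const \<gamma> S \<mu> a" "alpha_const \<gamma> S \<mu> b" "open (Domain S)" "is_subgroup S" "unimodular_haar \<gamma>"
  shows "a = b"
proof -
  note D = is_subgroup_zero[OF is_subgroup_Domain[OF assms(4)]]
  note u = unimodular_haarD(1)[OF assms(5)]
  obtain C where VC: "C \<subseteq> Domain S" "C \<in> sets borel"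
    and 1: "emeasure \<gamma> C \<noteq> 0" "emeasure \<gamma> C < \<infinity>"
    by (rule compact_in_open_pos[OF u assms(3) D]) (rule that)
  have C: "C \<inter> Domain S = C" "C \<in> sets borel" using VC by auto
  have "emeasure \<gamma> C * ennreal a = emeasure \<gamma> C * ennreal b"
    using assms(1,2) C unfolding alpha_const_def by (metis mult.commute)
  then show ?thesis
    using 1 assms(1,2) by (auto simp: ennreal_mult_cancel_left alpha_const_def)
qed

text \<open>One direction bounds the constants of given polyhomomorphisms, the other places the
  product in \<open>Polh\<close>.\<close>

lemma alpha_const_le_1:
  fixes \<gamma> :: "'g::lcsc_group measure"
  assumes "alpha_const \<gamma> S \<mu> a" "open (Domain S)" "is_subgroup S" "unimodular_haar \<gamma>"
  shows "a \<le> 1 \<longleftrightarrow> (\<forall>A\<in>sets borel. emeasure \<mu> (A \<times> UNIV) \<le> emeasure \<gamma> A)"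
proof
  note u = unimodular_haarD(1)[OF assms(4)]
  assume "a \<le> 1"
  show "\<forall>A\<in>sets borel. emeasure \<mu> (A \<times> UNIV) \<le> emeasure \<gamma> A"
  proof
    fix A :: "'g set" assume A: "A \<in> sets borel"
    have "emeasure \<mu> (A \<times> UNIV) = ennreal a * emeasure \<gamma> (A \<inter> Domain S)"
      using assms(1) A by (simp add: alpha_const_def)
    also have "\<dots> \<le> 1 * emeasure \<gamma> A"
      using \<open>a \<le> 1\<close> A lhaarD(5)[OF u] by (intro mult_mono emeasure_mono) (auto simp: ennreal_le_1)
    finally show "emeasure \<mu> (A \<times> UNIV) \<le> emeasure \<gamma> A" by simp
  qed
next
  note u = unimodular_haarD(1)[OF assms(4)]
  note D = is_subgroup_zero[OF is_subgroup_Domain[OF assms(3)]]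
  assume dom: "\<forall>A\<in>sets borel. emeasure \<mu> (A \<times> UNIV) \<le> emeasure \<gamma> A"
  obtain C where VC: "C \<subseteq> Domain S" "C \<in> sets borel"
    and 1: "emeasure \<gamma> C \<noteq> 0" "emeasure \<gamma> C < \<infinity>"
    by (rule compact_in_open_pos[OF u assms(2) D]) (rule that)
  have C: "C \<inter> Domain S = C" "C \<in> sets borel" using VC by auto
  have "emeasure \<gamma> C * ennreal a \<le> emeasure \<gamma> C * 1"
    using assms(1) dom C unfolding alpha_const_def by (metis mult.commute mult.right_neutral)
  then have "ennreal a \<le> 1"
    using 1 by (subst (asm) ennreal_mult_le_mult_iff) auto
  then show "a \<le> 1" by (simp add: ennreal_le_1)
qed

lemma alpha_const_iff_distr:
  fixes S :: "('g::lcsc_group \<times> 'h::lcsc_group) set"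
  assumes "lhaar S \<mu>" "sets \<gamma> = sets borel" "Domain S \<in> sets borel"
  shows "alpha_const \<gamma> S \<mu> a \<longleftrightarrow>
    0 < a \<and> distr \<mu> borel fst = scale_measure (ennreal a) (density \<gamma> (indicator (Domain S)))"
    (is "_ \<longleftrightarrow> _ \<and> ?l = ?r")
proof -
  note l = lhaarD[OF assms(1)]
  have f: "fst \<in> measurable \<mu> borel"
    using measurable_fst_borel[OF measurable_ident_sets[OF l(5)]] by simp
  have 1: "emeasure ?l A = emeasure \<mu> (A \<times> UNIV)" if "A \<in> sets borel" for A
    using that by (subst emeasure_distr[OF f]) (auto simp: l intro!: arg_cong[where f="emeasure \<mu>"])
  have 2: "emeasure ?r A = ennreal a * emeasure \<gamma> (A \<inter> Domain S)" if "A \<in> sets borel" for A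
    using that assms(2,3) by (simp add: emeasure_restricted Int_commute)
  have "?l = ?r \<longleftrightarrow> (\<forall>A\<in>sets borel. emeasure ?l A = emeasure ?r A)"
    by (auto intro!: measure_eqI simp: assms(2))
  then show ?thesis by (simp add: alpha_const_def 1 2 del: emeasure_scale_measure)
qed

lemma beta_const_iff_distr:
  fixes S :: "('g::lcsc_group \<times> 'h::lcsc_group) set"
  assumes "lhaar S \<mu>" "sets \<eta> = sets borel" "Range S \<in> sets borel"
  shows "beta_const \<eta> S \<mu> b \<longleftrightarrow>
    0 < b \<and> distr \<mu> borel snd = scale_measure (ennreal b) (density \<eta> (indicator (Range S)))"
    (is "_ \<longleftrightarrow> _ \<and> ?l = ?r")
proof -
  note l = lhaarD[OF assms(1)]
  have f: "snd \<in> measurable \<mu> borel"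
    using measurable_snd_borel[OF measurable_ident_sets[OF l(5)]] by simp
  have 1: "emeasure ?l A = emeasure \<mu> (UNIV \<times> A)" if "A \<in> sets borel" for A
    using that by (subst emeasure_distr[OF f]) (auto simp: l intro!: arg_cong[where f="emeasure \<mu>"])
  have 2: "emeasure ?r A = ennreal b * emeasure \<eta> (A \<inter> Range S)" if "A \<in> sets borel" for A
    using that assms(2,3) by (simp add: emeasure_restricted Int_commute)
  have "?l = ?r \<longleftrightarrow> (\<forall>A\<in>sets borel. emeasure ?l A = emeasure ?r A)"
    by (auto intro!: measure_eqI simp: assms(2))
  then show ?thesis by (simp add: beta_const_def 1 2 del: emeasure_scale_measure)
qed

section \<open>Fibre measures\<close>

text \<open>
  For a compact set \<open>F\<close> and a compact basis \<open>C\<close>, the sets \<open>F \<inter> (\<Inter>i\<in>nested_choice C F n. C i)\<close>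
  decrease to a single point, which is a selection from \<open>F\<close> depending on \<open>F\<close> in a Borel way.
\<close>

primrec nested_choice :: "(nat \<Rightarrow> 'h set) \<Rightarrow> 'h set \<Rightarrow> nat \<Rightarrow> nat set" where
  "nested_choice C F 0 = {}"
| "nested_choice C F (Suc n) =
    (if F \<inter> (C n \<inter> (\<Inter>i\<in>nested_choice C F n. C i)) \<noteq> {} then insert n (nested_choice C F n)
     else nested_choice C F n)"

lemma nested_choice_subset: "nested_choice C F n \<subseteq> {..<n}"
  by (induction n) auto

lemma nested_choice_mono: "m \<le> n \<Longrightarrow> nested_choice C F m \<subseteq> nested_choice C F n"
  by (induction rule: dec_induct) auto

lemma nested_choice_nonempty: "F \<noteq> {} \<Longrightarrow> F \<inter> (\<Inter>i\<in>nested_choice C F n. C i) \<noteq> {}"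
  by (induction n) auto

text \<open>Whether \<open>F g\<close> meets a closed set \<open>A\<close> is a Borel condition on
  \<open>g\<close>, since the set of such \<open>g\<close> is the projection of a closed set. The
  set \<open>I g n\<close> of choices takes finitely many values and so depends on \<open>g\<close>
  in a Borel way, and by compactness the limit point lies in a closed \<open>A\<close> exactly if
  all finite stages meet \<open>A\<close>.\<close>

lemma borel_section_exists:
  fixes S :: "('g::lcsc_group \<times> 'h::lcsc_group) set"
  assumes "proper_subgroup S"
  shows "\<exists>s\<in>borel_measurable borel. \<forall>g\<in>Domain S. (g, s g) \<in> S"
proof -
  note S = proper_subgroupD[OF assms]
  obtain C :: "nat \<Rightarrow> 'h set" where C: "\<And>n. compact (C n)"
    "\<And>x U. open U \<Longrightarrow> x \<in> U \<Longrightarrow> \<exists>n. x \<in> C n \<and> C n \<subseteq> U"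
    by (rule compact_basis) (rule that)
  define F where "F g = {k. (g, k) \<in> S}" for g
  define I where "I g n = nested_choice C (F g) n" for g n
  define P where "P g n = F g \<inter> (\<Inter>i\<in>I g n. C i)" for g n
  have clC: "closed (C n)" for n by (rule compact_imp_closed[OF C(1)])
  have Fc: "compact (F g)" for g
  proof -
    have "compact (snd ` (S \<inter> {g} \<times> UNIV))"
      by (intro compact_continuous_image continuous_intros S(4)) simp
    moreover have "snd ` (S \<inter> {g} \<times> UNIV) = F g" by (force simp: F_def)
    ultimately show ?thesis by simp
  qed
  have Pcl: "closed (P g n)" for g n
    unfolding P_def by (intro closed_Int closed_INT compact_imp_closed[OF Fc]) (simp add: clC)
  have Pmono: "P g n \<subseteq> P g m" if "m \<le> n" for g m n
    using nested_choice_mono[OF that, of C "F g"] by (auto simp: P_def I_def)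
  have inter: "\<exists>k\<in>A. \<forall>n. k \<in> P g n" if A: "closed A" and ne: "\<forall>n. P g n \<inter> A \<noteq> {}" for g A
  proof -
    have "F g \<inter> (\<Inter>n\<in>UNIV. P g n \<inter> A) \<noteq> {}"
    proof (rule compact_imp_fip_image[OF Fc])
      show "closed (P g n \<inter> A)" for n using Pcl A by (rule closed_Int)
      fix J :: "nat set" assume "finite J"
      \<comment> \<open>The stages decrease, so a late stage controls any finite number of
        them.\<close>
      then obtain m where m: "\<forall>j\<in>J. j \<le> m" using finite_nat_set_iff_bounded_le by blast
      obtain x where x: "x \<in> P g m \<inter> A" using ne by blast
      then have "x \<in> P g j \<inter> A" if "j \<in> J" for j using m that Pmono by blast
      moreover have "x \<in> F g" using x by (simp add: P_def)
      ultimately show "F g \<inter> (\<Inter>n\<in>J. P g n \<inter> A) \<noteq> {}" by blast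
    qed
    then show ?thesis by blast
  qed
  have uniq: "x = y" if x: "\<forall>n. x \<in> P g n" and y: "\<forall>n. y \<in> P g n" for g x y
  proof (rule ccontr)
    assume "x \<noteq> y"
    \<comment> \<open>A set of the compact basis that contains \<open>x\<close> but not
      \<open>y\<close> is compatible with the earlier choices, because \<open>x\<close> lies in all
      of them. It is therefore chosen, and \<open>y\<close> would have to lie in it.\<close>
    then obtain n where n: "x \<in> C n" "C n \<subseteq> - {y}" using C(2)[of "- {y}" x] by auto
    have "x \<in> F g \<inter> (C n \<inter> (\<Inter>i\<in>I g n. C i))" using x n(1) by (simp add: P_def)
    then have "n \<in> I g (Suc n)" by (auto simp: I_def)
    then have "y \<in> C n" using y[rule_format, of "Suc n"] by (auto simp: P_def)
    then show False using n(2) by blast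
  qed
  have ne: "P g n \<noteq> {}" if "g \<in> Domain S" for g n
    unfolding P_def I_def using that by (intro nested_choice_nonempty) (auto simp: F_def)
  \<comment> \<open>Outside the Borel set \<open>Domain S\<close> the section is constantly
    \<open>0\<close>, which keeps it Borel on the whole group.\<close>
  define s where "s g = (if g \<in> Domain S then SOME k. \<forall>n. k \<in> P g n else 0)" for g
  have s: "\<forall>n. s g \<in> P g n" if g: "g \<in> Domain S" for g
  proof -
    have "\<exists>k. \<forall>n. k \<in> P g n" using inter[of UNIV g] ne[OF g] by auto
    from someI_ex[OF this] show ?thesis unfolding s_def if_P[OF g] .
  qed
  have sA: "s g \<in> A \<longleftrightarrow> (\<forall>n. P g n \<inter> A \<noteq> {})" if A: "closed A" and g: "g \<in> Domain S" for g A
  proof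
    assume "s g \<in> A" then show "\<forall>n. P g n \<inter> A \<noteq> {}" using s[OF g] by blast
  next
    assume "\<forall>n. P g n \<inter> A \<noteq> {}"
    from inter[OF A this] obtain k where "k \<in> A" "\<forall>n. k \<in> P g n" by blast
    then show "s g \<in> A" using uniq[OF _ s[OF g]] by blast
  qed
  have E: "Measurable.pred borel (\<lambda>g. F g \<inter> A \<noteq> {})" if A: "closed A" for A
  proof -
    have "closed (S \<inter> UNIV \<times> A)" using S(2) A by (intro closed_Int closed_Times) auto
    then have "fst ` (S \<inter> UNIV \<times> A) \<in> sets borel" by (rule borel_fst_image_closed)
    moreover have "fst ` (S \<inter> UNIV \<times> A) = {g. F g \<inter> A \<noteq> {}}" by (force simp: F_def)
    ultimately show ?thesis by (simp add: pred_def)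
  qed
  have K: "closed (\<Inter>i\<in>J. C i)" for J by (intro closed_INT) (simp add: clC)
  have I: "Measurable.pred borel (\<lambda>g. I g n = J)" for n J
  proof (induction n arbitrary: J)
    case 0
    then show ?case by (simp add: I_def)
  next
    case (Suc n)
    \<comment> \<open>Only indices below \<open>n\<close> can have been chosen before, so the
      earlier value of \<open>I\<close> ranges over the finite set
      \<open>Pow {..<n}\<close>.\<close>
    have eq: "I g (Suc n) = J \<longleftrightarrow> (\<exists>J'\<in>Pow {..<n}. I g n = J' \<and>
        (if F g \<inter> (C n \<inter> (\<Inter>i\<in>J'. C i)) \<noteq> {} then J = insert n J' else J = J'))" for g
      using nested_choice_subset[of C "F g" n] by (auto simp: I_def)
    have [measurable]: "Measurable.pred borel (\<lambda>g. F g \<inter> (C n \<inter> (\<Inter>i\<in>J'. C i)) \<noteq> {})" for J'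
      by (intro E closed_Int clC K)
    note [measurable] = Suc
    show ?case unfolding eq
      by (rule pred_intros_finite(4)) (simp, measurable)
  qed
  have PA: "Measurable.pred borel (\<lambda>g. P g n \<inter> A \<noteq> {})" if A: "closed A" for A n
  proof -
    have eq: "P g n \<inter> A \<noteq> {} \<longleftrightarrow>
      (\<exists>J\<in>Pow {..<n}. I g n = J \<and> F g \<inter> ((\<Inter>i\<in>J. C i) \<inter> A) \<noteq> {})" for g
      using nested_choice_subset[of C "F g" n] by (auto simp: I_def P_def)
    note [measurable] = I
    have [measurable]: "Measurable.pred borel (\<lambda>g. F g \<inter> ((\<Inter>i\<in>J. C i) \<inter> A) \<noteq> {})" for J
      by (intro E closed_Int A K)
    show ?thesis unfolding eq
      by (rule pred_intros_finite(4)) (simp, measurable)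
  qed
  have "s \<in> borel_measurable borel"
  proof (rule borel_measurableI)
    fix U :: "'h set" assume "open U"
    then have cl: "closed (- U)" by auto
    have eq: "s g \<in> U \<longleftrightarrow> (if g \<in> Domain S then \<not> (\<forall>n. P g n \<inter> (- U) \<noteq> {}) else 0 \<in> U)" for g
      using sA[OF cl, of g] by (auto simp: s_def)
    note [measurable] = PA[OF cl] S(7)
    have "Measurable.pred borel (\<lambda>g. s g \<in> U)" unfolding eq by measurable
    then show "s -` U \<inter> space borel \<in> sets borel" by (simp add: pred_def vimage_def)
  qed
  moreover have "(g, s g) \<in> S" if "g \<in> Domain S" for g
    using s[OF that] by (auto simp: P_def F_def)
  ultimately show ?thesis by blast
qed

text \<open>Such an \<open>M\<close> is \<open>a\<close> times the normalized Haar measure of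
  \<open>indef S\<close>, seen on the whole group. Right invariance and invariance under conjugation
  are recorded because they make the product measure left invariant.\<close>

definition fibre_measure :: "('g::lcsc_group \<times> 'h::lcsc_group) set \<Rightarrow> real \<Rightarrow> 'h measure \<Rightarrow> bool" where
  "fibre_measure S a M \<longleftrightarrow> sets M = sets borel \<and> (AE x in M. x \<in> indef S) \<and>
     left_invariant (indef S) M \<and> right_invariant (indef S) M \<and>
     (\<forall>k\<in>Range S. distr M borel (\<lambda>n. k + n - k) = M) \<and> emeasure M UNIV = ennreal a"

lemma fibre_measureD:
  assumes "fibre_measure S a M"
  shows "sets M = sets borel" "AE x in M. x \<in> indef S" "left_invariant (indef S) M"
    "right_invariant (indef S) M" "\<And>k. k \<in> Range S \<Longrightarrow> distr M borel (\<lambda>n. k + n - k) = M"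
    "emeasure M UNIV = ennreal a" "space M = UNIV" "finite_measure M"
proof -
  show 1: "sets M = sets borel" "AE x in M. x \<in> indef S" "left_invariant (indef S) M"
    "right_invariant (indef S) M" "\<And>k. k \<in> Range S \<Longrightarrow> distr M borel (\<lambda>n. k + n - k) = M"
    "emeasure M UNIV = ennreal a"
    using assms by (auto simp: fibre_measure_def)
  show 2: "space M = UNIV" using sets_eq_imp_space_eq[OF 1(1)] by simp
  show "finite_measure M" using 1(6) 2 by (intro finite_measureI) simp
qed

text \<open>Averaging over \<open>M\<close> the left translates by \<open>(0, n)\<close> changes
  \<mu> only by the mass of \<open>M\<close>. After Fubini the average is taken at a fixed
  \<open>p\<close>, where right invariance of \<open>M\<close> makes it depend on the first
  coordinate alone, so that only the first marginal of \<mu> remains. As \<open>M\<close> is not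
  tied to \<mu>, the formula can also compare two Haar measures.\<close>

lemma averaging_formula:
  fixes S :: "('g::lcsc_group \<times> 'h::lcsc_group) set"
  assumes S: "proper_subgroup S" "lhaar S \<mu>" "unimodular_haar \<gamma>" "alpha_const \<gamma> S \<mu> a"
    and s: "s \<in> borel_measurable borel" "\<And>g. g \<in> Domain S \<Longrightarrow> (g, s g) \<in> S"
    and M: "sets M = sets borel" "AE x in M. x \<in> indef S" "right_invariant (indef S) M" "finite_measure M"
    and A: "A \<in> sets borel"
  shows "emeasure \<mu> A * emeasure M UNIV =
    ennreal a * (\<integral>\<^sup>+g. (\<integral>\<^sup>+n. indicator A (g, n + s g) \<partial>M) * indicator (Domain S) g \<partial>\<gamma>)"
proof -
  note l = lhaarD[OF S(2)] and g = lhaarD[OF unimodular_haarD(1)[OF S(3)]]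
  note P = proper_subgroupD[OF S(1)]
  interpret M: finite_measure M by fact
  interpret p: pair_sigma_finite \<mu> M
    using sigma_finite_locally_finite[OF l(1)] M.sigma_finite_measure_axioms
    by (simp add: pair_sigma_finite_def)
  have sp: "space M = UNIV" using sets_eq_imp_space_eq[OF M(1)] by simp
  note [measurable_cong] = l(5) g(5) M(1)
  note [measurable] = A s(1) P(7)
  define F where "F g = (\<integral>\<^sup>+n. indicator A (g, n + s g) \<partial>M)" for g
  have F[measurable]: "F \<in> borel_measurable borel" unfolding F_def by measurable
  have "emeasure \<mu> A * emeasure M UNIV = (\<integral>\<^sup>+n. emeasure \<mu> A \<partial>M)" by (simp add: sp)
  also have "\<dots> = (\<integral>\<^sup>+n. (\<integral>\<^sup>+p. indicator A ((0, n) + p) \<partial>\<mu>) \<partial>M)"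
  proof (rule nn_integral_cong_AE, use M(2) in eventually_elim)
    fix n assume n: "n \<in> indef S"
    then have "(\<integral>\<^sup>+p. indicator A ((0, n) + p) \<partial>\<mu>) = (\<integral>\<^sup>+p. indicator A p \<partial>\<mu>)"
      by (intro nn_integral_left_invariant[OF l(3,5)]) (auto simp: indef_def)
    then show "emeasure \<mu> A = (\<integral>\<^sup>+p. indicator A ((0, n) + p) \<partial>\<mu>)" by simp
  qed
  also have "\<dots> = (\<integral>\<^sup>+p. (\<integral>\<^sup>+n. indicator A ((0, n) + p) \<partial>M) \<partial>\<mu>)"
    by (rule p.Fubini') measurable
  also have "\<dots> = (\<integral>\<^sup>+p. F (fst p) \<partial>\<mu>)"
  proof (rule nn_integral_cong_AE, use l(2) in eventually_elim)
    fix p assume p: "p \<in> S"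
    obtain x k where xk: "p = (x, k)" by (cases p)
    \<comment> \<open>The point \<open>p\<close> is \<open>(0, c)\<close> plus the point of the
      section over \<open>x\<close>, with \<open>c\<close> in \<open>indef S\<close>.\<close>
    define c where "c = k - s x"
    have "(0, c) = (x, k) - (x, s x)" by (simp add: c_def)
    also have "\<dots> \<in> S" using p xk s(2)[of x] by (intro is_subgroup_diff[OF P(1)]) auto
    finally have c: "c \<in> indef S" by (simp add: indef_def)
    have "(\<integral>\<^sup>+n. indicator A ((0, n) + p) \<partial>M) = (\<integral>\<^sup>+n. indicator A (x, (n + c) + s x) \<partial>M)"
      by (simp add: xk c_def add.assoc)
    also have "\<dots> = F (fst p)"
      unfolding F_def xk fst_conv
      by (intro nn_integral_right_invariant[OF M(3,1) c]) measurable
    finally show "(\<integral>\<^sup>+n. indicator A ((0, n) + p) \<partial>M) = F (fst p)" .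
  qed
  also have "\<dots> = (\<integral>\<^sup>+x. F x \<partial>distr \<mu> borel fst)"
    by (subst nn_integral_distr) measurable
  also have "distr \<mu> borel fst = scale_measure (ennreal a) (density \<gamma> (indicator (Domain S)))"
    using S(4) by (simp add: alpha_const_iff_distr[OF S(2) g(5) P(7)])
  also have "(\<integral>\<^sup>+x. F x \<partial>scale_measure (ennreal a) (density \<gamma> (indicator (Domain S)))) =
      ennreal a * (\<integral>\<^sup>+x. F x * indicator (Domain S) x \<partial>\<gamma>)"
    by (simp add: nn_integral_scale_measure nn_integral_density mult.commute)
  finally show ?thesis by (simp add: F_def)
qed

text \<open>
  The measure \<open>M\<close> is the normalized image of \<open>\<mu>\<close>, restricted to a compact set of first
  coordinates, under \<open>(g, k) \<mapsto> k - s g\<close>; this map commutes with left translation by \<open>indef S\<close>.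
\<close>

lemma fibre_measure_exists:
  fixes S :: "('g::lcsc_group \<times> 'h::lcsc_group) set"
  assumes S: "proper_subgroup S" "lhaar S \<mu>" "unimodular_haar \<gamma>" "alpha_const \<gamma> S \<mu> a"
    and s: "s \<in> borel_measurable borel" "\<And>g. g \<in> Domain S \<Longrightarrow> (g, s g) \<in> S"
  shows "\<exists>M. fibre_measure S a M \<and> (\<forall>A\<in>sets borel. emeasure \<mu> A =
    (\<integral>\<^sup>+g. (\<integral>\<^sup>+n. indicator A (g, n + s g) \<partial>M) * indicator (Domain S) g \<partial>\<gamma>))"
proof -
  note l = lhaarD[OF S(2)] and g = lhaarD[OF unimodular_haarD(1)[OF S(3)]]
  note P = proper_subgroupD[OF S(1)]
  note [measurable_cong] = l(5)
  have a: "0 < a" using S(4) by (simp add: alpha_const_def)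
  define N where "N = indef S"
  have N: "is_subgroup N"
    using is_subgroupD[OF P(1)] unfolding is_subgroup_def N_def indef_def
    by (auto simp: zero_prod_def) (metis add.left_neutral add_Pair, metis minus_zero uminus_Pair)
  have Nb[measurable]: "N \<in> sets borel"
  proof -
    have "closed (snd ` (S \<inter> {0} \<times> UNIV))"
      by (intro compact_imp_closed compact_continuous_image continuous_intros P(4)) simp
    moreover have "snd ` (S \<inter> {0} \<times> UNIV) = N" by (force simp: N_def indef_def)
    ultimately show ?thesis by simp
  qed
  obtain C where VC: "compact C" "C \<subseteq> Domain S" and Cb[measurable]: "C \<in> sets borel"
    and C1: "emeasure \<gamma> C \<noteq> 0" "emeasure \<gamma> C < \<infinity>"
    by (rule compact_in_open_pos[OF unimodular_haarD(1)[OF S(3)] P(3) is_subgroup_zero[OF P(5)]]) (rule that)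
  have C: "C \<inter> Domain S = C" using VC by auto
  define f where "f p = snd p - s (fst p)" for p
  note [measurable] = s(1)
  have f[measurable]: "f \<in> borel_measurable borel" unfolding f_def by measurable
  \<comment> \<open>The mass of \<mu> over \<open>C\<close> is \<open>a\<close> times
    \<open>emeasure \<gamma> C\<close>; the scaling reduces it to \<open>a\<close>.\<close>
  define M where "M = scale_measure (inverse (emeasure \<gamma> C))
    (distr (density \<mu> (indicator (C \<times> UNIV))) borel f)"
  have sM[measurable_cong]: "sets M = sets borel" by (simp add: M_def)
  have spM: "space M = UNIV" using sets_eq_imp_space_eq[OF sM] by simp
  have eM: "emeasure M B = inverse (emeasure \<gamma> C) * emeasure \<mu> {p. fst p \<in> C \<and> f p \<in> B}"
    if B[measurable]: "B \<in> sets borel" for B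
  proof -
    have f': "f \<in> measurable (density \<mu> (indicator (C \<times> UNIV))) borel"
      using f by (simp add: measurable_cong_sets[OF l(5) refl])
    have CU: "C \<times> UNIV \<in> sets \<mu>" using l(5) Cb by simp
    have fB: "f -` B \<in> sets \<mu>" using measurable_sets[OF f B] l(5) by simp
    have "emeasure (distr (density \<mu> (indicator (C \<times> UNIV))) borel f) B
        = emeasure \<mu> (C \<times> UNIV \<inter> f -` B)"
      using CU fB by (subst emeasure_distr[OF f' B]) (simp add: l(6) emeasure_restricted)
    also have "C \<times> UNIV \<inter> f -` B = {p. fst p \<in> C \<and> f p \<in> B}" by auto
    finally show ?thesis by (simp add: M_def)
  qed
  have fS: "f p \<in> N" if "p \<in> S" for p
  proof -
    have "(0, f p) = p - (fst p, s (fst p))" by (cases p) (simp add: f_def)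
    also have "\<dots> \<in> S"
      using that by (intro is_subgroup_diff[OF P(1)] s(2)) (auto simp: Domain_fst)
    finally show ?thesis by (simp add: N_def indef_def)
  qed
  have ae: "AE x in M. x \<in> N"
  proof (rule AE_I[of _ _ "- N"])
    have "emeasure \<mu> {p. fst p \<in> C \<and> f p \<in> - N} = emeasure \<mu> {}"
      using fS by (intro emeasure_concentrated[OF S(2)]) auto
    then show "emeasure M (- N) = 0" by (subst eM) auto
    show "- N \<in> sets M" using Nb by (simp add: sM)
  qed auto
  have li: "left_invariant N M"
    unfolding left_invariant_def
  proof (intro ballI measure_eqI)
    fix n B assume n: "n \<in> N" and "B \<in> sets (distr M borel ((+) n))"
    then have B[measurable]: "B \<in> sets borel" by simp
    have "emeasure (distr M borel ((+) n)) B = emeasure M {y. n + y \<in> B}"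
      using B by (subst emeasure_distr) (auto simp: vimage_def spM)
    also have "\<dots> = inverse (emeasure \<gamma> C) * emeasure \<mu> {p. fst p \<in> C \<and> n + f p \<in> B}"
      by (subst eM[OF borel_translate(1)[OF B]]) simp
    also have "{p. fst p \<in> C \<and> n + f p \<in> B} = {p. (0, n) + p \<in> {p. fst p \<in> C \<and> f p \<in> B}}"
      by (simp add: f_def add.assoc diff_conv_add_uminus del: add_uminus_conv_diff)
    also have "emeasure \<mu> \<dots> = emeasure \<mu> {p. fst p \<in> C \<and> f p \<in> B}"
      using n by (intro emeasure_left_invariant[OF l(3,5)]) (auto simp: N_def indef_def)
    finally show "emeasure (distr M borel ((+) n)) B = emeasure M B" using eM[OF B] by simp
  qed (simp add: sM)
  have mass: "emeasure M UNIV = ennreal a"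
  proof -
    have "{p::'g \<times> 'h. fst p \<in> C \<and> f p \<in> UNIV} = C \<times> UNIV" by auto
    then have "emeasure M UNIV = inverse (emeasure \<gamma> C) * (ennreal a * emeasure \<gamma> C)"
      using eM[of UNIV] S(4) Cb C by (simp add: alpha_const_def)
    also have "\<dots> = ennreal a * (emeasure \<gamma> C / emeasure \<gamma> C)"
      by (simp add: divide_ennreal_def mult_ac)
    finally show ?thesis using C1 by simp
  qed
  have fin: "finite_measure M" using mass spM by (intro finite_measureI) simp
  \<comment> \<open>Inversion exchanges left and right invariance. A left and a right invariant
    measure of the same finite mass on \<open>indef S\<close> coincide, so \<open>M\<close> is
    symmetric and hence right invariant.\<close>
  have "M = distr M borel uminus"
  proof (rule finite_left_right_invariant_eq[where D=N])
    show "finite_measure (distr M borel uminus)"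
      using fin by (intro finite_measure.finite_measure_distr) measurable
    show "AE x in distr M borel uminus. x \<in> N"
      using ae by (subst AE_distr_iff) (auto simp: is_subgroup_uminus_iff[OF N])
    show "emeasure M UNIV = emeasure (distr M borel uminus) UNIV"
      by (subst emeasure_distr) (auto simp: spM)
    show "right_invariant N (distr M borel uminus)"
      unfolding right_invariant_def
    proof (intro ballI)
      fix n assume n: "n \<in> N"
      have "distr (distr M borel uminus) borel (\<lambda>y. y + n) = distr M borel (\<lambda>y. - y + n)"
        by (subst distr_distr) (auto simp: comp_def)
      also have "\<dots> = distr (distr M borel ((+) (- n))) borel uminus"
        by (subst distr_distr) (auto simp: comp_def minus_add)
      also have "distr M borel ((+) (- n)) = M"
        using li is_subgroup_uminus[OF N n] by (simp add: left_invariant_def)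
      finally show "distr (distr M borel uminus) borel (\<lambda>y. y + n) = distr M borel uminus" .
    qed
  qed (use fin ae li sM in auto)
  then have Mu: "distr M borel uminus = M" by simp
  have ri: "right_invariant N M"
    unfolding right_invariant_def
  proof (intro ballI)
    fix n assume n: "n \<in> N"
    have "distr M borel (\<lambda>y. y + n) = distr (distr M borel uminus) borel (\<lambda>y. y + n)"
      by (simp add: Mu)
    also have "\<dots> = distr M borel (\<lambda>y. - y + n)"
      by (subst distr_distr) (auto simp: comp_def)
    also have "\<dots> = distr (distr M borel ((+) (- n))) borel uminus"
      by (subst distr_distr) (auto simp: comp_def minus_add)
    also have "distr M borel ((+) (- n)) = M"
      using li is_subgroup_uminus[OF N n] by (simp add: left_invariant_def)
    finally show "distr M borel (\<lambda>y. y + n) = M" by (simp add: Mu)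
  qed
  \<comment> \<open>Conjugation by \<open>k\<close> maps \<open>indef S\<close> to itself, so the
    image of \<open>M\<close> is again left invariant and of the same mass, and can be compared with
    the right invariant \<open>M\<close>.\<close>
  have conj: "distr M borel (\<lambda>n. k + n - k) = M" if k: "k \<in> Range S" for k
  proof (rule finite_left_right_invariant_eq[where D=N])
    obtain x where x: "(x, k) \<in> S" using k by auto
    have conjN: "- k + n + k \<in> N" "k + n - k \<in> N" if "n \<in> N" for n
    proof -
      have n: "(0, n) \<in> S" using that by (simp add: N_def indef_def)
      note S' = is_subgroupD[OF P(1)]
      have "- (x, k) + (0, n) + (x, k) \<in> S" "(x, k) + (0, n) - (x, k) \<in> S"
        by (intro S' x n)+
      then show "- k + n + k \<in> N" "k + n - k \<in> N" by (simp_all add: N_def indef_def)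
    qed
    show "finite_measure (distr M borel (\<lambda>n. k + n - k))"
      using fin by (intro finite_measure.finite_measure_distr) measurable
    show "AE x in distr M borel (\<lambda>n. k + n - k). x \<in> N"
    proof -
      have "AE n in M. k + n - k \<in> N" using ae by eventually_elim (rule conjN)
      then show ?thesis by (subst AE_distr_iff) auto
    qed
    show "emeasure (distr M borel (\<lambda>n. k + n - k)) UNIV = emeasure M UNIV"
      by (subst emeasure_distr) (auto simp: spM)
    show "left_invariant N (distr M borel (\<lambda>n. k + n - k))"
      unfolding left_invariant_def
    proof (intro ballI)
      fix m assume m: "m \<in> N"
      have "distr (distr M borel (\<lambda>n. k + n - k)) borel ((+) m) = distr M borel (\<lambda>n. m + (k + n - k))"
        by (subst distr_distr) (auto simp: comp_def)
      also have "(\<lambda>n. m + (k + n - k)) = (\<lambda>n. k + ((- k + m + k) + n) - k)"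
        by (simp add: add.assoc diff_conv_add_uminus del: add_uminus_conv_diff)
      also have "distr M borel \<dots> = distr (distr M borel ((+) (- k + m + k))) borel (\<lambda>n. k + n - k)"
        by (subst distr_distr) (auto simp: comp_def)
      also have "distr M borel ((+) (- k + m + k)) = M"
        using li conjN(1)[OF m] by (simp add: left_invariant_def)
      finally show "distr (distr M borel (\<lambda>n. k + n - k)) borel ((+) m)
          = distr M borel (\<lambda>n. k + n - k)" .
    qed
  qed (use fin ae ri sM in auto)
  have fm: "fibre_measure S a M"
    using sM ae li ri conj mass by (simp add: fibre_measure_def N_def)
  have "emeasure \<mu> A =
    (\<integral>\<^sup>+g. (\<integral>\<^sup>+n. indicator A (g, n + s g) \<partial>M) * indicator (Domain S) g \<partial>\<gamma>)" if A: "A \<in> sets borel" for A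
  proof -
    \<comment> \<open>The averaging formula for \<mu> and its own \<open>M\<close>, whose mass
      \<open>a\<close> cancels.\<close>
    have "ennreal a * emeasure \<mu> A = ennreal a *
        (\<integral>\<^sup>+g. (\<integral>\<^sup>+n. indicator A (g, n + s g) \<partial>M) * indicator (Domain S) g \<partial>\<gamma>)"
      using averaging_formula[OF S s fibre_measureD(1,2,4,8)[OF fm] A]
      by (simp add: mass mult.commute)
    then show ?thesis using a by (simp add: ennreal_mult_cancel_left)
  qed
  then show ?thesis using fm by blast
qed

text \<open>The averaging formula for \<open>\<mu>'\<close>, used with the fibre measure of \<mu>,
  has on its right side \<open>a'\<close> times the integral that represents \<mu>.\<close>

lemma lhaar_proportional:
  fixes S :: "('g::lcsc_group \<times> 'h::lcsc_group) set"
  assumes "proper_subgroup S" "unimodular_haar \<gamma>" "lhaar S \<mu>" "alpha_const \<gamma> S \<mu> a"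
    "lhaar S \<mu>'" "alpha_const \<gamma> S \<mu>' a'" "A \<in> sets borel"
  shows "ennreal a' * emeasure \<mu> A = ennreal a * emeasure \<mu>' A"
proof -
  obtain s where s: "s \<in> borel_measurable borel" "\<And>g. g \<in> Domain S \<Longrightarrow> (g, s g) \<in> S"
    using borel_section_exists[OF assms(1)] by auto
  obtain M where M: "fibre_measure S a M" "\<forall>A\<in>sets borel. emeasure \<mu> A =
      (\<integral>\<^sup>+g. (\<integral>\<^sup>+n. indicator A (g, n + s g) \<partial>M) * indicator (Domain S) g \<partial>\<gamma>)"
    using fibre_measure_exists[OF assms(1,3,2,4) s] by blast
  have "emeasure \<mu>' A * ennreal a = ennreal a' * emeasure \<mu> A"
    using averaging_formula[OF assms(1,5,2,6) s fibre_measureD(1,2,4,8)[OF M(1)] assms(7)]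
      M(2) assms(7) fibre_measureD(6)[OF M(1)] by simp
  then show ?thesis by (simp add: mult.commute)
qed

section \<open>Cosets and relational composition\<close>

lemma left_coset_eq_iff:
  fixes B :: "'a::group_add set"
  assumes "is_subgroup B"
  shows "(+) x ` B = (+) y ` B \<longleftrightarrow> - x + y \<in> B"
proof
  assume "(+) x ` B = (+) y ` B"
  moreover have "y \<in> (+) y ` B" unfolding translate_image using is_subgroup_zero[OF assms] by simp
  ultimately have "y \<in> (+) x ` B" by simp
  then show "- x + y \<in> B" by (simp add: translate_image)
next
  assume xy: "- x + y \<in> B"
  have "- x + z \<in> B \<longleftrightarrow> - y + z \<in> B" for z
    using is_subgroup_translate_iff(1)[OF assms xy, of "- y + z"] by (simp add: add.assoc)
  then show "(+) x ` B = (+) y ` B" by (simp add: translate_image)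
qed

lemma left_cosets_rep:
  assumes "c \<in> left_cosets A B"
  obtains r where "r \<in> A" "c = (+) r ` B"
  using assms by (auto simp: left_cosets_def)

text \<open>The left cosets of the open subgroup \<open>D\<close> through points of \<open>A\<close>
  cover the compact \<open>A\<close>.\<close>

lemma finite_left_cosets_compact_open:
  fixes A D :: "'a::lcsc_group set"
  assumes "compact A" "open D" "is_subgroup A" "is_subgroup D"
  shows "finite (left_cosets A (A \<inter> D))"
proof -
  have AD: "is_subgroup (A \<inter> D)" using assms(3,4) by (auto simp: is_subgroup_def)
  have "open {y. - x + y \<in> D}" for x
    using open_vimage[OF assms(2), of "\<lambda>y. - x + y"] by (simp add: vimage_def continuous_intros)
  moreover have "A \<subseteq> (\<Union>x\<in>A. {y. - x + y \<in> D})" using is_subgroup_zero[OF assms(4)] by auto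
  ultimately obtain F where F: "F \<subseteq> A" "finite F" "A \<subseteq> (\<Union>x\<in>F. {y. - x + y \<in> D})"
    by (rule compactE_image[OF assms(1)])
  have "left_cosets A (A \<inter> D) \<subseteq> (\<lambda>x. (+) x ` (A \<inter> D)) ` F"
  proof
    fix c assume "c \<in> left_cosets A (A \<inter> D)"
    then obtain r where r: "r \<in> A" "c = (+) r ` (A \<inter> D)" by (rule left_cosets_rep)
    then obtain x where x: "x \<in> F" "- x + r \<in> D" using F(3) by blast
    moreover have "- x + r \<in> A"
      using is_subgroup_translate_iff(3)[OF assms(3), of x r] r(1) x(1) F(1) by blast
    ultimately have "(+) x ` (A \<inter> D) = c" using left_coset_eq_iff[OF AD, of x r] r(2) by blast
    then show "c \<in> (\<lambda>x. (+) x ` (A \<inter> D)) ` F" using x(1) by blast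
  qed
  then show ?thesis using F(2) finite_subset by blast
qed

lemma is_subgroup_indef: "is_subgroup R \<Longrightarrow> is_subgroup (indef R)"
  unfolding is_subgroup_def indef_def zero_prod_def
  by (auto simp: Ball_def) (metis add.left_neutral add_Pair, metis minus_zero uminus_Pair)

lemma compact_indef:
  assumes "proper_subgroup R"
  shows "compact (indef R)"
proof -
  have "compact (snd ` (R \<inter> {0} \<times> UNIV))"
    by (intro compact_continuous_image continuous_intros proper_subgroupD(4)[OF assms]) simp
  moreover have "snd ` (R \<inter> {0} \<times> UNIV) = indef R" by (force simp: indef_def)
  ultimately show ?thesis by simp
qed

text \<open>Over a point \<open>g\<close> related to some \<open>h\<close> in \<open>D\<close>, the
  fibre of \<open>R\<close> is \<open>indef R + h\<close>. It splits according to the left cosets of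
  \<open>indef R \<inter> D\<close>, and each piece is the translate by some \<open>(0, r c)\<close>
  of the piece inside \<open>D\<close>. So the mass over such points of \<open>A\<close> is the
  index times \<open>emeasure \<mu> (A \<times> D)\<close>.\<close>

lemma index_formula:
  fixes R :: "('g::lcsc_group \<times> 'h::lcsc_group) set"
  assumes R: "proper_subgroup R" "lhaar R \<mu>" and D: "open D" "is_subgroup D"
    and E: "R\<inverse> `` D \<in> sets borel" and A: "A \<in> sets borel"
  shows "of_nat (subgroup_index (indef R) (indef R \<inter> D)) * emeasure \<mu> (A \<times> D)
    = emeasure \<mu> ((A \<inter> R\<inverse> `` D) \<times> UNIV)"
proof -
  note l = lhaarD[OF R(2)] and P = proper_subgroupD[OF R(1)]
  define N where "N = indef R"
  have N: "is_subgroup N" unfolding N_def by (rule is_subgroup_indef[OF P(1)])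
  have ND: "is_subgroup (N \<inter> D)" using N D(2) by (auto simp: is_subgroup_def)
  define L where "L = left_cosets N (N \<inter> D)"
  have fin: "finite L" unfolding L_def N_def
    by (intro finite_left_cosets_compact_open compact_indef[OF R(1)] D is_subgroup_indef P)
  have "\<forall>c\<in>L. \<exists>r. r \<in> N \<and> c = (+) r ` (N \<inter> D)" by (auto simp: L_def left_cosets_def)
  then obtain r where r: "\<And>c. c \<in> L \<Longrightarrow> r c \<in> N" "\<And>c. c \<in> L \<Longrightarrow> c = (+) (r c) ` (N \<inter> D)"
    by metis
  define X where "X c = (+) (0, r c) ` (A \<times> D)" for c
  have ADb: "A \<times> D \<in> sets borel" using A D(1) by simp
  have Xb: "X c \<in> sets borel" for c unfolding X_def by (rule borel_translate(5)[OF ADb])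
  have Xmem: "(g, y) \<in> X c \<longleftrightarrow> g \<in> A \<and> - r c + y \<in> D" for g y c
    unfolding X_def translate_image by simp
  have rN: "(0, r c) \<in> R" if "c \<in> L" for c using r(1)[OF that] by (simp add: N_def indef_def)
  have disj: "disjoint_family_on X L"
    unfolding disjoint_family_on_def
  proof (intro ballI impI)
    fix c d assume cd: "c \<in> L" "d \<in> L" "c \<noteq> d"
    show "X c \<inter> X d = {}"
    proof (rule ccontr)
      assume "X c \<inter> X d \<noteq> {}"
      then obtain g y where y: "- r c + y \<in> D" "- r d + y \<in> D" using Xmem by (metis IntE equals0I prod.exhaust)
      have "- r c + r d = (- r c + y) - (- r d + y)"
        by (simp add: add.assoc diff_conv_add_uminus minus_add del: add_uminus_conv_diff)
      then have "- r c + r d \<in> D" using is_subgroup_diff[OF D(2) y] by simp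
      moreover have "- r c + r d \<in> N" using is_subgroup_translate_iff(3)[OF N r(1)] r(1) cd by blast
      ultimately have "(+) (r c) ` (N \<inter> D) = (+) (r d) ` (N \<inter> D)" using left_coset_eq_iff[OF ND] by blast
      then show False using r(2)[OF cd(1)] r(2)[OF cd(2)] cd(3) by simp
    qed
  qed
  have "of_nat (card L) * emeasure \<mu> (A \<times> D) = (\<Sum>c\<in>L. emeasure \<mu> (A \<times> D))" by simp
  also have "\<dots> = (\<Sum>c\<in>L. emeasure \<mu> (X c))"
    unfolding X_def
    by (intro sum.cong refl emeasure_translate_image[OF l(3,5) P(1) rN ADb, symmetric])
  also have "\<dots> = emeasure \<mu> (\<Union>c\<in>L. X c)"
    using Xb l(5) fin disj by (intro sum_emeasure) auto
  also have "\<dots> = emeasure \<mu> ((A \<inter> R\<inverse> `` D) \<times> UNIV)"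
  proof (rule emeasure_concentrated[OF R(2)])
    show "(\<Union>c\<in>L. X c) \<in> sets borel" using Xb fin by (intro sets.finite_UN) auto
    show "(A \<inter> R\<inverse> `` D) \<times> (UNIV :: 'h set) \<in> sets borel"
      by (rule borel_Times_lcsc[OF sets.Int[OF A E]]) simp
    have key: "(\<exists>c\<in>L. (g, y) \<in> X c) \<longleftrightarrow> g \<in> A \<inter> R\<inverse> `` D" if gy: "(g, y) \<in> R" for g y
    proof
      assume "\<exists>c\<in>L. (g, y) \<in> X c"
      then obtain c where c: "c \<in> L" "g \<in> A" "- r c + y \<in> D" using Xmem by blast
      have "- (0, r c) + (g, y) \<in> R" using is_subgroup_translate_iff(3)[OF P(1) rN[OF c(1)]] gy by blast
      then have "(g, - r c + y) \<in> R" by simp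
      then show "g \<in> A \<inter> R\<inverse> `` D" using c by blast
    next
      assume "g \<in> A \<inter> R\<inverse> `` D"
      then obtain h where h: "(g, h) \<in> R" "h \<in> D" "g \<in> A" by blast
      have "(g, y) - (g, h) \<in> R" by (rule is_subgroup_diff[OF P(1) gy h(1)])
      then have d: "y - h \<in> N" by (simp add: N_def indef_def)
      \<comment> \<open>The piece containing \<open>(g, y)\<close> is found from the coset of
        \<open>y - h\<close>, where \<open>(g, h)\<close> is the point of \<open>R\<close> with
        \<open>h\<close> in \<open>D\<close>.\<close>
      define c where "c = (+) (y - h) ` (N \<inter> D)"
      have c: "c \<in> L" using d by (auto simp: c_def L_def left_cosets_def)
      then have "- r c + (y - h) \<in> D" using left_coset_eq_iff[OF ND, of "r c" "y - h"] r(2)[OF c] c_def by auto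
      then have "- r c + (y - h) + h \<in> D" using h(2) by (rule is_subgroup_add[OF D(2)])
      then have "- r c + y \<in> D" by (simp add: add.assoc)
      then show "\<exists>c\<in>L. (g, y) \<in> X c" using c h(3) Xmem by blast
    qed
    have "p \<in> (\<Union>c\<in>L. X c) \<inter> R \<longleftrightarrow> p \<in> ((A \<inter> R\<inverse> `` D) \<times> UNIV) \<inter> R" for p
      using key[of "fst p" "snd p"] unfolding Int_iff UN_iff mem_Times_iff prod.collapse by blast
    then show "(\<Union>c\<in>L. X c) \<inter> R = ((A \<inter> R\<inverse> `` D) \<times> UNIV) \<inter> R" by (rule set_eqI)
  qed
  finally show ?thesis by (simp add: L_def N_def subgroup_index_def)
qed

section \<open>Converse and composition of subgroups\<close>

lemma lhaar_converse:
  fixes R :: "('g::lcsc_group \<times> 'h::lcsc_group) set"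
  assumes "lhaar R \<mu>" "closed R"
  shows "lhaar (R\<inverse>) (distr \<mu> borel prod.swap)"
    "A \<in> sets borel \<Longrightarrow> B \<in> sets borel \<Longrightarrow> emeasure (distr \<mu> borel prod.swap) (B \<times> A) = emeasure \<mu> (A \<times> B)"
    "closed (R\<inverse>)"
proof -
  note l = lhaarD[OF assms(1)]
  have sw: "prod.swap \<in> borel_measurable \<mu>"
  proof -
    have "prod.swap \<in> borel_measurable (borel :: ('g \<times> 'h) measure)"
      by (intro borel_measurable_continuous_onI continuous_on_swap)
    then show ?thesis by (simp add: measurable_cong_sets[OF l(5) refl])
  qed
  have e: "emeasure (distr \<mu> borel prod.swap) A = emeasure \<mu> {p. prod.swap p \<in> A}" if "A \<in> sets borel" for A
    using that by (subst emeasure_distr[OF sw]) (auto simp: l vimage_def)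
  have mem: "prod.swap p \<in> R\<inverse> \<longleftrightarrow> p \<in> R" for p by (cases p) simp
  show cl: "closed (R\<inverse>)"
  proof -
    have "closed (prod.swap -` R)" using assms(2) by (intro closed_vimage continuous_on_swap)
    moreover have "prod.swap -` R = R\<inverse>" by auto
    ultimately show ?thesis by simp
  qed
  show "lhaar (R\<inverse>) (distr \<mu> borel prod.swap)"
    unfolding lhaar_def locally_finite_def left_invariant_def
  proof (intro conjI allI impI ballI)
    show "AE x in distr \<mu> borel prod.swap. x \<in> R\<inverse>"
    proof -
      have "{x. x \<in> R\<inverse>} \<in> sets borel" using cl by simp
      then show ?thesis using l(2) by (subst AE_distr_iff[OF sw]) (auto simp: mem simp del: converse_iff)
    qed
    show "sets (distr \<mu> borel prod.swap) = sets borel" by simp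
    show "emeasure (distr \<mu> borel prod.swap) UNIV \<noteq> 0" using l(4) by (simp add: e)
    fix C :: "('h \<times> 'g) set" assume C: "compact C"
    then have "compact (prod.swap ` C)" by (intro compact_continuous_image continuous_on_swap)
    moreover have "{p. prod.swap p \<in> C} = prod.swap ` C" by (force simp: image_iff)
    ultimately show "emeasure (distr \<mu> borel prod.swap) C < \<infinity>"
      using l(1) C by (simp add: e borel_compact locally_finite_def)
  next
    fix x assume x: "x \<in> R\<inverse>"
    show "distr (distr \<mu> borel prod.swap) borel ((+) x) = distr \<mu> borel prod.swap"
    proof (rule measure_eqI)
      fix A assume "A \<in> sets (distr (distr \<mu> borel prod.swap) borel ((+) x))"
      then have A: "A \<in> sets borel" by simp
      have sA: "{p::'g \<times> 'h. prod.swap p \<in> A} \<in> sets borel"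
        using measurable_sets[OF sw A] by (simp add: l vimage_def)
      have "emeasure (distr (distr \<mu> borel prod.swap) borel ((+) x)) A
          = emeasure (distr \<mu> borel prod.swap) {y. x + y \<in> A}"
        using A by (subst emeasure_distr) (auto simp: vimage_def)
      also have "\<dots> = emeasure \<mu> {p. prod.swap x + p \<in> {p. prod.swap p \<in> A}}"
        using e[OF borel_translate(1)[OF A, of x]] by (cases x) (simp add: prod.swap_def plus_prod_def)
      also have "\<dots> = emeasure \<mu> {p. prod.swap p \<in> A}"
        using x by (intro emeasure_left_invariant[OF l(3,5) _ sA]) auto
      finally show "emeasure (distr (distr \<mu> borel prod.swap) borel ((+) x)) A
          = emeasure (distr \<mu> borel prod.swap) A" by (simp add: e[OF A])
    qed simp
  qed
  assume "A \<in> sets borel" "B \<in> sets borel"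
  then show "emeasure (distr \<mu> borel prod.swap) (B \<times> A) = emeasure \<mu> (A \<times> B)"
    by (subst e) (auto intro!: arg_cong[where f="emeasure \<mu>"])
qed

text \<open>Properness over both factors; for a polyhomomorphism each of the two dominations gives
  one of them.\<close>

definition biproper :: "('g::lcsc_group \<times> 'h::lcsc_group) set \<Rightarrow> bool" where
  "biproper R \<longleftrightarrow> proper_subgroup R \<and> proper_subgroup (R\<inverse>)"

lemma is_subgroup_converse: "is_subgroup R \<Longrightarrow> is_subgroup (R\<inverse>)"
  unfolding is_subgroup_def zero_prod_def by auto (metis add_Pair)

lemma is_subgroup_relcomp:
  assumes "is_subgroup R" "is_subgroup T"
  shows "is_subgroup (R O T)"
  unfolding is_subgroup_def zero_prod_def
proof (intro conjI ballI)
  show "(0, 0) \<in> R O T"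
    using is_subgroup_zero[OF assms(1)] is_subgroup_zero[OF assms(2)] by (auto simp: zero_prod_def)
  fix x assume "x \<in> R O T"
  then obtain g h k where x: "x = (g, k)" "(g, h) \<in> R" "(h, k) \<in> T" by auto
  show "- x \<in> R O T"
    using is_subgroup_uminus[OF assms(1) x(2)] is_subgroup_uminus[OF assms(2) x(3)] x(1) by auto
  fix y assume "y \<in> R O T"
  then obtain g' h' k' where y: "y = (g', k')" "(g', h') \<in> R" "(h', k') \<in> T" by auto
  show "x + y \<in> R O T"
    using is_subgroup_add[OF assms(1) x(2) y(2)] is_subgroup_add[OF assms(2) x(3) y(3)] x(1) y(1) by auto
qed

text \<open>Over \<open>C\<close> the composition is a continuous image of the fibre product, over
  the middle group, of \<open>RC\<close> and the part of \<open>T\<close> over the second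
  coordinates of \<open>RC\<close>. This is a closed subset of a product of two compact
  sets.\<close>

lemma compact_sections_relcomp:
  fixes R :: "('g::lcsc_group \<times> 'h::lcsc_group) set" and T :: "('h \<times> 'k::lcsc_group) set"
  assumes "proper_subgroup R" "proper_subgroup T" "compact C"
  shows "compact ((R O T) \<inter> C \<times> UNIV)"
proof -
  define RC where "RC = R \<inter> C \<times> UNIV"
  have RC: "compact RC" unfolding RC_def by (rule proper_subgroupD(4)[OF assms(1,3)])
  define TC where "TC = T \<inter> (snd ` RC) \<times> UNIV"
  have TC: "compact TC" unfolding TC_def
    by (intro proper_subgroupD(4)[OF assms(2)] compact_continuous_image continuous_intros RC)
  have "closed {x :: ('g \<times> 'h) \<times> ('h \<times> 'k). snd (fst x) = fst (snd x)}"
    by (intro closed_Collect_eq continuous_intros)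
  then have "compact ((RC \<times> TC) \<inter> {x. snd (fst x) = fst (snd x)})"
    by (intro compact_Int_closed compact_Times RC TC)
  then have "compact ((\<lambda>x. (fst (fst x), snd (snd x))) ` ((RC \<times> TC) \<inter> {x. snd (fst x) = fst (snd x)}))"
    by (intro compact_continuous_image continuous_intros)
  also have "(\<lambda>x. (fst (fst x), snd (snd x))) ` ((RC \<times> TC) \<inter> {x. snd (fst x) = fst (snd x)})
      = (R O T) \<inter> C \<times> UNIV" (is "?L = ?R")
  proof (intro equalityI subsetI)
    fix z assume "z \<in> ?R"
    then obtain g h k where z: "z = (g, k)" "(g, h) \<in> R" "(h, k) \<in> T" "g \<in> C" by auto
    then have "(g, h) \<in> RC" by (simp add: RC_def)
    moreover from this have "(h, k) \<in> TC" using z(3) by (force simp: TC_def)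
    ultimately have "((g, h), (h, k)) \<in> (RC \<times> TC) \<inter> {x. snd (fst x) = fst (snd x)}" by simp
    then show "z \<in> ?L" by (rule rev_image_eqI) (simp add: z)
  qed (auto simp: RC_def TC_def)
  finally show ?thesis .
qed

text \<open>Closedness comes from the compact sections. For openness, \<mu> is positive on the open
  set \<open>UNIV \<times> Domain T\<close>, and the points of \<open>R\<close> in it lie over
  \<open>Domain (R O T)\<close>, which therefore has positive measure for \<gamma>.\<close>

lemma proper_subgroup_relcomp:
  fixes R :: "('g::lcsc_group \<times> 'h::lcsc_group) set" and T :: "('h \<times> 'k::lcsc_group) set"
    and \<gamma> :: "'g measure"
  assumes "proper_subgroup R" "proper_subgroup T" "lhaar R \<mu>" "unimodular_haar \<gamma>"
  shows "proper_subgroup (R O T)"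
proof -
  note R = proper_subgroupD[OF assms(1)] and T = proper_subgroupD[OF assms(2)]
  note cs = compact_sections_relcomp[OF assms(1,2)]
  note cl = closed_subset_compact_sections[OF cs]
  have sg: "is_subgroup (R O T)" by (rule is_subgroup_relcomp[OF R(1) T(1)])
  obtain a where a: "alpha_const \<gamma> R \<mu> a" using alpha_const_exists[OF assms(1,3,4)] by blast
  have "emeasure \<mu> (UNIV \<times> Domain T) \<noteq> 0"
    using T(3) is_subgroup_zero[OF T(5)]
    by (intro lhaar_open_pos[OF assms(3) R(1) _ is_subgroup_zero[OF R(1)]]) (auto intro: open_Times simp: zero_prod_def)
  moreover have "emeasure \<mu> (UNIV \<times> Domain T) \<le> emeasure \<mu> (Domain (R O T) \<times> UNIV)"
  proof -
    have "emeasure \<mu> (UNIV \<times> Domain T) = emeasure \<mu> (R \<inter> UNIV \<times> Domain T)"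
      using T(3) R(8) by (intro emeasure_concentrated[OF assms(3)]) (auto intro!: sets.Int borel_Times_lcsc)
    also have "\<dots> \<le> emeasure \<mu> (Domain (R O T) \<times> UNIV)"
      using cl(2) lhaarD(5)[OF assms(3)] by (intro emeasure_mono) auto
    finally show ?thesis .
  qed
  ultimately have "ennreal a * emeasure \<gamma> (Domain (R O T) \<inter> Domain R) \<noteq> 0"
    using a cl(2) by (auto simp: alpha_const_def)
  moreover have "Domain (R O T) \<inter> Domain R = Domain (R O T)" by blast
  ultimately have "emeasure \<gamma> (Domain (R O T)) \<noteq> 0" by auto
  then have "open (Domain (R O T))"
    by (intro open_subgroup_if_pos[OF cl(2) is_subgroup_Domain[OF sg] unimodular_haarD(1)[OF assms(4)]])
  then show ?thesis using sg cl(1) cs by (simp add: proper_subgroup_def)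
qed

lemma biproper_relcomp:
  fixes R :: "('g::lcsc_group \<times> 'h::lcsc_group) set" and T :: "('h \<times> 'k::lcsc_group) set"
    and \<gamma> :: "'g measure" and \<kappa> :: "'k measure"
  assumes "biproper R" "biproper T" "lhaar R \<mu>" "lhaar T \<tau>" "unimodular_haar \<gamma>" "unimodular_haar \<kappa>"
  shows "biproper (R O T)"
  unfolding biproper_def
proof
  show "proper_subgroup (R O T)"
    using assms proper_subgroup_relcomp[of R T \<mu> \<gamma>] by (simp add: biproper_def)
  have "closed T" using assms(2) by (simp add: biproper_def proper_subgroup_def)
  then show "proper_subgroup ((R O T)\<inverse>)"
    unfolding converse_relcomp
    using assms proper_subgroup_relcomp[of "T\<inverse>" "R\<inverse>" "distr \<tau> borel prod.swap" \<kappa>]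
      lhaar_converse(1)[OF assms(4)] by (simp add: biproper_def)
qed

section \<open>The product measure\<close>

lemma index_pos:
  assumes "finite (left_cosets A B)" "is_subgroup A"
  shows "0 < subgroup_index A B"
  using assms is_subgroup_zero[OF assms(2)] unfolding subgroup_index_def
  by (auto simp: card_gt_0_iff left_cosets_def)

text \<open>For the first constant: \<open>M\<close> has mass \<open>a'\<close>, so
  \<open>emeasure \<sigma> (A \<times> UNIV)\<close> is \<open>a'\<close> times
  \<open>emeasure \<mu> (A \<times> D)\<close>, which \<open>index_formula\<close> relates to
  \<open>a\<close> times \<gamma>. For the second: the image of \<mu> under \<open>snd\<close> is
  \<open>b\<close> times \<eta> on \<open>Range R\<close>, and integrating the fibres against it
  restores \<tau>, giving \<open>b\<close> times
  \<open>emeasure \<tau> (Range R \<times> B)\<close>; the index formula for the converse of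
  \<open>T\<close> then produces \<open>b'\<close> and the other index.\<close>

lemma product_measure_exists:
  fixes R :: "('g::lcsc_group \<times> 'h::lcsc_group) set" and T :: "('h \<times> 'k::lcsc_group) set"
    and \<gamma> :: "'g measure" and \<eta> :: "'h measure" and \<kappa> :: "'k measure"
  assumes bi: "biproper R" "biproper T" and lh: "lhaar R \<mu>" "lhaar T \<tau>"
    and uni: "unimodular_haar \<gamma>" "unimodular_haar \<eta>" "unimodular_haar \<kappa>"
    and R: "alpha_const \<gamma> R \<mu> a" "beta_const \<eta> R \<mu> b"
    and T: "alpha_const \<eta> T \<tau> a'" "beta_const \<kappa> T \<tau> b'"
  shows "\<exists>\<sigma>. lhaar (R O T) \<sigma> \<and>
      alpha_const \<gamma> (R O T) \<sigma> (a * a' / subgroup_index (indef R) (indef R \<inter> Domain T)) \<and>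
      beta_const \<kappa> (R O T) \<sigma> (b * b' / subgroup_index (ker T) (ker T \<inter> Range R))"
proof -
  have pR: "proper_subgroup R" "proper_subgroup (R\<inverse>)" and pT: "proper_subgroup T" "proper_subgroup (T\<inverse>)"
    using bi by (auto simp: biproper_def)
  have pS: "proper_subgroup (R O T)" "proper_subgroup ((R O T)\<inverse>)"
    using biproper_relcomp[OF bi lh uni(1,3)] by (auto simp: biproper_def)
  note lR = lhaarD[OF lh(1)] and lT = lhaarD[OF lh(2)]
  note PR = proper_subgroupD[OF pR(1)] and PT = proper_subgroupD[OF pT(1)] and PS = proper_subgroupD[OF pS(1)]
  note e = lhaarD[OF unimodular_haarD(1)[OF uni(2)]]
  have pos: "0 < a" "0 < b" "0 < a'" "0 < b'"
    using R T by (auto simp: alpha_const_def beta_const_def)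
  define D where "D = Domain T"
  have D: "open D" "is_subgroup D" "D \<in> sets borel" using PT by (auto simp: D_def)
  have RR: "Range R \<in> sets borel" "open (Range R)" "is_subgroup (Range R)"
    using proper_subgroupD(3,5,7)[OF pR(2)] by simp_all
  obtain s where s: "s \<in> borel_measurable borel" "\<And>h. h \<in> D \<Longrightarrow> (h, s h) \<in> T"
    using borel_section_exists[OF pT(1)] unfolding D_def by auto
  obtain M where M: "fibre_measure T a' M" and \<tau>: "\<forall>A\<in>sets borel. emeasure \<tau> A =
      (\<integral>\<^sup>+h. (\<integral>\<^sup>+n. indicator A (h, n + s h) \<partial>M) * indicator (Domain T) h \<partial>\<eta>)"
    using fibre_measure_exists[OF pT(1) lh(2) uni(2) T(1) s[unfolded D_def]] by blast
  note M = fibre_measureD[OF M]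
  interpret M: finite_measure M by (rule M(8))
  note [measurable_cong] = lR(5) M(1) e(5)
  note [measurable] = s(1) D(3) RR(1)
  \<comment> \<open>Cutting \<mu> down to second coordinates in \<open>D\<close> makes
    \<open>s\<close> a section there, so that almost every \<open>h\<close> and
    \<open>n + s h\<close> are related by \<open>T\<close>.\<close>
  define \<sigma> where "\<sigma> = distr (density \<mu> (indicator (UNIV \<times> D)) \<Otimes>\<^sub>M M) borel
    (\<lambda>x. (fst (fst x), snd x + s (snd (fst x))))"
  have s\<sigma>: "sets \<sigma> = sets borel" by (simp add: \<sigma>_def)
  have sp\<sigma>: "space \<sigma> = UNIV" using sets_eq_imp_space_eq[OF s\<sigma>] by simp
  have e\<sigma>: "emeasure \<sigma> A =
      (\<integral>\<^sup>+p. (\<integral>\<^sup>+n. indicator A (fst p, n + s (snd p)) \<partial>M) * indicator D (snd p) \<partial>\<mu>)"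
    if A[measurable]: "A \<in> sets borel" for A
  proof -
    define f where "f x = (fst (fst x), snd x + s (snd (fst x)))" for x :: "('g \<times> 'h) \<times> 'k"
    have "emeasure \<sigma> A = (\<integral>\<^sup>+z. indicator A z \<partial>\<sigma>)" by (simp add: s\<sigma>)
    also have "\<dots> = (\<integral>\<^sup>+x. indicator A (f x) \<partial>(density \<mu> (indicator (UNIV \<times> D)) \<Otimes>\<^sub>M M))"
      unfolding \<sigma>_def f_def by (rule nn_integral_distr) measurable
    also have "\<dots> = (\<integral>\<^sup>+p. (\<integral>\<^sup>+n. indicator A (f (p, n)) \<partial>M) \<partial>density \<mu> (indicator (UNIV \<times> D)))"
      unfolding f_def by (rule M.nn_integral_fst[symmetric]) measurable
    also have "\<dots> = (\<integral>\<^sup>+p. indicator (UNIV \<times> D) p * (\<integral>\<^sup>+n. indicator A (f (p, n)) \<partial>M) \<partial>\<mu>)"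
      unfolding f_def by (rule nn_integral_density) measurable
    finally show ?thesis by (simp add: f_def indicator_times mult.commute)
  qed
  have eprod: "emeasure \<sigma> (A \<times> UNIV) = ennreal a' * emeasure \<mu> (A \<times> D)"
    if A[measurable]: "A \<in> sets borel" for A
  proof -
    have "emeasure \<sigma> (A \<times> UNIV) = (\<integral>\<^sup>+p. ennreal a' * indicator (A \<times> D) p \<partial>\<mu>)"
      by (subst e\<sigma>) (auto intro!: nn_integral_cong simp: indicator_def M)
    then show ?thesis by (simp add: nn_integral_cmult)
  qed
  define E where "E = Domain (R O T)"
  have E: "R\<inverse> `` D = E" "E \<in> sets borel" using PS(7) by (auto simp: E_def D_def)
  define n where "n = subgroup_index (indef R) (indef R \<inter> D)"
  have n: "0 < n" unfolding n_def
    by (intro index_pos finite_left_cosets_compact_open compact_indef[OF pR(1)] is_subgroup_indef PR D)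
  have nE: "of_nat n * emeasure \<mu> (A \<times> D) = ennreal a * emeasure \<gamma> (A \<inter> E)" if A: "A \<in> sets borel" for A
  proof -
    have "of_nat n * emeasure \<mu> (A \<times> D) = emeasure \<mu> ((A \<inter> E) \<times> UNIV)"
      using index_formula[OF pR(1) lh(1) D(1,2) _ A] E by (simp add: n_def)
    also have "\<dots> = ennreal a * emeasure \<gamma> (A \<inter> E \<inter> Domain R)"
      using R(1) A E(2) by (simp add: alpha_const_def)
    also have "A \<inter> E \<inter> Domain R = A \<inter> E" by (auto simp: E_def)
    finally show ?thesis .
  qed
  \<comment> \<open>Cancels the integer index in an identity of extended nonnegative reals.\<close>
  have div: "x = ennreal (c / m) * y" if "of_nat m * x = ennreal c * y" "0 < m" "0 < c" for m c x y
  proof -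
    have "of_nat m * x = of_nat m * (ennreal (c / m) * y)"
      using that by (simp add: mult.assoc[symmetric] ennreal_of_nat_eq_real_of_nat ennreal_mult[symmetric])
    then show ?thesis using that(2) by (simp add: ennreal_mult_cancel_left)
  qed
  have alpha: "alpha_const \<gamma> (R O T) \<sigma> (a * a' / n)"
    unfolding alpha_const_def
  proof (intro conjI ballI)
    show "0 < a * a' / n" using pos n by simp
    fix A :: "'g set" assume A: "A \<in> sets borel"
    have "of_nat n * emeasure \<sigma> (A \<times> UNIV) = ennreal a' * (of_nat n * emeasure \<mu> (A \<times> D))"
      by (simp add: eprod[OF A] mult.left_commute)
    also have "\<dots> = ennreal (a * a') * emeasure \<gamma> (A \<inter> E)"
      unfolding nE[OF A] using pos by (simp add: ennreal_mult mult.assoc[symmetric] mult.commute)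
    finally show "emeasure \<sigma> (A \<times> UNIV) = ennreal (a * a' / n) * emeasure \<gamma> (A \<inter> Domain (R O T))"
      using n pos by (intro div) (auto simp: E_def)
  qed
  have RTb: "R O T \<in> sets borel" using PS(8) .
  have inT: "(h, n + s h) \<in> T" if "h \<in> D" "n \<in> indef T" for h n
  proof -
    have "(0, n) + (h, s h) \<in> T"
      using that s(2) by (intro is_subgroup_add[OF PT(1)]) (auto simp: indef_def)
    then show ?thesis by simp
  qed
  have ae: "AE x in \<sigma>. x \<in> R O T"
  proof (rule AE_I[of _ _ "- (R O T)"])
    have "emeasure \<sigma> (- (R O T)) = (\<integral>\<^sup>+p. 0 \<partial>\<mu>)"
    proof (subst e\<sigma>)
      show "- (R O T) \<in> sets borel" using RTb by auto
      show "(\<integral>\<^sup>+p. (\<integral>\<^sup>+n. indicator (- (R O T)) (fst p, n + s (snd p)) \<partial>M) * indicator D (snd p) \<partial>\<mu>)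
          = (\<integral>\<^sup>+p. 0 \<partial>\<mu>)"
      proof (rule nn_integral_cong_AE, use lR(2) in eventually_elim)
        fix p assume p: "p \<in> R"
        have "(\<integral>\<^sup>+n. indicator (- (R O T)) (fst p, n + s (snd p)) \<partial>M) = (\<integral>\<^sup>+n. 0 \<partial>M)" if "snd p \<in> D"
        proof (rule nn_integral_cong_AE, use M(2) in eventually_elim)
          fix n assume "n \<in> indef T"
          then have "(fst p, n + s (snd p)) \<in> R O T"
            using p inT[OF that] by (cases p) auto
          then show "indicator (- (R O T)) (fst p, n + s (snd p)) = (0::ennreal)" by simp
        qed
        then show "(\<integral>\<^sup>+n. indicator (- (R O T)) (fst p, n + s (snd p)) \<partial>M) * indicator D (snd p) = 0"
          by (auto simp: indicator_def)
      qed
    qed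
    then show "emeasure \<sigma> (- (R O T)) = 0" by simp
    show "- (R O T) \<in> sets \<sigma>" using RTb by (auto simp: s\<sigma>)
  qed auto
  have li: "left_invariant (R O T) \<sigma>"
    unfolding left_invariant_def
  proof (intro ballI measure_eqI)
    fix z A assume z: "z \<in> R O T" and "A \<in> sets (distr \<sigma> borel ((+) z))"
    then have A[measurable]: "A \<in> sets borel" by simp
    obtain g0 h0 k0 where z0: "z = (g0, k0)" "(g0, h0) \<in> R" "(h0, k0) \<in> T" using z by auto
    define f where "f p = (\<integral>\<^sup>+n. indicator A (fst p, n + s (snd p)) \<partial>M) * indicator D (snd p)" for p
    have f[measurable]: "f \<in> borel_measurable borel" unfolding f_def by measurable
    have "emeasure (distr \<sigma> borel ((+) z)) A = emeasure \<sigma> {y. z + y \<in> A}"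
      using A s\<sigma> by (subst emeasure_distr) (auto simp: vimage_def sp\<sigma>)
    also have "\<dots> = (\<integral>\<^sup>+p. f ((g0, h0) + p) \<partial>\<mu>)"
    proof (subst e\<sigma>[OF borel_translate(1)[OF A]], rule nn_integral_cong)
      fix p :: "'g \<times> 'h"
      obtain g h where p: "p = (g, h)" by (cases p)
      show "(\<integral>\<^sup>+n. indicator {y. z + y \<in> A} (fst p, n + s (snd p)) \<partial>M) * indicator D (snd p)
          = f ((g0, h0) + p)"
      proof (cases "h \<in> D")
        case False
        \<comment> \<open>Translation by \<open>h0\<close> in \<open>D\<close> preserves the
          complement of \<open>D\<close>, where both sides vanish.\<close>
        moreover have "h0 + h \<notin> D"
          using False is_subgroup_translate_iff(1)[OF D(2), of h0 h] z0(3) by (auto simp: D_def)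
        ultimately show ?thesis by (simp add: p f_def)
      next
        case True
        have h0: "h0 \<in> D" using z0(3) by (auto simp: D_def)
        then have hh: "h0 + h \<in> D" using True is_subgroup_add[OF D(2)] by blast
        \<comment> \<open>The defect of \<open>s\<close> from being a homomorphism, relative to
          \<open>(h0, k0)\<close>; it lies in \<open>indef T\<close>.\<close>
        define c where "c = k0 + s h - s (h0 + h)"
        have "(h0, k0) + (h, s h) - (h0 + h, s (h0 + h)) \<in> T"
          by (intro is_subgroup_diff[OF PT(1)] is_subgroup_add[OF PT(1)] z0(3) s(2) True hh)
        then have c: "c \<in> indef T" by (simp add: c_def indef_def)
        have k0: "k0 \<in> Range T" using z0(3) by auto
        have "(\<integral>\<^sup>+n. indicator {y. z + y \<in> A} (fst p, n + s (snd p)) \<partial>M)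
            = (\<integral>\<^sup>+n. indicator A (g0 + g, k0 + (n + s h)) \<partial>M)"
          by (simp add: p z0(1) indicator_def)
        \<comment> \<open>With \<open>k0 + n\<close> written as \<open>(k0 + n - k0) + k0\<close>,
          conjugation invariance of \<open>M\<close> removes \<open>k0\<close> from the fibre
          variable, and right invariance then removes \<open>c\<close>.\<close>
        also have "\<dots> = (\<integral>\<^sup>+n. indicator A (g0 + g, (k0 + n - k0) + c + s (h0 + h)) \<partial>M)"
          by (simp add: c_def add.assoc diff_conv_add_uminus del: add_uminus_conv_diff)
        also have "\<dots> = (\<integral>\<^sup>+n. indicator A (g0 + g, n + c + s (h0 + h)) \<partial>distr M borel (\<lambda>n. k0 + n - k0))"
          by (rule nn_integral_distr[symmetric]) measurable
        also have "\<dots> = (\<integral>\<^sup>+n. indicator A (g0 + g, (n + c) + s (h0 + h)) \<partial>M)"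
          by (simp add: M(5)[OF k0])
        also have "\<dots> = (\<integral>\<^sup>+n. indicator A (g0 + g, n + s (h0 + h)) \<partial>M)"
          by (rule nn_integral_right_invariant[OF M(4,1) c]) measurable
        finally show ?thesis using True hh by (simp add: f_def p)
      qed
    qed
    also have "\<dots> = (\<integral>\<^sup>+p. f p \<partial>\<mu>)"
      by (rule nn_integral_left_invariant[OF lR(3,5) z0(2)]) measurable
    also have "\<dots> = emeasure \<sigma> A" using e\<sigma>[OF A] by (simp add: f_def)
    finally show "emeasure (distr \<sigma> borel ((+) z)) A = emeasure \<sigma> A" .
  qed (simp add: s\<sigma>)
  have lf: "locally_finite \<sigma>"
    unfolding locally_finite_def
  proof (intro conjI allI impI)
    \<comment> \<open>Local finiteness is read off the first marginal, as \<open>C\<close> lies over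
      its compact projection.\<close>
    fix C :: "('g \<times> 'k) set" assume C: "compact C"
    then have c1: "compact (fst ` C)" by (intro compact_continuous_image continuous_intros)
    then have cb: "fst ` C \<in> sets borel" by (rule borel_compact)
    have "C \<subseteq> fst ` C \<times> UNIV" by force
    then have "emeasure \<sigma> C \<le> emeasure \<sigma> (fst ` C \<times> UNIV)"
      using cb s\<sigma> by (intro emeasure_mono) auto
    also have "\<dots> = ennreal (a * a' / n) * emeasure \<gamma> (fst ` C \<inter> Domain (R O T))"
      using alpha cb by (simp add: alpha_const_def)
    also have "\<dots> \<le> ennreal (a * a' / n) * emeasure \<gamma> (fst ` C)"
      using cb lhaarD(5)[OF unimodular_haarD(1)[OF uni(1)]] by (intro mult_left_mono emeasure_mono) auto
    also have "\<dots> < \<infinity>"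
      using c1 lhaarD(1)[OF unimodular_haarD(1)[OF uni(1)]] by (auto simp: locally_finite_def ennreal_mult_less_top)
    finally show "emeasure \<sigma> C < \<infinity>" .
  qed (rule s\<sigma>)
  have nz: "emeasure \<sigma> UNIV \<noteq> 0"
  proof -
    have "emeasure \<mu> (UNIV \<times> D) \<noteq> 0"
      using D(1) is_subgroup_zero[OF D(2)]
      by (intro lhaar_open_pos[OF lh(1) PR(1) _ is_subgroup_zero[OF PR(1)]]) (auto intro: open_Times simp: zero_prod_def)
    then show ?thesis using eprod[of UNIV] pos by simp
  qed
  have lS: "lhaar (R O T) \<sigma>" using lf ae li nz by (simp add: lhaar_def)
  define n' where "n' = subgroup_index (ker T) (ker T \<inter> Range R)"
  have ker: "indef (T\<inverse>) = ker T" by (simp add: indef_def ker_def)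
  have n': "0 < n'" unfolding n'_def ker[symmetric]
    by (intro index_pos finite_left_cosets_compact_open compact_indef[OF pT(2)] is_subgroup_indef
        proper_subgroupD(1)[OF pT(2)] RR)
  have clT: "closed T" using PT(2) .
  \<comment> \<open>The index formula for \<open>T\<inverse>\<close>, where \<open>indef\<close>
    becomes \<open>ker\<close> and the open subgroup is \<open>Range R\<close>.\<close>
  have nE': "of_nat n' * emeasure \<tau> (Range R \<times> B) = ennreal b' * emeasure \<kappa> (B \<inter> Range (R O T))"
    if B: "B \<in> sets borel" for B
  proof -
    have im: "T `` Range R = Range (R O T)" by auto
    have RS: "Range (R O T) \<in> sets borel" using proper_subgroupD(7)[OF pS(2)] by simp
    have "of_nat n' * emeasure \<tau> (Range R \<times> B) = of_nat n' * emeasure (distr \<tau> borel prod.swap) (B \<times> Range R)"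
      by (subst lhaar_converse(2)[OF lh(2) clT RR(1) B]) simp
    also have "\<dots> = emeasure (distr \<tau> borel prod.swap) ((B \<inter> Range (R O T)) \<times> UNIV)"
      using index_formula[OF pT(2) lhaar_converse(1)[OF lh(2) clT] RR(2,3) _ B] im RS
      by (simp add: n'_def ker)
    also have "\<dots> = emeasure \<tau> (UNIV \<times> (B \<inter> Range (R O T)))"
      using B RS by (intro lhaar_converse(2)[OF lh(2) clT]) auto
    also have "\<dots> = ennreal b' * emeasure \<kappa> (B \<inter> Range (R O T) \<inter> Range T)"
      using T(2) B RS by (simp add: beta_const_def)
    also have "B \<inter> Range (R O T) \<inter> Range T = B \<inter> Range (R O T)" by auto
    finally show ?thesis .
  qed
  have beta: "beta_const \<kappa> (R O T) \<sigma> (b * b' / n')"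
    unfolding beta_const_def
  proof (intro conjI ballI)
    show "0 < b * b' / n'" using pos n' by simp
    fix B :: "'k set" assume B[measurable]: "B \<in> sets borel"
    define G where "G h = (\<integral>\<^sup>+n. indicator B (n + s h) \<partial>M) * indicator D h" for h
    have G[measurable]: "G \<in> borel_measurable borel" unfolding G_def by measurable
    have "emeasure \<sigma> (UNIV \<times> B) = (\<integral>\<^sup>+p. G (snd p) \<partial>\<mu>)"
      by (subst e\<sigma>) (auto intro!: nn_integral_cong simp: G_def indicator_def)
    also have "\<dots> = (\<integral>\<^sup>+h. G h \<partial>distr \<mu> borel snd)"
      by (subst nn_integral_distr) measurable
    also have "\<dots> = ennreal b * (\<integral>\<^sup>+h. G h * indicator (Range R) h \<partial>\<eta>)"
      unfolding conjunct2[OF R(2)[unfolded beta_const_iff_distr[OF lh(1) e(5) RR(1)]]]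
      by (simp add: nn_integral_scale_measure nn_integral_density mult.commute)
    \<comment> \<open>The indicator of \<open>Domain T\<close> is built into \<open>G\<close>, so
      the indicator of \<open>Range R\<close> completes the integral that represents \<tau> on
      \<open>Range R \<times> B\<close>.\<close>
    also have "(\<integral>\<^sup>+h. G h * indicator (Range R) h \<partial>\<eta>) = emeasure \<tau> (Range R \<times> B)"
      using \<tau> B RR(1)
      by (simp add: G_def D_def) (auto intro!: nn_integral_cong simp: indicator_def)
    finally have 1: "emeasure \<sigma> (UNIV \<times> B) = ennreal b * emeasure \<tau> (Range R \<times> B)" .
    have "of_nat n' * emeasure \<sigma> (UNIV \<times> B) = ennreal b * (of_nat n' * emeasure \<tau> (Range R \<times> B))"
      by (simp add: 1 mult.left_commute)
    also have "\<dots> = ennreal (b * b') * emeasure \<kappa> (B \<inter> Range (R O T))"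
      unfolding nE'[OF B] using pos by (simp add: ennreal_mult mult.assoc[symmetric])
    finally show "emeasure \<sigma> (UNIV \<times> B) = ennreal (b * b' / n') * emeasure \<kappa> (B \<inter> Range (R O T))"
      using n' pos by (intro div) auto
  qed
  show ?thesis using lS alpha beta by (auto simp: n_def n'_def D_def)
qed

section \<open>Indices\<close>

lemma left_cosets_reps:
  obtains r where "\<And>c. c \<in> left_cosets A B \<Longrightarrow> r c \<in> A" "\<And>c. c \<in> left_cosets A B \<Longrightarrow> c = (+) (r c) ` B"
proof -
  have "\<forall>c\<in>left_cosets A B. \<exists>r. r \<in> A \<and> c = (+) r ` B" by (auto simp: left_cosets_def)
  then show ?thesis using that by metis
qed

lemma left_coset_in_cosets: "x \<in> A \<Longrightarrow> (+) x ` B \<in> left_cosets A B"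
  by (simp add: left_cosets_def)

lemma group_hom_zero_minus:
  fixes f :: "'a::group_add \<Rightarrow> 'b::group_add"
  assumes "\<And>x y. f (x + y) = f x + f y"
  shows "f 0 = 0" "f (- x) = - f x" "f (x - y) = f x - f y"
proof -
  have "f 0 + f 0 = f 0 + 0" using assms[of 0 0] by simp
  then show 1: "f 0 = 0" by (simp only: add_left_cancel)
  show 2: "f (- x) = - f x" for x
    using assms[of "- x" x] 1 by (simp add: eq_neg_iff_add_eq_0)
  show "f (x - y) = f x - f y"
    using assms[of x "- y"] 2[of y] by simp
qed

text \<open>Cosets of \<open>P1\<close> in \<open>P\<close> correspond to pairs: with
  \<open>p\<close> lifting representatives of the cosets in the image and \<open>m\<close>
  representing those in the kernel, \<open>p c + m d\<close> runs through a system of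
  representatives. As the identity comes from a bijection, it covers infinite indices as well, which
  \<open>card\<close> counts as \<open>0\<close>.\<close>

lemma subgroup_index_hom:
  fixes f :: "'a::group_add \<Rightarrow> 'b::group_add"
  assumes P: "is_subgroup P" "is_subgroup P1" "P1 \<subseteq> P" and f: "\<And>x y. f (x + y) = f x + f y"
  shows "subgroup_index P P1 =
    subgroup_index (f ` P) (f ` P1) * subgroup_index {x\<in>P. f x = 0} {x\<in>P1. f x = 0}"
proof -
  note f0 = group_hom_zero_minus(1)[OF f] and fm = group_hom_zero_minus(2)[OF f] and fd = group_hom_zero_minus(3)[OF f]
  define K where "K = {x\<in>P. f x = 0}"
  define K1 where "K1 = {x\<in>P1. f x = 0}"
  note SP = is_subgroupD[OF P(1)] and SP1 = is_subgroupD[OF P(2)]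
  have K1: "is_subgroup K1"
    unfolding is_subgroup_def K1_def using SP1 f f0 fm by auto
  have fP1: "is_subgroup (f ` P1)"
    unfolding is_subgroup_def
  proof (intro conjI ballI)
    show "0 \<in> f ` P1" using SP1(1) f0 by force
    fix x assume "x \<in> f ` P1"
    then obtain u where u: "u \<in> P1" "x = f u" by blast
    show "- x \<in> f ` P1" using u SP1(3) fm by (metis imageI)
    fix y assume "y \<in> f ` P1"
    then obtain v where v: "v \<in> P1" "y = f v" by blast
    show "x + y \<in> f ` P1" using u v SP1(2) f by (metis imageI)
  qed
  obtain p where p: "\<And>c. c \<in> left_cosets (f ` P) (f ` P1) \<Longrightarrow> p c \<in> P"
    "\<And>c. c \<in> left_cosets (f ` P) (f ` P1) \<Longrightarrow> c = (+) (f (p c)) ` (f ` P1)"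
  proof -
    have "\<forall>c\<in>left_cosets (f ` P) (f ` P1). \<exists>r. r \<in> P \<and> c = (+) (f r) ` (f ` P1)"
      by (auto simp: left_cosets_def)
    then show ?thesis using that by metis
  qed
  obtain m where m: "\<And>d. d \<in> left_cosets K K1 \<Longrightarrow> m d \<in> K"
    "\<And>d. d \<in> left_cosets K K1 \<Longrightarrow> d = (+) (m d) ` K1"
    by (rule left_cosets_reps) (rule that)
  have "bij_betw (\<lambda>(c, d). (+) (p c + m d) ` P1)
      (left_cosets (f ` P) (f ` P1) \<times> left_cosets K K1) (left_cosets P P1)"
    unfolding bij_betw_def
  proof
    show "inj_on (\<lambda>(c, d). (+) (p c + m d) ` P1) (left_cosets (f ` P) (f ` P1) \<times> left_cosets K K1)"
    proof (rule inj_onI, clarify)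
      fix c d c' d'
      assume cd: "c \<in> left_cosets (f ` P) (f ` P1)" "d \<in> left_cosets K K1"
        "c' \<in> left_cosets (f ` P) (f ` P1)" "d' \<in> left_cosets K K1"
        and "(+) (p c + m d) ` P1 = (+) (p c' + m d') ` P1"
      then have eq: "- (p c + m d) + (p c' + m d') \<in> P1" using left_coset_eq_iff[OF P(2)] by blast
      have z: "f (m d) = 0" "f (m d') = 0" using m(1) cd by (auto simp: K_def)
      have "f (- (p c + m d) + (p c' + m d')) = - f (p c) + f (p c')"
        using z by (simp add: f fm fd minus_add)
      then have "- f (p c) + f (p c') \<in> f ` P1" using eq by (metis imageI)
      then have "(+) (f (p c)) ` f ` P1 = (+) (f (p c')) ` f ` P1" using left_coset_eq_iff[OF fP1] by blast
      then have c: "c = c'" using p(2)[OF cd(1)] p(2)[OF cd(3)] by simp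
      have "- (p c + m d) + (p c' + m d') = - m d + m d'"
        unfolding c by (simp add: minus_add add.assoc diff_conv_add_uminus del: add_uminus_conv_diff)
      then have "- m d + m d' \<in> K1" using eq z by (simp add: K1_def f fm fd)
      then have "(+) (m d) ` K1 = (+) (m d') ` K1" using left_coset_eq_iff[OF K1] by blast
      then have "d = d'" using m(2)[OF cd(2)] m(2)[OF cd(4)] by simp
      then show "c = c' \<and> d = d'" using c by simp
    qed
    show "(\<lambda>(c, d). (+) (p c + m d) ` P1) ` (left_cosets (f ` P) (f ` P1) \<times> left_cosets K K1) = left_cosets P P1"
    proof (intro equalityI subsetI)
      fix e assume "e \<in> (\<lambda>(c, d). (+) (p c + m d) ` P1) ` (left_cosets (f ` P) (f ` P1) \<times> left_cosets K K1)"
      then obtain c d where cd: "c \<in> left_cosets (f ` P) (f ` P1)" "d \<in> left_cosets K K1"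
        "e = (+) (p c + m d) ` P1" by auto
      have "p c + m d \<in> P" using p(1)[OF cd(1)] m(1)[OF cd(2)] SP(2) by (simp add: K_def)
      then show "e \<in> left_cosets P P1" unfolding cd(3) by (rule left_coset_in_cosets)
    next
      fix e assume "e \<in> left_cosets P P1"
      then obtain x where x: "x \<in> P" "e = (+) x ` P1" by (rule left_cosets_rep)
      define c where "c = (+) (f x) ` f ` P1"
      have c: "c \<in> left_cosets (f ` P) (f ` P1)" unfolding c_def using x by (intro left_coset_in_cosets) auto
      have "- f (p c) + f x \<in> f ` P1"
        using p(2)[OF c] left_coset_eq_iff[OF fP1, of "f (p c)" "f x"] c_def by blast
      then obtain q where q: "q \<in> P1" "- f (p c) + f x = f q" by blast
      \<comment> \<open>The element \<open>q\<close> of \<open>P1\<close> has the same image as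
        \<open>- p c + x\<close>, so their difference lies in the kernel.\<close>
      define u where "u = - p c + x - q"
      have u: "u \<in> K"
      proof -
        have "u \<in> P" unfolding u_def
          using q(1) P(3) by (intro SP(4)[OF SP(2)[OF SP(3)[OF p(1)[OF c]] x(1)]]) auto
        moreover have "f u = f (- p c + x) + f (- q)"
          unfolding u_def diff_conv_add_uminus by (rule f)
        then have "f u = 0" using q(2) by (simp add: f fm fd)
        ultimately show ?thesis by (simp add: K_def)
      qed
      define d where "d = (+) u ` K1"
      have d: "d \<in> left_cosets K K1" unfolding d_def by (rule left_coset_in_cosets[OF u])
      have "- m d + u \<in> K1"
        using m(2)[OF d] left_coset_eq_iff[OF K1, of "m d" u] d_def by blast
      then have "- m d + u + q \<in> P1" using SP1(2) q(1) by (simp add: K1_def)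
      moreover have "- m d + u + q = - (p c + m d) + x"
        by (simp add: u_def minus_add add.assoc diff_conv_add_uminus del: add_uminus_conv_diff)
      ultimately have "(+) (p c + m d) ` P1 = e"
        using left_coset_eq_iff[OF P(2), of "p c + m d" x] x(2) by simp
      then show "e \<in> (\<lambda>(c, d). (+) (p c + m d) ` P1) ` (left_cosets (f ` P) (f ` P1) \<times> left_cosets K K1)"
        using c d by (intro image_eqI[of _ _ "(c, d)"]) auto
    qed
  qed
  from bij_betw_same_card[OF this] show ?thesis
    by (simp add: subgroup_index_def card_cartesian_product K_def K1_def)
qed

text \<open>Products \<open>a c + b d\<close> of representatives of the two steps represent the
  cosets of \<open>C\<close> in \<open>A\<close>.\<close>

lemma subgroup_index_tower:
  fixes A :: "'a::group_add set"
  assumes S: "is_subgroup A" "is_subgroup B" "is_subgroup C" "C \<subseteq> B" "B \<subseteq> A"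
  shows "subgroup_index A C = subgroup_index A B * subgroup_index B C"
proof -
  note SA = is_subgroupD[OF S(1)] and SB = is_subgroupD[OF S(2)]
  obtain a where a: "\<And>c. c \<in> left_cosets A B \<Longrightarrow> a c \<in> A" "\<And>c. c \<in> left_cosets A B \<Longrightarrow> c = (+) (a c) ` B"
    by (rule left_cosets_reps) (rule that)
  obtain b where b: "\<And>c. c \<in> left_cosets B C \<Longrightarrow> b c \<in> B" "\<And>c. c \<in> left_cosets B C \<Longrightarrow> c = (+) (b c) ` C"
    by (rule left_cosets_reps) (rule that)
  have "bij_betw (\<lambda>(c, d). (+) (a c + b d) ` C) (left_cosets A B \<times> left_cosets B C) (left_cosets A C)"
    unfolding bij_betw_def
  proof
    show "inj_on (\<lambda>(c, d). (+) (a c + b d) ` C) (left_cosets A B \<times> left_cosets B C)"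
    proof (rule inj_onI, clarify)
      fix c d c' d'
      assume cd: "c \<in> left_cosets A B" "d \<in> left_cosets B C" "c' \<in> left_cosets A B" "d' \<in> left_cosets B C"
        and "(+) (a c + b d) ` C = (+) (a c' + b d') ` C"
      then have eq: "- (a c + b d) + (a c' + b d') \<in> C" using left_coset_eq_iff[OF S(3)] by blast
      \<comment> \<open>Stripping off the elements of \<open>B\<close> leaves
        \<open>- a c + a c'\<close>, so the two cosets of \<open>B\<close> agree.\<close>
      have "b d + (- (a c + b d) + (a c' + b d')) - b d' \<in> B"
        using eq S(4) by (intro SB(4)[OF SB(2)[OF b(1)[OF cd(2)]] b(1)[OF cd(4)]]) auto
      moreover have "b d + (- (a c + b d) + (a c' + b d')) - b d' = - a c + a c'"
        by (simp add: minus_add add.assoc diff_conv_add_uminus del: add_uminus_conv_diff)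
      ultimately have "(+) (a c) ` B = (+) (a c') ` B" using left_coset_eq_iff[OF S(2)] by metis
      then have c: "c = c'" using a(2)[OF cd(1)] a(2)[OF cd(3)] by simp
      have "- (a c + b d) + (a c' + b d') = - b d + b d'"
        unfolding c by (simp add: minus_add add.assoc diff_conv_add_uminus del: add_uminus_conv_diff)
      then have "(+) (b d) ` C = (+) (b d') ` C" using eq left_coset_eq_iff[OF S(3)] by metis
      then have "d = d'" using b(2)[OF cd(2)] b(2)[OF cd(4)] by simp
      then show "c = c' \<and> d = d'" using c by simp
    qed
    show "(\<lambda>(c, d). (+) (a c + b d) ` C) ` (left_cosets A B \<times> left_cosets B C) = left_cosets A C"
    proof (intro equalityI subsetI)
      fix e assume "e \<in> (\<lambda>(c, d). (+) (a c + b d) ` C) ` (left_cosets A B \<times> left_cosets B C)"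
      then obtain c d where cd: "c \<in> left_cosets A B" "d \<in> left_cosets B C" "e = (+) (a c + b d) ` C"
        by auto
      have "a c + b d \<in> A" using b(1)[OF cd(2)] S(5) by (intro SA(2)[OF a(1)[OF cd(1)]]) auto
      then show "e \<in> left_cosets A C" unfolding cd(3) by (rule left_coset_in_cosets)
    next
      fix e assume "e \<in> left_cosets A C"
      then obtain x where x: "x \<in> A" "e = (+) x ` C" by (rule left_cosets_rep)
      define c where "c = (+) x ` B"
      have c: "c \<in> left_cosets A B" unfolding c_def by (rule left_coset_in_cosets[OF x(1)])
      have u: "- a c + x \<in> B"
        using a(2)[OF c] left_coset_eq_iff[OF S(2), of "a c" x] c_def by blast
      define d where "d = (+) (- a c + x) ` C"
      have d: "d \<in> left_cosets B C" unfolding d_def by (rule left_coset_in_cosets[OF u])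
      have "- b d + (- a c + x) \<in> C"
        using b(2)[OF d] left_coset_eq_iff[OF S(3), of "b d" "- a c + x"] d_def by blast
      moreover have "- b d + (- a c + x) = - (a c + b d) + x"
        by (simp add: minus_add add.assoc diff_conv_add_uminus del: add_uminus_conv_diff)
      ultimately have "(+) (a c + b d) ` C = e"
        using left_coset_eq_iff[OF S(3), of "a c + b d" x] x(2) by simp
      then show "e \<in> (\<lambda>(c, d). (+) (a c + b d) ` C) ` (left_cosets A B \<times> left_cosets B C)"
        using c d by (intro image_eqI[of _ _ "(c, d)"]) auto
    qed
  qed
  from bij_betw_same_card[OF this] show ?thesis
    by (simp add: subgroup_index_def card_cartesian_product)
qed

lemma subgroup_index_self:
  fixes A :: "'a::group_add set"
  assumes "is_subgroup A"
  shows "subgroup_index A A = 1"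
proof -
  have "(+) x ` A = (+) 0 ` A" if "x \<in> A" for x
    using that assms is_subgroup_uminus_iff[OF assms] by (subst left_coset_eq_iff[OF assms]) auto
  then have "left_cosets A A = {A}"
    using is_subgroup_zero[OF assms] unfolding left_cosets_def by auto
  then show ?thesis by (simp add: subgroup_index_def)
qed

text \<open>
  Both sides count \<open>{(h, k) \<in> T. h \<in> indef R}\<close> modulo \<open>k \<in> D\<close>, through its projections
  to the two factors.
\<close>

lemma index_relcomp:
  fixes R :: "('g::group_add \<times> 'h::group_add) set" and T :: "('h \<times> 'k::group_add) set"
  assumes "is_subgroup R" "is_subgroup T" "is_subgroup D"
  shows "subgroup_index (indef R) (indef R \<inter> T\<inverse> `` D) * subgroup_index (indef T) (indef T \<inter> D) =
    subgroup_index (indef (R O T)) (indef (R O T) \<inter> D) * subgroup_index (indef R) (indef R \<inter> Domain T)"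
proof -
  define A where "A = indef R"
  have A: "is_subgroup A" unfolding A_def by (rule is_subgroup_indef[OF assms(1)])
  define P where "P = {x\<in>T. fst x \<in> A}"
  define P1 where "P1 = {x\<in>P. snd x \<in> D}"
  have P: "is_subgroup P" unfolding P_def is_subgroup_def
    using is_subgroupD[OF A] is_subgroupD[OF assms(2)] by auto
  have P1: "is_subgroup P1" unfolding P1_def is_subgroup_def
    using is_subgroupD[OF P] is_subgroupD[OF assms(3)] by auto
  have P1P: "P1 \<subseteq> P" by (auto simp: P1_def)
  have B: "fst ` P = A \<inter> Domain T" by (force simp: P_def)
  have C: "fst ` P1 = A \<inter> T\<inverse> `` D" by (force simp: P1_def P_def)
  have Q: "snd ` P = indef (R O T)" by (force simp: P_def A_def indef_def)
  have E: "snd ` P1 = indef (R O T) \<inter> D" by (force simp: P1_def P_def A_def indef_def)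
  have sB: "is_subgroup (A \<inter> Domain T)"
    using is_subgroupD[OF A] is_subgroupD[OF is_subgroup_Domain[OF assms(2)]] by (auto simp: is_subgroup_def)
  have sTD: "is_subgroup (T\<inverse> `` D)"
    unfolding is_subgroup_def
  proof (intro conjI ballI)
    show "0 \<in> T\<inverse> `` D" using is_subgroup_zero[OF assms(2)] is_subgroup_zero[OF assms(3)] by (auto simp: zero_prod_def)
    fix x assume "x \<in> T\<inverse> `` D"
    then obtain u where u: "u \<in> D" "(x, u) \<in> T" by blast
    show "- x \<in> T\<inverse> `` D"
      using is_subgroup_uminus[OF assms(3) u(1)] is_subgroup_uminus[OF assms(2) u(2)] by auto
    fix y assume "y \<in> T\<inverse> `` D"
    then obtain v where v: "v \<in> D" "(y, v) \<in> T" by blast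
    show "x + y \<in> T\<inverse> `` D"
      using is_subgroup_add[OF assms(3) u(1) v(1)] is_subgroup_add[OF assms(2) u(2) v(2)] by auto
  qed
  then have sC: "is_subgroup (A \<inter> T\<inverse> `` D)"
    using is_subgroupD[OF A] is_subgroupD[OF sTD] by (auto simp: is_subgroup_def)
  have ker_sg: "is_subgroup {x\<in>X. f x = 0}"
    if "is_subgroup X" "\<And>x y. f (x + y) = f x + f y" for X and f :: "'x::group_add \<Rightarrow> 'y::group_add"
    using is_subgroupD[OF that(1)] that(2) group_hom_zero_minus[OF that(2)] by (auto simp: is_subgroup_def)
  define K where "K = {x\<in>P. fst x = 0}"
  define K1 where "K1 = {x\<in>P1. fst x = 0}"
  have K: "is_subgroup K" "is_subgroup K1" "K1 \<subseteq> K"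
    unfolding K_def K1_def
    by (rule ker_sg[OF P], simp, rule ker_sg[OF P1], simp, auto simp: P1_def)
  \<comment> \<open>On \<open>K\<close> and \<open>K1\<close> the map \<open>snd\<close> has the
    same kernel because \<open>0\<close> is in \<open>D\<close>, so passing to the images in the
    last group preserves the index.\<close>
  have kf: "subgroup_index K K1 = subgroup_index (indef T) (indef T \<inter> D)"
  proof -
    have i: "snd ` K = indef T" "snd ` K1 = indef T \<inter> D"
      using is_subgroup_zero[OF A] by (force simp: K_def K1_def P_def P1_def indef_def)+
    have "{x\<in>K1. snd x = 0} = {x\<in>K. snd x = 0}"
      using is_subgroup_zero[OF assms(3)] by (auto simp: K_def K1_def P1_def)
    then have "subgroup_index {x\<in>K. snd x = 0} {x\<in>K1. snd x = 0} = 1"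
      using subgroup_index_self[OF ker_sg[OF K(1), of snd]] by simp
    then show ?thesis using subgroup_index_hom[OF K, of snd] i by simp
  qed
  have 1: "subgroup_index P P1 =
      subgroup_index (A \<inter> Domain T) (A \<inter> T\<inverse> `` D) * subgroup_index (indef T) (indef T \<inter> D)"
    using subgroup_index_hom[OF P P1 P1P, of fst] kf[unfolded K_def K1_def] B C by simp
  \<comment> \<open>Projecting \<open>P\<close> to the last group loses only the kernel of
    \<open>snd\<close>, which lies in \<open>P1\<close> as well.\<close>
  have "{x\<in>P1. snd x = 0} = {x\<in>P. snd x = 0}"
    using is_subgroup_zero[OF assms(3)] by (auto simp: P1_def)
  then have "subgroup_index {x\<in>P. snd x = 0} {x\<in>P1. snd x = 0} = 1"
    using subgroup_index_self[OF ker_sg[OF P, of snd]] by simp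
  then have 2: "subgroup_index P P1 = subgroup_index (indef (R O T)) (indef (R O T) \<inter> D)"
    using subgroup_index_hom[OF P P1 P1P, of snd] Q E by simp
  \<comment> \<open>The projection to the middle group sees only \<open>A \<inter> Domain T\<close>;
    the tower law passes from there to \<open>A\<close> and brings in the remaining index.\<close>
  have 3: "subgroup_index A (A \<inter> T\<inverse> `` D) =
      subgroup_index A (A \<inter> Domain T) * subgroup_index (A \<inter> Domain T) (A \<inter> T\<inverse> `` D)"
    by (rule subgroup_index_tower[OF A sB sC]) auto
  show ?thesis using 1 2 3 by (simp add: A_def)
qed

section \<open>Polyhomomorphisms\<close>

lemma beta_const_iff_converse:
  fixes S :: "('g::lcsc_group \<times> 'h::lcsc_group) set"
  assumes "lhaar S \<mu>" "closed S"
  shows "beta_const \<eta> S \<mu> b \<longleftrightarrow> alpha_const \<eta> (S\<inverse>) (distr \<mu> borel prod.swap) b"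
  unfolding alpha_const_def beta_const_def by (simp add: lhaar_converse(2)[OF assms])

lemma lhaar_eq_if_alpha_const:
  fixes S :: "('g::lcsc_group \<times> 'h::lcsc_group) set"
  assumes "proper_subgroup S" "unimodular_haar \<gamma>" "lhaar S \<mu>" "lhaar S \<mu>'"
    "alpha_const \<gamma> S \<mu> a" "alpha_const \<gamma> S \<mu>' a"
  shows "\<mu> = \<mu>'"
proof (rule measure_eqI)
  show "sets \<mu> = sets \<mu>'" using lhaarD(5)[OF assms(3)] lhaarD(5)[OF assms(4)] by simp
  fix A assume "A \<in> sets \<mu>"
  then have A: "A \<in> sets borel" using lhaarD(5)[OF assms(3)] by simp
  have "0 < a" using assms(5) by (simp add: alpha_const_def)
  then show "emeasure \<mu> A = emeasure \<mu>' A"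
    using lhaar_proportional[OF assms(1,2,3,5,4,6) A] by (simp add: ennreal_mult_cancel_left)
qed

text \<open>The swap turns \<open>beta_const\<close> into \<open>alpha_const\<close> for the
  converse; being an involution, it leads back from equal images to equal measures.\<close>

lemma lhaar_eq_if_beta_const:
  fixes S :: "('g::lcsc_group \<times> 'h::lcsc_group) set"
  assumes "proper_subgroup (S\<inverse>)" "closed S" "unimodular_haar \<eta>" "lhaar S \<mu>" "lhaar S \<mu>'"
    "beta_const \<eta> S \<mu> b" "beta_const \<eta> S \<mu>' b"
  shows "\<mu> = \<mu>'"
proof -
  have swap: "distr (distr \<nu> borel prod.swap) borel prod.swap = \<nu>" if "lhaar S \<nu>" for \<nu>
  proof -
    have sw: "prod.swap \<in> borel_measurable (borel :: ('x::topological_space \<times> 'y::topological_space) measure)"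
      by (intro borel_measurable_continuous_onI continuous_on_swap)
    have "prod.swap \<in> borel_measurable \<nu>"
      using sw by (simp add: measurable_cong_sets[OF lhaarD(5)[OF that] refl])
    then have "distr (distr \<nu> borel prod.swap) borel prod.swap = distr \<nu> borel (\<lambda>x. x)"
      by (subst distr_distr[OF sw]) (auto simp: comp_def)
    then show ?thesis using distr_id2[OF lhaarD(5)[OF that, symmetric]] by simp
  qed
  have "distr \<mu> borel prod.swap = distr \<mu>' borel prod.swap"
    using assms by (intro lhaar_eq_if_alpha_const[OF assms(1,3), of _ _ b] lhaar_converse(1))
      (simp_all add: beta_const_iff_converse)
  then show ?thesis using swap assms(4,5) by metis
qed

text \<open>Evaluates the definite description: \<rho> and its ambient extension have the same image
  in the first factor, and the constant is unique.\<close>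

lemma ph_alpha_eq:
  fixes S :: "('g::lcsc_group \<times> 'h::lcsc_group) set" and \<gamma> :: "'g measure"
  assumes "proper_subgroup S" "unimodular_haar \<gamma>" "haar_on S \<rho>" "alpha_const \<gamma> S (borel_extension \<rho>) a"
  shows "ph_alpha \<gamma> S \<rho> = a"
proof -
  note P = proper_subgroupD[OF assms(1)]
  note lh = lhaar_borel_extension[OF assms(3) P(2,1)]
  note g = lhaarD[OF unimodular_haarD(1)[OF assms(2)]]
  have "fst \<in> borel_measurable (borel :: ('g \<times> 'h) measure)" by measurable
  then have "distr \<rho> borel fst = distr (borel_extension \<rho>) borel fst"
    unfolding borel_extension_def by (subst distr_distr[OF _ haar_onD(2)[OF assms(3) P(2)]]) (auto simp: comp_def)
  then have "ph_alpha \<gamma> S \<rho> = (THE a. alpha_const \<gamma> S (borel_extension \<rho>) a)"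
    unfolding ph_alpha_def alpha_const_iff_distr[OF lh g(5) P(7)] by simp
  also have "\<dots> = a"
    using assms(4) alpha_const_unique[OF _ assms(4) P(3,1) assms(2)] by (rule the_equality)
  finally show ?thesis .
qed

lemma ph_beta_eq:
  fixes S :: "('g::lcsc_group \<times> 'h::lcsc_group) set" and \<eta> :: "'h measure"
  assumes "biproper S" "unimodular_haar \<eta>" "haar_on S \<rho>" "beta_const \<eta> S (borel_extension \<rho>) b"
  shows "ph_beta \<eta> S \<rho> = b"
proof -
  have p: "proper_subgroup S" "proper_subgroup (S\<inverse>)" using assms(1) by (auto simp: biproper_def)
  note P = proper_subgroupD[OF p(1)] and P' = proper_subgroupD[OF p(2)]
  note lh = lhaar_borel_extension[OF assms(3) P(2,1)]
  note g = lhaarD[OF unimodular_haarD(1)[OF assms(2)]]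
  have "snd \<in> borel_measurable (borel :: ('g \<times> 'h) measure)" by measurable
  then have "distr \<rho> borel snd = distr (borel_extension \<rho>) borel snd"
    unfolding borel_extension_def by (subst distr_distr[OF _ haar_onD(2)[OF assms(3) P(2)]]) (auto simp: comp_def)
  then have "ph_beta \<eta> S \<rho> = (THE b. beta_const \<eta> S (borel_extension \<rho>) b)"
    using P'(7) unfolding ph_beta_def by (simp add: beta_const_iff_distr[OF lh g(5)])
  also have "\<dots> = b"
    using assms(4) alpha_const_unique[OF _ _ P'(3,1) assms(2)]
    unfolding beta_const_iff_converse[OF lh P(2)] by blast
  finally show ?thesis .
qed

lemma PH_in_Polh_iff:
  fixes \<gamma> :: "'g::lcsc_group measure" and \<eta> :: "'h::lcsc_group measure"
  shows "PH R \<rho> \<in> Polh \<gamma> \<eta> \<longleftrightarrow> is_subgroup R \<and> closed R \<and> haar_on R \<rho> \<and>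
    (\<forall>A\<in>sets borel. emeasure (borel_extension \<rho>) (A \<times> UNIV) \<le> emeasure \<gamma> A) \<and>
    (\<forall>B\<in>sets borel. emeasure (borel_extension \<rho>) (UNIV \<times> B) \<le> emeasure \<eta> B)"
  unfolding Polh_def by (auto simp: haar_onD(3))

text \<open>Domination by \<gamma> gives properness of \<open>R\<close>, and domination by \<eta>
  that of the converse. The constants then exist, and the definite descriptions denote them.\<close>

lemma PolhD:
  fixes \<gamma> :: "'g::lcsc_group measure" and \<eta> :: "'h::lcsc_group measure"
  assumes "PH R \<rho> \<in> Polh \<gamma> \<eta>" "unimodular_haar \<gamma>" "unimodular_haar \<eta>"
  shows "biproper R" "haar_on R \<rho>" "lhaar R (borel_extension \<rho>)"
    "alpha_const \<gamma> R (borel_extension \<rho>) (ph_alpha \<gamma> R \<rho>)" "beta_const \<eta> R (borel_extension \<rho>) (ph_beta \<eta> R \<rho>)"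
    "ph_alpha \<gamma> R \<rho> \<le> 1" "ph_beta \<eta> R \<rho> \<le> 1"
proof -
  have R: "is_subgroup R" "closed R" "haar_on R \<rho>"
    and dom: "\<forall>A\<in>sets borel. emeasure (borel_extension \<rho>) (A \<times> UNIV) \<le> emeasure \<gamma> A"
      "\<forall>B\<in>sets borel. emeasure (borel_extension \<rho>) (UNIV \<times> B) \<le> emeasure \<eta> B"
    using assms(1) unfolding PH_in_Polh_iff by auto
  show "haar_on R \<rho>" by fact
  show lh: "lhaar R (borel_extension \<rho>)" by (rule lhaar_borel_extension[OF R(3,2,1)])
  note lc = lhaar_converse[OF lh R(2)]
  have dom': "\<forall>B\<in>sets borel. emeasure (distr (borel_extension \<rho>) borel prod.swap) (B \<times> UNIV) \<le> emeasure \<eta> B"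
    using dom(2) by (simp add: lc(2))
  have p1: "proper_subgroup R"
    using dom(1) by (intro proper_subgroup_if_dominated[OF R(1,2) lh unimodular_haarD(1)[OF assms(2)]]) blast
  have p2: "proper_subgroup (R\<inverse>)"
    using dom' by (intro proper_subgroup_if_dominated[OF is_subgroup_converse[OF R(1)] lc(3,1)
        unimodular_haarD(1)[OF assms(3)]]) blast
  show bi: "biproper R" using p1 p2 by (simp add: biproper_def)
  obtain a where a: "alpha_const \<gamma> R (borel_extension \<rho>) a" using alpha_const_exists[OF p1 lh assms(2)] by blast
  obtain b where b: "alpha_const \<eta> (R\<inverse>) (distr (borel_extension \<rho>) borel prod.swap) b"
    using alpha_const_exists[OF p2 lc(1) assms(3)] by blast
  then have b': "beta_const \<eta> R (borel_extension \<rho>) b" unfolding beta_const_iff_converse[OF lh R(2)] .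
  show "alpha_const \<gamma> R (borel_extension \<rho>) (ph_alpha \<gamma> R \<rho>)" using a ph_alpha_eq[OF p1 assms(2) R(3) a] by simp
  show "beta_const \<eta> R (borel_extension \<rho>) (ph_beta \<eta> R \<rho>)" using b' ph_beta_eq[OF bi assms(3) R(3) b'] by simp
  show "ph_alpha \<gamma> R \<rho> \<le> 1"
    using alpha_const_le_1[OF a proper_subgroupD(3)[OF p1] R(1) assms(2)] dom(1)
      ph_alpha_eq[OF p1 assms(2) R(3) a] by simp
  show "ph_beta \<eta> R \<rho> \<le> 1"
    using alpha_const_le_1[OF b proper_subgroupD(3)[OF p2] is_subgroup_converse[OF R(1)] assms(3)] dom'
      ph_beta_eq[OF bi assms(3) R(3) b'] by simp
qed

text \<open>Haar measures on such a subgroup are proportional, with the ratio of their constants. So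
  a normalization determines the measure, and equality of products reduces to equality of
  numbers.\<close>

lemma haar_on_eq_if_ph_alpha:
  fixes S :: "('g::lcsc_group \<times> 'h::lcsc_group) set" and \<gamma> :: "'g measure"
  assumes "proper_subgroup S" "unimodular_haar \<gamma>" "haar_on S \<rho>" "haar_on S \<rho>'"
    "ph_alpha \<gamma> S \<rho> = ph_alpha \<gamma> S \<rho>'"
  shows "\<rho> = \<rho>'"
proof -
  note P = proper_subgroupD[OF assms(1)]
  note lh = lhaar_borel_extension[OF assms(3) P(2,1)] and lh' = lhaar_borel_extension[OF assms(4) P(2,1)]
  obtain a where a: "alpha_const \<gamma> S (borel_extension \<rho>) a" using alpha_const_exists[OF assms(1) lh assms(2)] by blast
  obtain a' where a': "alpha_const \<gamma> S (borel_extension \<rho>') a'" using alpha_const_exists[OF assms(1) lh' assms(2)] by blast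
  have "a = a'" using ph_alpha_eq[OF assms(1,2,3) a] ph_alpha_eq[OF assms(1,2,4) a'] assms(5) by simp
  then show ?thesis
    using lhaar_eq_if_alpha_const[OF assms(1,2) lh lh' a] a' by (intro haar_on_eqI[OF assms(3,4) P(2)]) simp
qed

lemma haar_on_eq_if_ph_beta:
  fixes S :: "('g::lcsc_group \<times> 'h::lcsc_group) set" and \<eta> :: "'h measure"
  assumes "biproper S" "unimodular_haar \<eta>" "haar_on S \<rho>" "haar_on S \<rho>'"
    "ph_beta \<eta> S \<rho> = ph_beta \<eta> S \<rho>'"
  shows "\<rho> = \<rho>'"
proof -
  have p: "proper_subgroup S" "proper_subgroup (S\<inverse>)" using assms(1) by (auto simp: biproper_def)
  note P = proper_subgroupD[OF p(1)]
  note lh = lhaar_borel_extension[OF assms(3) P(2,1)] and lh' = lhaar_borel_extension[OF assms(4) P(2,1)]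
  obtain b where b: "beta_const \<eta> S (borel_extension \<rho>) b"
    using alpha_const_exists[OF p(2) lhaar_converse(1)[OF lh P(2)] assms(2)]
    unfolding beta_const_iff_converse[OF lh P(2)] by blast
  obtain b' where b': "beta_const \<eta> S (borel_extension \<rho>') b'"
    using alpha_const_exists[OF p(2) lhaar_converse(1)[OF lh' P(2)] assms(2)]
    unfolding beta_const_iff_converse[OF lh' P(2)] by blast
  have "b = b'" using ph_beta_eq[OF assms(1,2,3) b] ph_beta_eq[OF assms(1,2,4) b'] assms(5) by simp
  then show ?thesis
    using lhaar_eq_if_beta_const[OF p(2) P(2) assms(2) lh lh' b] b'
    by (intro haar_on_eqI[OF assms(3,4) P(2)]) simp
qed

text \<open>Either normalization alone singles out one and the same \<sigma>. This is the
  consistency of the two, and it makes the definite description in \<open>ph_mult\<close>, which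
  asks for both, denote \<sigma>. Finiteness of the sets of cosets gives the indices their
  meaning.\<close>

lemma product_well_defined:
  fixes \<gamma> :: "'g::lcsc_group measure" and \<eta> :: "'h::lcsc_group measure" and \<kappa> :: "'k::lcsc_group measure"
  assumes uni: "unimodular_haar \<gamma>" "unimodular_haar \<eta>" "unimodular_haar \<kappa>"
    and R: "PH R \<rho> \<in> Polh \<gamma> \<eta>" and T: "PH T \<tau> \<in> Polh \<eta> \<kappa>"
  shows "is_subgroup (R O T)" "closed (R O T)"
    "finite (left_cosets (indef R) (indef R \<inter> Domain T))"
    "finite (left_cosets (ker T) (ker T \<inter> Range R))"
    "\<exists>\<sigma>. (\<forall>\<sigma>'. haar_on (R O T) \<sigma>' \<and> alpha_normalized \<gamma> \<eta> T \<tau> R \<rho> \<sigma>' \<longleftrightarrow> \<sigma>' = \<sigma>) \<and>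
      (\<forall>\<sigma>'. haar_on (R O T) \<sigma>' \<and> beta_normalized \<eta> \<kappa> T \<tau> R \<rho> \<sigma>' \<longleftrightarrow> \<sigma>' = \<sigma>) \<and>
      PH (R O T) \<sigma> \<in> Polh \<gamma> \<kappa> \<and>
      ph_mult \<gamma> \<eta> \<kappa> (PH T \<tau>) (PH R \<rho>) = PH (R O T) \<sigma>"
proof -
  note r = PolhD[OF R uni(1,2)] and t = PolhD[OF T uni(2,3)]
  have pR: "proper_subgroup R" "proper_subgroup (R\<inverse>)" and pT: "proper_subgroup T" "proper_subgroup (T\<inverse>)"
    using r(1) t(1) by (auto simp: biproper_def)
  have bS: "biproper (R O T)" by (rule biproper_relcomp[OF r(1) t(1) r(3) t(3) uni(1,3)])
  then have pS: "proper_subgroup (R O T)" "proper_subgroup ((R O T)\<inverse>)" by (auto simp: biproper_def)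
  note PS = proper_subgroupD[OF pS(1)]
  show "is_subgroup (R O T)" "closed (R O T)" by (rule PS)+
  have ker: "indef (T\<inverse>) = ker T" by (simp add: indef_def ker_def)
  show f1: "finite (left_cosets (indef R) (indef R \<inter> Domain T))"
    by (intro finite_left_cosets_compact_open compact_indef pR is_subgroup_indef proper_subgroupD[OF pT(1)]
        proper_subgroupD[OF pR(1)])
  have RR: "open (Range R)" "is_subgroup (Range R)"
    using proper_subgroupD(3,5)[OF pR(2)] by simp_all
  show f2: "finite (left_cosets (ker T) (ker T \<inter> Range R))"
    unfolding ker[symmetric]
    by (intro finite_left_cosets_compact_open compact_indef pT is_subgroup_indef RR proper_subgroupD[OF pT(2)])
  define n where "n = subgroup_index (indef R) (indef R \<inter> Domain T)"
  define n' where "n' = subgroup_index (ker T) (ker T \<inter> Range R)"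
  have n: "1 \<le> n" "1 \<le> n'"
    using index_pos[OF f1 is_subgroup_indef[OF proper_subgroupD(1)[OF pR(1)]]]
      index_pos[OF f2, unfolded ker[symmetric], OF is_subgroup_indef[OF proper_subgroupD(1)[OF pT(2)]]]
    by (auto simp: n_def n'_def ker)
  define a where "a = ph_alpha \<gamma> R \<rho> * ph_alpha \<eta> T \<tau> / n"
  define b where "b = ph_beta \<eta> R \<rho> * ph_beta \<kappa> T \<tau> / n'"
  have pos: "0 < ph_alpha \<gamma> R \<rho>" "0 < ph_beta \<eta> R \<rho>" "0 < ph_alpha \<eta> T \<tau>" "0 < ph_beta \<kappa> T \<tau>"
    using r(4,5) t(4,5) by (auto simp: alpha_const_def beta_const_def)
  \<comment> \<open>Dividing by an index, which is at least 1, cannot increase the constants, so the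
    dominations survive.\<close>
  have le1: "x * y / real m \<le> 1" if "0 < x" "x \<le> 1" "0 < y" "y \<le> 1" "1 \<le> m" for x y :: real and m :: nat
    using that mult_le_one[of x y] by (simp add: divide_le_eq)
  have ab: "a \<le> 1" "b \<le> 1"
    unfolding a_def b_def
    by (rule le1[OF pos(1) r(6) pos(3) t(6) n(1)], rule le1[OF pos(2) r(7) pos(4) t(7) n(2)])
  obtain \<sigma>0 where \<sigma>0: "lhaar (R O T) \<sigma>0" "alpha_const \<gamma> (R O T) \<sigma>0 a" "beta_const \<kappa> (R O T) \<sigma>0 b"
    using product_measure_exists[OF r(1) t(1) r(3) t(3) uni r(4,5) t(4,5)]
    unfolding a_def b_def n_def n'_def by blast
  \<comment> \<open>The constructed measure lives on the ambient product; its restriction is the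
    Haar measure in the sense of \<open>haar_on\<close>.\<close>
  define \<sigma> where "\<sigma> = restrict_space \<sigma>0 (R O T)"
  have \<sigma>: "haar_on (R O T) \<sigma>" "borel_extension \<sigma> = \<sigma>0"
    unfolding \<sigma>_def by (rule haar_on_restrict[OF \<sigma>0(1) PS(2,1)])+
  have \<alpha>\<sigma>: "ph_alpha \<gamma> (R O T) \<sigma> = a"
    using \<sigma>0(2) by (intro ph_alpha_eq[OF pS(1) uni(1) \<sigma>(1)]) (simp add: \<sigma>)
  have \<beta>\<sigma>: "ph_beta \<kappa> (R O T) \<sigma> = b"
    using \<sigma>0(3) by (intro ph_beta_eq[OF bS uni(3) \<sigma>(1)]) (simp add: \<sigma>)
  have A: "haar_on (R O T) \<sigma>' \<and> alpha_normalized \<gamma> \<eta> T \<tau> R \<rho> \<sigma>' \<longleftrightarrow> \<sigma>' = \<sigma>" for \<sigma>'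
    using haar_on_eq_if_ph_alpha[OF pS(1) uni(1) _ \<sigma>(1), of \<sigma>'] \<sigma>(1) \<alpha>\<sigma>
    unfolding alpha_normalized_def a_def n_def by auto
  have B: "haar_on (R O T) \<sigma>' \<and> beta_normalized \<eta> \<kappa> T \<tau> R \<rho> \<sigma>' \<longleftrightarrow> \<sigma>' = \<sigma>" for \<sigma>'
    using haar_on_eq_if_ph_beta[OF bS uni(3) _ \<sigma>(1), of \<sigma>'] \<sigma>(1) \<beta>\<sigma>
    unfolding beta_normalized_def b_def n'_def by auto
  have "\<forall>A\<in>sets borel. emeasure \<sigma>0 (A \<times> UNIV) \<le> emeasure \<gamma> A"
    using alpha_const_le_1[OF \<sigma>0(2) PS(3,1) uni(1)] ab by blast
  moreover have "\<forall>B\<in>sets borel. emeasure (distr \<sigma>0 borel prod.swap) (B \<times> UNIV) \<le> emeasure \<kappa> B"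
    using alpha_const_le_1[OF \<sigma>0(3)[unfolded beta_const_iff_converse[OF \<sigma>0(1) PS(2)]]
        proper_subgroupD(3,1)[OF pS(2)] uni(3)] ab by blast
  ultimately have P: "PH (R O T) \<sigma> \<in> Polh \<gamma> \<kappa>"
    unfolding PH_in_Polh_iff using PS(1,2) \<sigma> by (simp add: lhaar_converse(2)[OF \<sigma>0(1) PS(2)])
  have "(THE \<sigma>. haar_on (R O T) \<sigma> \<and> alpha_normalized \<gamma> \<eta> T \<tau> R \<rho> \<sigma> \<and>
      beta_normalized \<eta> \<kappa> T \<tau> R \<rho> \<sigma>) = \<sigma>"
    using A B by (intro the_equality) blast+
  then show "\<exists>\<sigma>. (\<forall>\<sigma>'. haar_on (R O T) \<sigma>' \<and> alpha_normalized \<gamma> \<eta> T \<tau> R \<rho> \<sigma>' \<longleftrightarrow> \<sigma>' = \<sigma>) \<and>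
      (\<forall>\<sigma>'. haar_on (R O T) \<sigma>' \<and> beta_normalized \<eta> \<kappa> T \<tau> R \<rho> \<sigma>' \<longleftrightarrow> \<sigma>' = \<sigma>) \<and>
      PH (R O T) \<sigma> \<in> Polh \<gamma> \<kappa> \<and>
      ph_mult \<gamma> \<eta> \<kappa> (PH T \<tau>) (PH R \<rho>) = PH (R O T) \<sigma>"
    using A B P by (intro exI[of _ \<sigma>]) simp
qed

lemma ph_mult_PH:
  fixes \<gamma> :: "'g::lcsc_group measure" and \<eta> :: "'h::lcsc_group measure" and \<kappa> :: "'k::lcsc_group measure"
  assumes "unimodular_haar \<gamma>" "unimodular_haar \<eta>" "unimodular_haar \<kappa>"
    and "PH R \<rho> \<in> Polh \<gamma> \<eta>" "PH T \<tau> \<in> Polh \<eta> \<kappa>"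
  obtains \<sigma> where "ph_mult \<gamma> \<eta> \<kappa> (PH T \<tau>) (PH R \<rho>) = PH (R O T) \<sigma>" "PH (R O T) \<sigma> \<in> Polh \<gamma> \<kappa>"
    "ph_alpha \<gamma> (R O T) \<sigma> =
      ph_alpha \<gamma> R \<rho> * ph_alpha \<eta> T \<tau> / real (subgroup_index (indef R) (indef R \<inter> Domain T))"
proof -
  obtain \<sigma> where \<sigma>: "\<forall>\<sigma>'. haar_on (R O T) \<sigma>' \<and> alpha_normalized \<gamma> \<eta> T \<tau> R \<rho> \<sigma>' \<longleftrightarrow> \<sigma>' = \<sigma>"
    "PH (R O T) \<sigma> \<in> Polh \<gamma> \<kappa>" "ph_mult \<gamma> \<eta> \<kappa> (PH T \<tau>) (PH R \<rho>) = PH (R O T) \<sigma>"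
    using product_well_defined(5)[OF assms] by (elim exE conjE) (rule that)
  from \<sigma>(1) have "alpha_normalized \<gamma> \<eta> T \<tau> R \<rho> \<sigma>" by blast
  then show ?thesis using that[OF \<sigma>(3,2)] by (simp add: alpha_normalized_def)
qed

text \<open>Relational composition is associative, so both sides have the same underlying subgroup,
  and their measures agree once the values of \<open>ph_alpha\<close> do. These are one triple
  product divided by two products of indices, which are equal by \<open>index_relcomp\<close> for
  the open subgroup \<open>Domain S\<close>.\<close>

lemma ph_mult_assoc_PH:
  fixes \<gamma> :: "'g::lcsc_group measure" and \<eta> :: "'h::lcsc_group measure"
    and \<kappa> :: "'k::lcsc_group measure" and \<omega> :: "'l::lcsc_group measure"
  assumes uni: "unimodular_haar \<gamma>" "unimodular_haar \<eta>" "unimodular_haar \<kappa>" "unimodular_haar \<omega>"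
    and R: "PH R \<rho> \<in> Polh \<gamma> \<eta>" and T: "PH T \<tau> \<in> Polh \<eta> \<kappa>" and S: "PH S \<sigma> \<in> Polh \<kappa> \<omega>"
  shows "ph_mult \<gamma> \<eta> \<omega> (ph_mult \<eta> \<kappa> \<omega> (PH S \<sigma>) (PH T \<tau>)) (PH R \<rho>) =
    ph_mult \<gamma> \<kappa> \<omega> (PH S \<sigma>) (ph_mult \<gamma> \<eta> \<kappa> (PH T \<tau>) (PH R \<rho>))"
proof -
  obtain \<mu> where \<mu>: "ph_mult \<gamma> \<eta> \<kappa> (PH T \<tau>) (PH R \<rho>) = PH (R O T) \<mu>" "PH (R O T) \<mu> \<in> Polh \<gamma> \<kappa>"
    "ph_alpha \<gamma> (R O T) \<mu> =
      ph_alpha \<gamma> R \<rho> * ph_alpha \<eta> T \<tau> / real (subgroup_index (indef R) (indef R \<inter> Domain T))"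
    by (rule ph_mult_PH[OF uni(1,2,3) R T]) (rule that)
  obtain \<nu> where \<nu>: "ph_mult \<eta> \<kappa> \<omega> (PH S \<sigma>) (PH T \<tau>) = PH (T O S) \<nu>" "PH (T O S) \<nu> \<in> Polh \<eta> \<omega>"
    "ph_alpha \<eta> (T O S) \<nu> =
      ph_alpha \<eta> T \<tau> * ph_alpha \<kappa> S \<sigma> / real (subgroup_index (indef T) (indef T \<inter> Domain S))"
    by (rule ph_mult_PH[OF uni(2,3,4) T S]) (rule that)
  obtain \<sigma>1 where \<sigma>1: "ph_mult \<gamma> \<eta> \<omega> (PH (T O S) \<nu>) (PH R \<rho>) = PH (R O (T O S)) \<sigma>1"
    "PH (R O (T O S)) \<sigma>1 \<in> Polh \<gamma> \<omega>"
    "ph_alpha \<gamma> (R O (T O S)) \<sigma>1 =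
      ph_alpha \<gamma> R \<rho> * ph_alpha \<eta> (T O S) \<nu> / real (subgroup_index (indef R) (indef R \<inter> Domain (T O S)))"
    by (rule ph_mult_PH[OF uni(1,2,4) R \<nu>(2)]) (rule that)
  obtain \<sigma>2 where \<sigma>2: "ph_mult \<gamma> \<kappa> \<omega> (PH S \<sigma>) (PH (R O T) \<mu>) = PH ((R O T) O S) \<sigma>2"
    "PH ((R O T) O S) \<sigma>2 \<in> Polh \<gamma> \<omega>"
    "ph_alpha \<gamma> ((R O T) O S) \<sigma>2 =
      ph_alpha \<gamma> (R O T) \<mu> * ph_alpha \<kappa> S \<sigma> / real (subgroup_index (indef (R O T)) (indef (R O T) \<inter> Domain S))"
    by (rule ph_mult_PH[OF uni(1,3,4) \<mu>(2) S]) (rule that)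
  have sg: "is_subgroup R" "is_subgroup T" "is_subgroup S"
    using R T S by (simp_all add: PH_in_Polh_iff)
  have "T\<inverse> `` Domain S = Domain (T O S)" by auto
  then have "subgroup_index (indef R) (indef R \<inter> Domain (T O S)) * subgroup_index (indef T) (indef T \<inter> Domain S) =
      subgroup_index (indef (R O T)) (indef (R O T) \<inter> Domain S) * subgroup_index (indef R) (indef R \<inter> Domain T)"
    using index_relcomp[OF sg(1,2) is_subgroup_Domain[OF sg(3)]] by simp
  then have idx: "real (subgroup_index (indef R) (indef R \<inter> Domain (T O S))) *
      real (subgroup_index (indef T) (indef T \<inter> Domain S)) =
      real (subgroup_index (indef (R O T)) (indef (R O T) \<inter> Domain S)) *
      real (subgroup_index (indef R) (indef R \<inter> Domain T))"
    by (simp only: of_nat_mult[symmetric])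
  have as: "(R O T) O S = R O (T O S)" by (rule O_assoc)
  have frac: "r * (t * s / n2) / n1 = r * t / n4 * s / n3" if "n1 * n2 = n3 * n4"
    for r t s n1 n2 n3 n4 :: real
  proof -
    have "r * (t * s / n2) / n1 = r * t * s / (n1 * n2)" by (simp add: mult_ac)
    also have "\<dots> = r * t / n4 * s / n3" unfolding that by (simp add: mult_ac)
    finally show ?thesis .
  qed
  have "ph_alpha \<gamma> (R O (T O S)) \<sigma>1 = ph_alpha \<gamma> (R O (T O S)) \<sigma>2"
    unfolding \<sigma>1(3) \<sigma>2(3)[unfolded as] \<mu>(3) \<nu>(3) by (rule frac[OF idx])
  moreover have "haar_on (R O (T O S)) \<sigma>1" "haar_on (R O (T O S)) \<sigma>2"
    using \<sigma>1(2) \<sigma>2(2) unfolding as PH_in_Polh_iff by blast+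
  moreover have "proper_subgroup (R O (T O S))"
    using PolhD(1)[OF \<sigma>1(2) uni(1,4)] by (simp add: biproper_def)
  ultimately have "\<sigma>1 = \<sigma>2" using haar_on_eq_if_ph_alpha uni(1) by blast
  then show ?thesis unfolding \<mu>(1) \<nu>(1) \<sigma>1(1) \<sigma>2(1) as by simp
qed

theorem lemma1p3:
  fixes \<gamma> :: "'g::lcsc_group measure" and \<eta> :: "'h::lcsc_group measure"
    and \<kappa> :: "'k::lcsc_group measure" and \<omega> :: "'l::lcsc_group measure"
  shows
    "(unimodular_haar \<gamma> \<and> unimodular_haar \<eta> \<and> unimodular_haar \<kappa> \<longrightarrow>
       (\<forall>R \<rho> T \<tau>. PH R \<rho> \<in> Polh \<gamma> \<eta> \<and> PH T \<tau> \<in> Polh \<eta> \<kappa> \<longrightarrow>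
          is_subgroup (R O T) \<and> closed (R O T) \<and>
          finite (left_cosets (indef R) (indef R \<inter> Domain T)) \<and>
          finite (left_cosets (ker T) (ker T \<inter> Range R)) \<and>
          (\<exists>\<sigma>. (\<forall>\<sigma>'. haar_on (R O T) \<sigma>' \<and> alpha_normalized \<gamma> \<eta> T \<tau> R \<rho> \<sigma>' \<longleftrightarrow> \<sigma>' = \<sigma>) \<and>
               (\<forall>\<sigma>'. haar_on (R O T) \<sigma>' \<and> beta_normalized \<eta> \<kappa> T \<tau> R \<rho> \<sigma>' \<longleftrightarrow> \<sigma>' = \<sigma>) \<and>
               PH (R O T) \<sigma> \<in> Polh \<gamma> \<kappa> \<and>
               ph_mult \<gamma> \<eta> \<kappa> (PH T \<tau>) (PH R \<rho>) = PH (R O T) \<sigma>)))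
     \<and>
     (unimodular_haar \<gamma> \<and> unimodular_haar \<eta> \<and> unimodular_haar \<kappa> \<and> unimodular_haar \<omega> \<longrightarrow>
       (\<forall>R\<in>Polh \<gamma> \<eta>. \<forall>T\<in>Polh \<eta> \<kappa>. \<forall>S\<in>Polh \<kappa> \<omega>.
          ph_mult \<gamma> \<eta> \<omega> (ph_mult \<eta> \<kappa> \<omega> S T) R = ph_mult \<gamma> \<kappa> \<omega> S (ph_mult \<gamma> \<eta> \<kappa> T R)))"
proof (intro conjI impI allI ballI; (elim conjE)?)
  fix R \<rho> T \<tau>
  assume "unimodular_haar \<gamma>" "unimodular_haar \<eta>" "unimodular_haar \<kappa>"
    "PH R \<rho> \<in> Polh \<gamma> \<eta>" "PH T \<tau> \<in> Polh \<eta> \<kappa>"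
  note wd = product_well_defined[OF this]
  show "is_subgroup (R O T)" "closed (R O T)"
    "finite (left_cosets (indef R) (indef R \<inter> Domain T))"
    "finite (left_cosets (ker T) (ker T \<inter> Range R))"
    "\<exists>\<sigma>. (\<forall>\<sigma>'. haar_on (R O T) \<sigma>' \<and> alpha_normalized \<gamma> \<eta> T \<tau> R \<rho> \<sigma>' \<longleftrightarrow> \<sigma>' = \<sigma>) \<and>
      (\<forall>\<sigma>'. haar_on (R O T) \<sigma>' \<and> beta_normalized \<eta> \<kappa> T \<tau> R \<rho> \<sigma>' \<longleftrightarrow> \<sigma>' = \<sigma>) \<and>
      PH (R O T) \<sigma> \<in> Polh \<gamma> \<kappa> \<and>
      ph_mult \<gamma> \<eta> \<kappa> (PH T \<tau>) (PH R \<rho>) = PH (R O T) \<sigma>"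
    by (rule wd)+
next
  fix R T S
  assume uni: "unimodular_haar \<gamma>" "unimodular_haar \<eta>" "unimodular_haar \<kappa>" "unimodular_haar \<omega>"
    and mem: "R \<in> Polh \<gamma> \<eta>" "T \<in> Polh \<eta> \<kappa>" "S \<in> Polh \<kappa> \<omega>"
  show "ph_mult \<gamma> \<eta> \<omega> (ph_mult \<eta> \<kappa> \<omega> S T) R = ph_mult \<gamma> \<kappa> \<omega> S (ph_mult \<gamma> \<eta> \<kappa> T R)"
  proof (cases "R = ZeroPH \<or> T = ZeroPH \<or> S = ZeroPH")
    case True
    \<comment> \<open>With a zero factor both sides reduce to \<open>ZeroPH\<close> by the equations
      of \<open>ph_mult\<close>.\<close>
    then show ?thesis by (cases R; cases T; cases S) auto
  next
    case False
    then obtain R' \<rho> T' \<tau> S' \<sigma> where eq: "R = PH R' \<rho>" "T = PH T' \<tau>" "S = PH S' \<sigma>"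
      by (cases R; cases T; cases S) auto
    show ?thesis using mem unfolding eq by (rule ph_mult_assoc_PH[OF uni])
  qed
qed

end
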